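(* Let $\alpha\in(0,1)$ and let $X_1,X_2,\dots$ be i.i.d. nonnegative random variables with $n^{-1/\alpha}\Sigma_n\Longrightarrow S_{\alpha,1}$ as $n\to\infty$, where $\Sigma_k=X_1+\dots+X_k$ ($\Sigma_0=0$). Let $r>0$, $\alpha'\in\mathbb R\setminus\{0\}$, and for each $n\in\mathbb N$ let $N_{r,\alpha',1/n^{\alpha'}}$ have the generalized negative binomial distribution with parameters $r,\alpha',\mu=n^{-\alpha'}$, independent of $X_1,X_2,\dots$. Then $$\lim_{n\to\infty}\sup_{x\ge0}\big|\mathsf P\big(\Sigma_{N_{r,\alpha',1/n^{\alpha'}}}<n^{1/\alpha}x\big)-A(x;r,\alpha,\alpha')\big|=0,$$ where $$A(x;r,\alpha,\alpha')=\mathsf P\big(S_{\alpha,1}G_{r,1}^{1/(\alpha\alpha')}<x\big)=\frac1{\Gamma(r)}\int_0^\infty F(xz^{-1/(\alpha\alpha')};\alpha,1)z^{r-1}e^{-z}\,dz,\quad x\ge0,$$ with $S_{\alpha,1}$ and $G_{r,1}$ independent. If, moreover, $r\in(0,1)$ and $\alpha'\in(0,1]$, then $A(\cdot;r,\alpha,\alpha')$ is mixed exponential and hence infinitely divisible, and $$S_{\alpha,1}G_{r,1}^{1/(\alpha\alpha')}\stackrel{d}{=}S_{\alpha,1}(G^*_{r,\alpha',1})^{1/\alpha}\stackrel{d}{=}\frac{W_1^{1/\alpha}S_{\alpha,1}}{S_{\alpha',1}^{1/\alpha}Z_{r,1}^{1/(\alpha\alpha')}}\stackrel{d}{=}\frac{W_\alpha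 S_{\alpha,1}}{S_{\alpha',1}^{1/\alpha}Z_{r,1}^{1/(\alpha\alpha')}}\stackrel{d}{=}\frac{R_\alpha W_1}{S_{\alpha',1}^{1/\alpha}Z_{r,1}^{1/(\alpha\alpha')}}\stackrel{d}{=}\frac{M_\alpha}{S_{\alpha',1}^{1/\alpha}Z_{r,1}^{1/(\alpha\alpha')}}$$ $$\stackrel{d}{=}\frac{|X|\sqrt{2W_1}\,R_\alpha}{S_{\alpha',1}^{1/\alpha}Z_{r,1}^{1/(\alpha\alpha')}}\stackrel{d}{=}\frac{|\Lambda|R_\alpha}{S_{\alpha',1}^{1/\alpha}Z_{r,1}^{1/(\alpha\alpha')}}\stackrel{d}{=}S_{\alpha,1}\Big(\frac{W_{\alpha'}}{Z_{r,1}^{1/\alpha'}}\Big)^{1/\alpha}\stackrel{d}{=}\frac{S_{\alpha,1}W_{\alpha\alpha'}}{Z_{r,1}^{1/(\alpha\alpha')}},$$ where in each term the factors are independent.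
   Context: For $0<\alpha\le1$, $S_{\alpha,1}$ denotes a random variable with the one-sided strictly stable characteristic function $\exp\{-|t|^{\alpha}\exp(-\tfrac12 i\pi\alpha\,\mathrm{sign}\,t)\}$ (degenerate at $1$ when $\alpha=1$), with distribution function $F(x;\alpha,1)$. The generalized gamma density is $g^*(x;r,\alpha,\lambda)=\frac{|\alpha|\lambda^r}{\Gamma(r)}x^{\alpha r-1}e^{-\lambda x^{\alpha}}$, $x\ge0$, $G^*_{r,\alpha,\lambda}$ a random variable with this density. $N_{r,\alpha,\mu}$ has the generalized negative binomial distribution $\mathsf P(N_{r,\alpha,\mu}=k)=\frac1{k!}\int_0^\infty e^{-z}z^kg^*(z;r,\alpha,\mu)dz$. $G_{s,1}$ is gamma with density $\frac1{\Gamma(s)}x^{s-1}e^{-x}$. $W_1$ is standard exponential, $W_\beta$ ($\beta>0$) has distribution function $1-e^{-x^{\beta}}$, $x\ge0$. $Z_{r,1}=(G_{r,1}+G_{1-r,1})/G_{r,1}$ with independent gamma factors. $R_\alpha=S_{\alpha,1}/S'_{\alpha,1}$ is the ratio of two independent copies of $S_{\alpha,1}$. $M_\alpha$ has the Mittag-Leffler distribution with Laplace transform $1/(1+s^{\alpha})$, $s\ge0$. $X$ is standard normal, and $\Lambda$ has the Laplace density $\frac12e^{-|x|}$. A distribution is mixed exponential if it is the law of $W_1/V$ with $V>0$ independent of $W_1$. *)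

theory Defs
  imports "HOL-Probability.Probability"
begin

(* One-sided strictly stable law S_{alpha,1}, given by its characteristic function
   exp{-|t|^alpha exp(-i pi alpha sign t / 2)}  (degenerate at 1 when alpha = 1). *)
definition one_sided_stable :: "real \<Rightarrow> real measure \<Rightarrow> bool" where
  "one_sided_stable \<alpha> M \<longleftrightarrow> real_distribution M \<and>
     (\<forall>t. char M t = exp (- complex_of_real (\<bar>t\<bar> powr \<alpha>) *
                           exp (- (\<i> * complex_of_real (pi * \<alpha> * sgn t / 2)))))"

definition gg_density :: "real \<Rightarrow> real \<Rightarrow> real \<Rightarrow> real \<Rightarrow> real" where
  "gg_density r \<alpha> lam x = (if x \<ge> 0 then
      \<bar>\<alpha>\<bar> * lam powr r / Gamma r * x powr (\<alpha> * r - 1) * exp (- lam * x powr \<alpha>) else 0)"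

definition gen_gamma :: "real \<Rightarrow> real \<Rightarrow> real \<Rightarrow> real measure" where
  "gen_gamma r \<alpha> lam = density lborel (\<lambda>x. ennreal (gg_density r \<alpha> lam x))"

definition gamma_law :: "real \<Rightarrow> real measure" where
  "gamma_law s = density lborel
     (\<lambda>x. ennreal (if x \<ge> 0 then x powr (s - 1) * exp (- x) / Gamma s else 0))"

(* W_beta: distribution function 1 - exp(-x^beta), x >= 0; given by its density.
   W_1 is the standard exponential law. *)
definition weibull_law :: "real \<Rightarrow> real measure" where
  "weibull_law \<beta> = density lborel
     (\<lambda>x. ennreal (if x \<ge> 0 then \<beta> * x powr (\<beta> - 1) * exp (- (x powr \<beta>)) else 0))"

definition Z_law :: "real \<Rightarrow> real measure" where
  "Z_law r = distr (gamma_law r \<Otimes>\<^sub>M gamma_law (1 - r)) borel (\<lambda>(a, b). (a + b) / a)"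

definition ratio_law :: "real measure \<Rightarrow> real measure" where
  "ratio_law S = distr (S \<Otimes>\<^sub>M S) borel (\<lambda>(s, s'). s / s')"

definition mittag_leffler :: "real \<Rightarrow> real measure \<Rightarrow> bool" where
  "mittag_leffler \<alpha> M \<longleftrightarrow> real_distribution M \<and> (AE x in M. x \<ge> 0) \<and>
     (\<forall>s\<ge>0. (\<integral>x. exp (- s * x) \<partial>M) = 1 / (1 + s powr \<alpha>))"

definition std_normal_law :: "real measure" where
  "std_normal_law = density lborel (\<lambda>x. ennreal (normal_density 0 1 x))"

definition laplace_law :: "real measure" where
  "laplace_law = density lborel (\<lambda>x. ennreal (exp (- \<bar>x\<bar>) / 2))"

definition mixed_exponential :: "real measure \<Rightarrow> bool" where
  "mixed_exponential M \<longleftrightarrow> (\<exists>V. prob_space V \<and> sets V = sets borel \<and> (AE v in V. v > 0) \<and>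
      M = distr (weibull_law 1 \<Otimes>\<^sub>M V) borel (\<lambda>(w, v). w / v))"

fun conv_power :: "nat \<Rightarrow> real measure \<Rightarrow> real measure" where
  "conv_power 0 Q = return borel 0"
| "conv_power (Suc n) Q = convolution Q (conv_power n Q)"

definition infinitely_divisible :: "real measure \<Rightarrow> bool" where
  "infinitely_divisible M \<longleftrightarrow> (\<forall>n::nat. n \<ge> 1 \<longrightarrow>
      (\<exists>Q. real_distribution Q \<and> conv_power n Q = M))"

definition gen_neg_binomial :: "'s measure \<Rightarrow> ('s \<Rightarrow> nat) \<Rightarrow> real \<Rightarrow> real \<Rightarrow> real \<Rightarrow> bool" where
  "gen_neg_binomial M N r \<alpha> \<mu> \<longleftrightarrow> N \<in> measurable M (count_space UNIV) \<and>
     (\<forall>k. \<P>(\<omega> in M. N \<omega> = k) =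
        1 / fact k * (\<integral>z\<in>{0..}. exp (- z) * z ^ k * gg_density r \<alpha> \<mu> z \<partial>lborel))"

end

theory Submission
  imports Defs
begin

text \<open>All laws involved live on the half-line and are handled through their Laplace transforms. The
  one-sided stable law \<open>S\<close> of index \<open>\<alpha>\<close> is the weak limit of normalised sums of Sibuya variables; this
  gives its positivity and its Laplace transform \<open>exp (- s\<^sup>\<alpha>)\<close>. Conditioning on \<open>N\<close>, a mixed Poisson variable
  with mixing variable \<open>n U\<close>, where \<open>U = G\<^bsup>1/\<alpha>'\<^esup>\<close>, the Laplace transform of the normalised random sum is
  \<open>E exp (- n (1 - L (s / n\<^bsup>1/\<alpha>\<^esup>)) U)\<close>, and \<open>n (1 - L (s / n\<^bsup>1/\<alpha>\<^esup>))\<close> tends to \<open>s\<^sup>\<alpha>\<close> by the assumption on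
  the \<open>X\<^sub>i\<close>. The limit \<open>E exp (- s\<^sup>\<alpha> U)\<close> is the transform of \<open>S U\<^bsup>1/\<alpha>\<^esup>\<close>, whose distribution function is
  continuous, so the convergence is uniform.

  The product representations are identities in the commutative monoid of laws under multiplicative
  convolution. Infinite divisibility of a mixed exponential law follows by approximating it with mixed
  geometric laws: these are log-convex, so by Kaluza's theorem the roots of their generating functions
  have nonnegative coefficients.\<close>

section \<open>Laplace transforms of distributions on the half-line\<close>

text \<open>A characteristic function reveals neither the support of its law nor its Laplace
  transform, and \<open>S\<close> is given by one. Hence a detour through the closed right
  half-plane: a law with transform \<open>exp (- (z powr a))\<close> is built there, the imaginary
  axis identifies it with \<open>S\<close>, and the positive axis yields the real transform that
  everything else uses. This forces the Sibuya series to be summed on the closed disc, because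
  imaginary arguments land on its boundary. The limit of \<open>n (1 - L)\<close> is recovered from
  the powers \<open>L ^ n\<close>, which are the transforms of the normalised sums. That the limit
  law is mixed exponential is a claim free of any given stable law of index
  \<open>\<alpha>'\<close>, yet its mixing law contains such a factor; so stable laws of every index
  up to 1 have to be shown to exist. Kaluza's theorem concerns sequences, which is why the mixed
  exponential law is discretised: on a lattice its transform is a generating function whose formal
  root can be taken, and a compactness argument for Laplace transforms leads back to the continuous
  law.\<close>

definition nonneg_law :: "real measure \<Rightarrow> bool" where
  "nonneg_law M \<longleftrightarrow> real_distribution M \<and> (AE x in M. 0 \<le> x)"

definition laplace :: "real measure \<Rightarrow> real \<Rightarrow> real" where
  "laplace M s = (\<integral>x. exp (- s * x) \<partial>M)"

lemma nonneg_lawD: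
  assumes "nonneg_law M"
  shows "real_distribution M" "AE x in M. 0 \<le> x" "prob_space M" "sets M = sets borel" "space M = UNIV"
proof -
  show "real_distribution M" "AE x in M. 0 \<le> x"
    using assms by (auto simp: nonneg_law_def)
  then interpret real_distribution M by simp
  show "prob_space M" "sets M = sets borel" "space M = UNIV"
    by (auto intro: prob_space_axioms)
qed

lemma real_distributionI:
  "prob_space M \<Longrightarrow> sets M = sets borel \<Longrightarrow> real_distribution M"
  by (simp add: real_distribution_def real_distribution_axioms_def)

lemma AE_pair_measureI:
  assumes M: "prob_space M" and N: "prob_space N" and P: "AE x in M. P x" and Q: "AE y in N. Q y"
    and R: "\<And>x y. P x \<Longrightarrow> Q y \<Longrightarrow> R (x, y)" and meas: "{z \<in> space (M \<Otimes>\<^sub>M N). R z} \<in> sets (M \<Otimes>\<^sub>M N)"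
  shows "AE z in M \<Otimes>\<^sub>M N. R z"
proof -
  interpret M: prob_space M by fact
  interpret N: prob_space N by fact
  interpret pair_prob_space M N ..
  have "AE x in M. AE y in N. R (x, y)"
    using P
  proof eventually_elim
    case (elim x)
    show ?case using Q by eventually_elim (use elim R in auto)
  qed
  then show ?thesis using meas by (intro AE_pair_measure)
qed

lemma integrable_bounded_nonneg:
  fixes f :: "real \<Rightarrow> 'a::{banach, second_countable_topology}"
  assumes M: "nonneg_law M" and f[measurable]: "f \<in> borel_measurable borel"
    and B: "\<And>x. 0 \<le> x \<Longrightarrow> norm (f x) \<le> B"
  shows "integrable M f"
proof -
  interpret real_distribution M using M by (rule nonneg_lawD)
  show ?thesis
    using nonneg_lawD(2)[OF M] B
    by (intro integrable_const_bound[where B = B]) auto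
qed

lemma integrable_exp_nonneg:
  assumes "nonneg_law M" "0 \<le> s"
  shows "integrable M (\<lambda>x. exp (- s * x))"
  using assms by (intro integrable_bounded_nonneg[where B = 1]) auto

lemma laplace_0 [simp]:
  assumes "nonneg_law M"
  shows "laplace M 0 = 1"
proof -
  interpret real_distribution M using assms by (rule nonneg_lawD)
  show ?thesis using prob_space by (simp add: laplace_def)
qed

lemma laplace_pos:
  assumes M: "nonneg_law M" "0 \<le> s"
  shows "0 < laplace M s"
proof -
  interpret real_distribution M using M(1) by (rule nonneg_lawD)
  have "laplace M s \<noteq> 0"
  proof
    assume "laplace M s = 0"
    then have "AE x in M. exp (- s * x) = 0"
      using integral_nonneg_eq_0_iff_AE[OF integrable_exp_nonneg[OF M]]
      by (simp add: laplace_def)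
    then show False by simp
  qed
  moreover have "0 \<le> laplace M s"
    unfolding laplace_def by simp
  ultimately show ?thesis by simp
qed

lemma laplace_le_1:
  assumes M: "nonneg_law M" "0 \<le> s"
  shows "laplace M s \<le> 1"
proof -
  interpret real_distribution M using M(1) by (rule nonneg_lawD)
  have "laplace M s \<le> (\<integral>x. 1 \<partial>M)"
    unfolding laplace_def
    using nonneg_lawD(2)[OF M(1)] M(2)
    by (intro integral_mono_AE integrable_exp_nonneg[OF M]) auto
  then show ?thesis using prob_space by simp
qed

text \<open>With \<open>u = - ln t\<close> a step function of \<open>u\<close> becomes a function on
  the unit interval. It vanishes for \<open>u \<ge> y\<close>, that is, for all \<open>t\<close>
  near 0, so the value 0 at \<open>t = 0\<close> extends it continuously and Weierstrass applies on
  a compact interval.\<close>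

lemma continuous_on_cts_step_log:
  assumes "x < y"
  shows "continuous_on {0..1} (\<lambda>t. if t = 0 then 0 else cts_step x y (- ln t))"
    (is "continuous_on _ ?f")
proof -
  have cont: "continuous_on UNIV (cts_step x y)"
    using cts_step_uniformly_continuous[OF assms] by (rule uniformly_continuous_imp_continuous)
  have "continuous_on ({0..exp (-y)} \<union> {exp (-y)..1}) ?f"
  proof (rule continuous_on_closed_Un)
    have "?f t = 0" if "t \<in> {0..exp (-y)}" for t
    proof (cases "t = 0")
      case False
      then have "ln t \<le> ln (exp (-y))" using that by (subst ln_le_cancel_iff) auto
      then show ?thesis using assms by (auto simp: cts_step_def)
    qed simp
    then show "continuous_on {0..exp (-y)} ?f"
      using continuous_on_cong[of "{0..exp (-y)}" "{0..exp (-y)}" ?f "\<lambda>_. 0"] continuous_on_const by blast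
    have pos: "t \<noteq> 0" if "exp (- y) \<le> t" for t
      using that exp_gt_zero[of "-y"] by linarith
    have "continuous_on {exp (-y)..1} (\<lambda>t. cts_step x y (- ln t))"
      by (rule continuous_on_compose2[OF cont]) (auto intro!: continuous_intros dest: pos)
    then show "continuous_on {exp (-y)..1} ?f"
      by (rule continuous_on_eq) (auto dest: pos)
  qed auto
  then show ?thesis
    by (rule continuous_on_subset) auto
qed

text \<open>The functions \<open>e\<^sup>-\<^sup>k\<^sup>x\<close> span the polynomials in \<open>e\<^sup>-\<^sup>x \<in> [0,1]\<close>, which by Weierstrass
  approximate every step function uniformly.\<close>

theorem laplace_continuity:
  assumes Mn: "\<And>n. nonneg_law (Mn n)" and M: "nonneg_law M"
    and lim: "\<And>s. 0 < s \<Longrightarrow> (\<lambda>n. laplace (Mn n) s) \<longlonglongrightarrow> laplace M s"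
  shows "weak_conv_m Mn M"
proof (rule integral_cts_step_conv_imp_weak_conv)
  show "real_distribution (Mn n)" for n using Mn nonneg_lawD by blast
  show "real_distribution M" using M nonneg_lawD by blast
  fix x y :: real assume "x < y"
  define f where "f = (\<lambda>t. if t = 0 then 0 else cts_step x y (- ln t))"
  have f: "continuous_on {0..1} f"
    unfolding f_def by (rule continuous_on_cts_step_log) fact
  have f_exp: "f (exp (-u)) = cts_step x y u" for u
    by (simp add: f_def)
  show "(\<lambda>n. integral\<^sup>L (Mn n) (cts_step x y)) \<longlonglongrightarrow> integral\<^sup>L M (cts_step x y)"
  proof (rule tendstoI)
    fix e :: real assume "0 < e"
    then have "0 < e / 4" by simp
    \<comment> \<open>Three errors of \<open>e / 4\<close> will add up: replacing the step function
      by \<open>q\<close> under \<open>Mn n\<close> and under \<open>M\<close>, and the gap between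
      the two integrals of \<open>q\<close>, which are finite combinations of transforms at
      integers.\<close>
    obtain p where "real_polynomial_function p" and p: "\<And>t. t \<in> {0..1} \<Longrightarrow> \<bar>f t - p t\<bar> < e / 4"
      using Stone_Weierstrass_real_polynomial_function[OF compact_Icc f \<open>0 < e / 4\<close>] by blast
    then obtain a d where p_eq: "p = (\<lambda>x. \<Sum>i\<le>d. a i * x ^ i)"
      by (auto simp: real_polynomial_function_iff_sum)
    define q where "q u = (\<Sum>i\<le>d. a i * exp (- real i * u))" for u
    have q: "q u = p (exp (-u))" for u
      by (simp add: q_def p_eq exp_of_nat_mult[symmetric])
    have int_q: "integrable L q" and q_eq: "integral\<^sup>L L q = (\<Sum>i\<le>d. a i * laplace L (real i))"
      if L: "nonneg_law L" for L
    proof -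
      have *: "integrable L (\<lambda>u. a i * exp (- real i * u))" for i
        using integrable_exp_nonneg[OF L, of "real i"] by simp
      show "integrable L q"
        unfolding q_def by (intro Bochner_Integration.integrable_sum *)
      show "integral\<^sup>L L q = (\<Sum>i\<le>d. a i * laplace L (real i))"
        unfolding q_def laplace_def
        by (subst Bochner_Integration.integral_sum[OF *]) simp
    qed
    have close: "\<bar>integral\<^sup>L L (cts_step x y) - integral\<^sup>L L q\<bar> \<le> e / 4"
      if L: "nonneg_law L" for L
    proof -
      interpret real_distribution L using L by (rule nonneg_lawD)
      have int: "integrable L (cts_step x y)" using \<open>x < y\<close> by (rule integrable_cts_step)
      have "\<bar>integral\<^sup>L L (cts_step x y) - integral\<^sup>L L q\<bar> = \<bar>\<integral>u. cts_step x y u - q u \<partial>L\<bar>"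
        using int int_q[OF L] by simp
      also have "\<dots> \<le> (\<integral>u. \<bar>cts_step x y u - q u\<bar> \<partial>L)"
        by (rule integral_abs_bound)
      also have "\<dots> \<le> (\<integral>u. e / 4 \<partial>L)"
      proof (rule integral_mono_AE)
        show "AE u in L. \<bar>cts_step x y u - q u\<bar> \<le> e / 4"
          using nonneg_lawD(2)[OF L]
        proof eventually_elim
          fix u :: real assume "0 \<le> u"
          then show "\<bar>cts_step x y u - q u\<bar> \<le> e / 4"
            using p[of "exp (-u)"] by (simp add: q f_exp)
        qed
      qed (use int int_q[OF L] in auto)
      finally show ?thesis using prob_space by simp
    qed
    have "(\<lambda>n. integral\<^sup>L (Mn n) q) \<longlonglongrightarrow> integral\<^sup>L M q"
    proof -
      have "(\<lambda>n. laplace (Mn n) (real i)) \<longlonglongrightarrow> laplace M (real i)" for i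
        by (cases "i = 0") (use Mn M lim[of "real i"] in auto)
      then show ?thesis
        unfolding q_eq[OF Mn] q_eq[OF M] by (intro tendsto_intros)
    qed
    then have "\<forall>\<^sub>F n in sequentially. \<bar>integral\<^sup>L (Mn n) q - integral\<^sup>L M q\<bar> < e / 4"
      using \<open>0 < e / 4\<close> unfolding tendsto_iff dist_real_def by blast
    then show "\<forall>\<^sub>F n in sequentially. dist (integral\<^sup>L (Mn n) (cts_step x y)) (integral\<^sup>L M (cts_step x y)) < e"
    proof eventually_elim
      case (elim n)
      then show ?case
        using close[OF Mn, of n] close[OF M] \<open>0 < e\<close> unfolding dist_real_def by argo
    qed
  qed
qed

text \<open>By the continuity theorem the constant sequence \<open>M\<close> converges weakly to
  \<open>L\<close>; characteristic functions turn this into equality.\<close>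

theorem laplace_uniqueness:
  assumes M: "nonneg_law M" and L: "nonneg_law L"
    and eq: "\<And>s. 0 < s \<Longrightarrow> laplace M s = laplace L s"
  shows "M = L"
proof -
  have "weak_conv_m (\<lambda>_. M) L"
    by (rule laplace_continuity) (use M L eq in auto)
  then have "(\<lambda>_::nat. char M t) \<longlonglongrightarrow> char L t" for t
    by (intro levy_continuity1) (use M L nonneg_lawD in auto)
  then have "char M = char L"
    by (auto simp: LIMSEQ_const_iff)
  then show ?thesis
    by (intro Levy_uniqueness) (use M L nonneg_lawD in auto)
qed

section \<open>Weak limits and compactness on the half-line\<close>

text \<open>The bounded continuous function \<open>min 1 (max 0 (- x))\<close> is zero exactly on
  the half-line, so its integral detects mass on the negative axis and passes to the limit.\<close>

lemma weak_limit_nonneg: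
  assumes Mn: "\<And>n. nonneg_law (Mn n)" and M: "real_distribution M" and "weak_conv_m Mn M"
  shows "nonneg_law M"
proof -
  interpret real_distribution M by fact
  let ?f = "\<lambda>x::real. min 1 (max 0 (- x))"
  have "(\<lambda>n. integral\<^sup>L (Mn n) ?f) \<longlonglongrightarrow> integral\<^sup>L M ?f"
    by (rule weak_conv_imp_integral_bdd_continuous_conv[where B = 1])
       (use assms nonneg_lawD in \<open>auto intro!: continuous_intros\<close>)
  moreover have "integral\<^sup>L (Mn n) ?f = 0" for n
    using nonneg_lawD(2)[OF Mn, of n]
    by (intro integral_eq_zero_AE) (auto elim!: eventually_mono)
  ultimately have "integral\<^sup>L M ?f = 0"
    by (simp add: LIMSEQ_const_iff)
  moreover have "integrable M ?f"
    by (intro integrable_const_bound[where B = 1]) auto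
  ultimately have "AE x in M. ?f x = 0"
    by (subst (asm) integral_nonneg_eq_0_iff_AE) auto
  then have "AE x in M. 0 \<le> x"
    by eventually_elim linarith
  then show ?thesis using M by (simp add: nonneg_law_def)
qed

text \<open>Functions such as \<open>exp (- s * x)\<close> are bounded only on the half-line.
  Composing with \<open>max 0 x\<close> gives a globally bounded continuous function with the same
  integrals.\<close>

lemma weak_conv_integral_nonneg:
  fixes f :: "real \<Rightarrow> 'a::{banach, second_countable_topology}"
  assumes Mn: "\<And>n. nonneg_law (Mn n)" and M: "nonneg_law M" and wc: "weak_conv_m Mn M"
    and cont: "continuous_on UNIV f" and bound: "\<And>x. 0 \<le> x \<Longrightarrow> norm (f x) \<le> B"
  shows "(\<lambda>n. integral\<^sup>L (Mn n) f) \<longlonglongrightarrow> integral\<^sup>L M f"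
proof -
  let ?g = "\<lambda>x. f (max 0 x)"
  have meas: "f \<in> borel_measurable borel" "?g \<in> borel_measurable borel"
    using cont by (auto intro!: borel_measurable_continuous_onI continuous_on_compose2[OF cont] continuous_intros)
  have "(\<lambda>n. integral\<^sup>L (Mn n) ?g) \<longlonglongrightarrow> integral\<^sup>L M ?g"
  proof (rule weak_conv_imp_integral_bdd_continuous_conv[where B = B])
    have "continuous_on UNIV ?g"
      by (intro continuous_on_compose2[OF cont] continuous_intros) auto
    then show "isCont ?g x" for x
      using continuous_on_eq_continuous_at by blast
  qed (use assms nonneg_lawD in auto)
  moreover have "integral\<^sup>L L ?g = integral\<^sup>L L f" if L: "nonneg_law L" for L
    using meas nonneg_lawD(2,4)[OF L]
    by (intro integral_cong_AE) (auto cong: measurable_cong_sets elim!: eventually_mono)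
  ultimately show ?thesis using Mn M by simp
qed

lemma laplace_weak_conv:
  assumes "\<And>n. nonneg_law (Mn n)" "nonneg_law M" "weak_conv_m Mn M" "0 \<le> s"
  shows "(\<lambda>n. laplace (Mn n) s) \<longlonglongrightarrow> laplace M s"
  unfolding laplace_def
  by (rule weak_conv_integral_nonneg[where B = 1]) (use assms in \<open>auto intro!: continuous_intros\<close>)

text \<open>Markov's inequality for \<open>1 - exp (- s * x)\<close>, which exceeds
  \<open>1 - exp (- 1)\<close> beyond \<open>1 / s\<close>. The left end \<open>- 1\<close> serves
  to enclose 0 in an interval open on the left, the shape in which tightness is stated.\<close>

lemma laplace_tail_bound:
  assumes M: "nonneg_law M" and "0 < s"
  shows "measure M {- 1<..1 / s} \<ge> 1 - (1 - laplace M s) / (1 - exp (- 1))"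
proof -
  interpret real_distribution M using M by (rule nonneg_lawD)
  have "measure M {- 1<..1 / s} = measure M {..1 / s}"
    using nonneg_lawD(2)[OF M]
    by (intro finite_measure_eq_AE) (auto elim!: eventually_mono)
  have e: "0 < 1 - exp (- 1 :: real)" by simp
  have "(1 - exp (- 1)) * measure M {1 / s<..} = (\<integral>x. (1 - exp (- 1)) * indicator {1 / s<..} x \<partial>M)"
    by simp
  also have "\<dots> \<le> (\<integral>x. 1 - exp (- s * x) \<partial>M)"
  proof (rule integral_mono_AE)
    show "AE x in M. (1 - exp (- 1)) * indicator {1 / s<..} x \<le> 1 - exp (- s * x)"
      using nonneg_lawD(2)[OF M]
      by eventually_elim (use \<open>0 < s\<close> in \<open>auto simp: indicator_def field_simps\<close>)
  qed (use integrable_exp_nonneg[OF M, of s] \<open>0 < s\<close> in \<open>auto simp: emeasure_eq_measure\<close>)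
  also have "\<dots> = 1 - laplace M s"
    using integrable_exp_nonneg[OF M, of s] \<open>0 < s\<close> prob_space
    by (simp add: laplace_def)
  finally have "measure M {1 / s<..} \<le> (1 - laplace M s) / (1 - exp (- 1))"
    using e by (simp add: pos_le_divide_eq mult.commute)
  moreover have "measure M {..1 / s} = 1 - measure M {1 / s<..}"
  proof -
    have "{..1 / s} = space M - {1 / s<..}" by auto
    then show ?thesis using prob_compl[of "{1 / s<..}"] by simp
  qed
  ultimately show ?thesis
    using \<open>measure M {- 1<..1 / s} = measure M {..1 / s}\<close> by simp
qed

text \<open>If \<open>\<phi>\<close> tends to 1 at 0, no mass escapes to infinity: the tail bound at
  one small \<open>s\<close> gives tightness. A convergent subsequence has a limit with transform
  \<open>\<phi>\<close>, and the continuity theorem then extends the convergence to the whole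
  sequence.\<close>

theorem laplace_compactness:
  assumes Mn: "\<And>n. nonneg_law (Mn n)"
    and lim: "\<And>s. 0 < s \<Longrightarrow> (\<lambda>n. laplace (Mn n) s) \<longlonglongrightarrow> \<phi> s"
    and \<phi>: "(\<phi> \<longlongrightarrow> 1) (at_right 0)"
  obtains M where "nonneg_law M" "\<And>s. 0 < s \<Longrightarrow> laplace M s = \<phi> s"
    "weak_conv_m Mn M"
proof -
  have "tight Mn"
    unfolding tight_def
  proof (intro conjI allI impI)
    show "real_distribution (Mn n)" for n using Mn nonneg_lawD by blast
    fix e :: real assume "0 < e"
    let ?c = "1 - exp (- 1 :: real)"
    have c: "0 < ?c" by simp
    have "\<forall>\<^sub>F s in at_right 0. 1 - e * ?c < \<phi> s"
      using \<open>0 < e\<close> c by (intro order_tendstoD(1)[OF \<phi>]) (simp only: less_diff_eq, simp)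
    moreover have "\<forall>\<^sub>F s in at_right 0. (0::real) < s"
      by (simp add: eventually_at_right_less)
    ultimately have "\<forall>\<^sub>F s in at_right 0. 1 - e * ?c < \<phi> s \<and> 0 < s"
      by eventually_elim simp
    then obtain s where s: "1 - e * ?c < \<phi> s" "0 < s"
      using eventually_happens'[OF trivial_limit_at_right_real] by blast
    have "\<forall>\<^sub>F n in sequentially. 1 - e * ?c < laplace (Mn n) s"
      by (rule order_tendstoD(1)[OF lim]) (use s in auto)
    then obtain K where K: "\<And>n. n \<ge> K \<Longrightarrow> 1 - e * ?c < laplace (Mn n) s"
      by (auto simp: eventually_sequentially)
    have tail: "measure (Mn n) {- 1<..1 / s} > 1 - e" if "n \<ge> K" for n
    proof -
      have "(1 - laplace (Mn n) s) / ?c < e"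
        using K[OF that] c by (subst pos_divide_less_eq) (auto simp: algebra_simps)
      then show ?thesis using laplace_tail_bound[OF Mn s(2), of n] by simp
    qed
    have "\<exists>b. measure (Mn n) {- 1<..b} > 1 - e" for n
    proof -
      interpret real_distribution "Mn n" using Mn by (rule nonneg_lawD)
      have "\<forall>\<^sub>F b in at_top. 1 - e < cdf (Mn n) b"
        using \<open>0 < e\<close> by (intro order_tendstoD(1)[OF cdf_lim_at_top_prob]) simp
      then obtain b where "1 - e < cdf (Mn n) b"
        using eventually_happens'[OF trivial_limit_at_top_linorder] by blast
      moreover have "cdf (Mn n) b = measure (Mn n) {- 1<..b}"
        unfolding cdf_def using nonneg_lawD(2)[OF Mn, of n]
        by (intro finite_measure_eq_AE) (auto elim!: eventually_mono)
      ultimately show ?thesis by auto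
    qed
    then obtain b where b: "\<And>n. measure (Mn n) {- 1<..b n} > 1 - e" by metis
    \<comment> \<open>The tail bound holds for \<open>n \<ge> K\<close>; each of the finitely many
      earlier laws brings its own bound \<open>b n\<close>.\<close>
    let ?b = "Max (insert (1 / s) (b ` {..<K}))"
    have mono: "measure (Mn n) {- 1<..c} \<le> measure (Mn n) {- 1<..?b}" if "c \<le> ?b" for n c
    proof -
      interpret real_distribution "Mn n" using Mn by (rule nonneg_lawD)
      show ?thesis using that by (intro finite_measure_mono) auto
    qed
    show "\<exists>a b. a < b \<and> (\<forall>n. 1 - e < measure (Mn n) {a<..b})"
    proof (intro exI conjI allI)
      have "1 / s \<le> ?b" by (rule Max_ge) auto
      moreover have "0 < 1 / s" using s by simp
      ultimately show "- 1 < ?b" by linarith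
      fix n show "1 - e < measure (Mn n) {- 1<..?b}"
      proof (cases "n < K")
        case True
        then have "b n \<le> ?b" by (intro Max_ge) auto
        then show ?thesis using mono[of "b n" n] b[of n] by linarith
      next
        case False
        then show ?thesis using mono[OF \<open>1 / s \<le> ?b\<close>, of n] tail[of n] by linarith
      qed
    qed
  qed
  then obtain r M where r: "strict_mono (r :: nat \<Rightarrow> nat)" and M: "real_distribution M"
    and wc: "weak_conv_m (Mn \<circ> id \<circ> r) M"
    using tight_imp_convergent_subsubsequence[of Mn id] strict_mono_id by blast
  have M': "nonneg_law M"
    by (rule weak_limit_nonneg[OF _ M wc]) (simp add: Mn)
  have lap: "laplace M s = \<phi> s" if "0 < s" for s
  proof -
    have "(\<lambda>n. laplace ((Mn \<circ> id \<circ> r) n) s) \<longlonglongrightarrow> laplace M s"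
      by (rule laplace_weak_conv[OF _ M' wc]) (use that Mn in auto)
    moreover have "(\<lambda>n. laplace ((Mn \<circ> id \<circ> r) n) s) \<longlonglongrightarrow> \<phi> s"
      using LIMSEQ_subseq_LIMSEQ[OF lim[OF that] r] by (simp add: comp_def)
    ultimately show ?thesis by (rule LIMSEQ_unique)
  qed
  moreover have "weak_conv_m Mn M"
    by (rule laplace_continuity[OF Mn M']) (use lim lap in auto)
  ultimately show ?thesis using that M' by blast
qed

section \<open>Complex Laplace transforms and convolution\<close>

text \<open>At real points this is \<open>laplace\<close>, on the imaginary axis the characteristic
  function, so identities on the closed right half-plane translate between the two.\<close>

definition complex_laplace :: "real measure \<Rightarrow> complex \<Rightarrow> complex" where
  "complex_laplace M z = (\<integral>x. exp (- z * of_real x) \<partial>M)"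

lemma complex_laplace_of_real:
  "complex_laplace M (of_real s) = of_real (laplace M s)"
  unfolding complex_laplace_def laplace_def
  by (subst integral_complex_of_real[symmetric]) (simp flip: exp_of_real of_real_mult of_real_minus)

lemma char_eq_complex_laplace: "char M t = complex_laplace M (- (\<i> * of_real t))"
  by (simp add: char_def complex_laplace_def mult_ac)

lemma norm_exp_nonneg_le_1:
  assumes "0 \<le> Re z" "0 \<le> x"
  shows "norm (exp (- z * of_real x)) \<le> 1"
  using assms by (simp add: norm_exp_eq_Re)

lemma integrable_complex_exp:
  assumes "nonneg_law M" "0 \<le> Re z"
  shows "integrable M (\<lambda>x. exp (- z * of_real x))"
  using assms norm_exp_nonneg_le_1[OF assms(2)]
  by (intro integrable_bounded_nonneg[where B = 1]) auto

lemma complex_laplace_weak_conv: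
  assumes "\<And>n. nonneg_law (Mn n)" "nonneg_law M" "weak_conv_m Mn M" "0 \<le> Re z"
  shows "(\<lambda>n. complex_laplace (Mn n) z) \<longlonglongrightarrow> complex_laplace M z"
  unfolding complex_laplace_def
  by (rule weak_conv_integral_nonneg[where B = 1])
     (use assms norm_exp_nonneg_le_1[OF assms(4)] in \<open>auto intro!: continuous_intros\<close>)

lemma nonneg_law_distr:
  assumes "prob_space M" "f \<in> borel_measurable M" "AE x in M. 0 \<le> f x"
  shows "nonneg_law (distr M borel f)"
  using assms by (auto simp: nonneg_law_def AE_distr_iff intro!: real_distributionI prob_space.prob_space_distr)

lemma nonneg_law_convolution:
  assumes M: "nonneg_law M" and N: "nonneg_law N"
  shows "nonneg_law (M \<star> N)"
proof -
  interpret M: real_distribution M using M by (rule nonneg_lawD)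
  interpret N: real_distribution N using N by (rule nonneg_lawD)
  interpret P: pair_prob_space M N ..
  have "AE w in M \<Otimes>\<^sub>M N. 0 \<le> fst w + snd w"
    by (rule AE_pair_measureI[OF M.prob_space_axioms N.prob_space_axioms nonneg_lawD(2)[OF M] nonneg_lawD(2)[OF N]])
       (simp, measurable)
  then show ?thesis
    unfolding convolution_def
    by (intro nonneg_law_distr) (auto simp: case_prod_beta P.prob_space_axioms)
qed

lemma complex_laplace_convolution:
  assumes M: "nonneg_law M" and N: "nonneg_law N" and z: "0 \<le> Re z"
  shows "complex_laplace (M \<star> N) z = complex_laplace M z * complex_laplace N z"
proof -
  interpret M: real_distribution M using M by (rule nonneg_lawD)
  interpret N: real_distribution N using N by (rule nonneg_lawD)
  interpret P: pair_prob_space M N ..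
  note int = integrable_complex_exp[OF M z] integrable_complex_exp[OF N z]
  have "complex_laplace (M \<star> N) z = (\<integral>w. exp (- z * of_real (fst w)) * exp (- z * of_real (snd w)) \<partial>(M \<Otimes>\<^sub>M N))"
    unfolding complex_laplace_def convolution_def
    by (subst integral_distr) (auto simp: case_prod_beta exp_add[symmetric] algebra_simps)
  also have "\<dots> = (\<integral>x. \<integral>y. exp (- z * of_real x) * exp (- z * of_real y) \<partial>N \<partial>M)"
  proof (subst P.integral_fst'[symmetric])
    show "integrable (M \<Otimes>\<^sub>M N) (\<lambda>w. exp (- z * of_real (fst w)) * exp (- z * of_real (snd w)))"
      using int[THEN integrable_norm] int
      by (intro P.Fubini_integrable) (simp_all add: norm_mult)
  qed simp
  also have "\<dots> = complex_laplace M z * complex_laplace N z"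
    by (simp add: complex_laplace_def)
  finally show ?thesis .
qed

lemma nonneg_law_return: "0 \<le> c \<Longrightarrow> nonneg_law (return borel c)"
  by (simp add: nonneg_law_def AE_return prob_space_return real_distributionI)

lemma nonneg_law_conv_power:
  assumes "nonneg_law Q"
  shows "nonneg_law (conv_power n Q)"
  by (induction n) (auto intro: nonneg_law_return nonneg_law_convolution assms)

lemma complex_laplace_conv_power:
  assumes "nonneg_law Q" "0 \<le> Re z"
  shows "complex_laplace (conv_power n Q) z = complex_laplace Q z ^ n"
proof (induction n)
  case 0
  show ?case by (simp add: complex_laplace_def integral_return)
next
  case (Suc n)
  then show ?case
    using assms by (simp add: complex_laplace_convolution nonneg_law_conv_power)
qed

lemma laplace_conv_power:
  assumes "nonneg_law Q" "0 \<le> s"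
  shows "laplace (conv_power n Q) s = laplace Q s ^ n"
  using complex_laplace_conv_power[of Q "of_real s" n] assms
  by (simp add: complex_laplace_of_real flip: of_real_power)

lemma complex_laplace_scale:
  assumes "sets M = sets borel"
  shows "complex_laplace (distr M borel (\<lambda>x. x / c)) z = complex_laplace M (z / of_real c)"
  unfolding complex_laplace_def using assms
  by (subst integral_distr) (auto cong: measurable_cong_sets)

section \<open>One-sided stable laws\<close>

text \<open>The Sibuya law: the number of the first success in independent trials of which the
  \<open>j\<close>-th succeeds with probability \<open>a / j\<close>.\<close>

definition sibuya :: "real \<Rightarrow> nat \<Rightarrow> real" where
  "sibuya a k = (if k = 0 then 0 else - ((-1) ^ k * (a gchoose k)))"

lemma sibuya_Suc:
  assumes "k \<ge> 1"
  shows "sibuya a (Suc k) = sibuya a k * (real k - a) / real (Suc k)"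
  using assms by (simp add: sibuya_def gbinomial_prod_rev divide_simps) (simp add: algebra_simps)

lemma sibuya_nonneg:
  assumes "0 < a" "a < 1"
  shows "0 \<le> sibuya a k"
proof (induction k)
  case 0 show ?case by (simp add: sibuya_def)
next
  case (Suc k)
  show ?case
  proof (cases "k = 0")
    case True
    then show ?thesis using assms by (simp add: sibuya_def)
  next
    case False
    then show ?thesis using Suc assms by (subst sibuya_Suc) auto
  qed
qed

lemma sibuya_sums_open:
  assumes "norm (z::complex) < 1"
  shows "(\<lambda>k. of_real (sibuya a k) * z ^ k) sums (1 - (1 - z) powr of_real a)"
proof -
  have "(\<lambda>n. (of_real a gchoose n) * (- z) ^ n) sums (1 + (- z)) powr of_real a"
    using assms by (intro gen_binomial_complex) simp
  then have "(\<lambda>n. (if n = 0 then 1 else 0) - (of_real a gchoose n) * (- z) ^ n) sums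
      (1 - (1 - z) powr of_real a)"
    using sums_single[of 0 "\<lambda>_. 1::complex"] by (intro sums_diff) auto
  moreover have "(if n = 0 then 1 else 0) - (of_real a gchoose n) * (- z) ^ n = of_real (sibuya a n) * z ^ n" for n
    by (auto simp: sibuya_def power_minus[of z] gbinomial_prod_rev)
  ultimately show ?thesis by (simp cong: sums_cong)
qed

text \<open>The binomial series is available inside the disc. As the coefficients are nonnegative,
  letting \<open>x\<close> increase to 1 bounds every partial sum by 1, while the full sum dominates
  \<open>1 - (1 - x) powr a\<close>, which tends to 1.\<close>

lemma sibuya_sums_1:
  assumes a: "0 < a" "a < 1"
  shows "sibuya a sums 1"
proof -
  have real: "(\<lambda>k. sibuya a k * x ^ k) sums (1 - (1 - x) powr a)" if "0 \<le> x" "x < 1" for x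
  proof -
    have "(\<lambda>k. complex_of_real (sibuya a k * x ^ k)) sums (of_real (1 - (1 - x) powr a))"
      using sibuya_sums_open[of "of_real x" a] that
      by (simp add: powr_of_real[symmetric])
    then show ?thesis by (simp only: sums_of_real_iff)
  qed
  have le: "(\<Sum>k<n. sibuya a k) \<le> 1" for n
  proof (rule tendsto_upperbound)
    show "((\<lambda>x. \<Sum>k<n. sibuya a k * x ^ k) \<longlongrightarrow> (\<Sum>k<n. sibuya a k)) (at_left 1)"
      by (auto intro!: tendsto_eq_intros)
    show "\<forall>\<^sub>F x in at_left 1. (\<Sum>k<n. sibuya a k * x ^ k) \<le> 1"
    proof (rule eventually_at_leftI[of 0])
      fix x :: real assume x: "x \<in> {0<..<1}"
      then have "(\<Sum>k<n. sibuya a k * x ^ k) \<le> 1 - (1 - x) powr a"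
        using sum_le_suminf[of "\<lambda>k. sibuya a k * x ^ k" "{..<n}"] real[of x] sibuya_nonneg[OF a]
        by (simp add: sums_iff)
      then show "(\<Sum>k<n. sibuya a k * x ^ k) \<le> 1"
        by (smt (verit) powr_ge_zero)
    qed simp
  qed simp
  have sm: "summable (sibuya a)"
    using sibuya_nonneg[OF a] le by (intro summableI_nonneg_bounded[where x = 1]) auto
  have "suminf (sibuya a) \<le> 1"
    using sm le by (intro suminf_le_const) auto
  moreover have "1 \<le> suminf (sibuya a)"
  proof (rule tendsto_upperbound)
    have "((\<lambda>x::real. 1 - (1 - x) powr a) \<longlongrightarrow> 1 - 0 powr a) (at_left 1)"
      by (rule tendsto_eq_intros tendsto_powr' | use a in \<open>auto simp: eventually_at_filter\<close>)+
    then show "((\<lambda>x::real. 1 - (1 - x) powr a) \<longlongrightarrow> 1) (at_left 1)" by simp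
    show "\<forall>\<^sub>F x in at_left 1. 1 - (1 - x) powr a \<le> suminf (sibuya a)"
    proof (rule eventually_at_leftI[of 0])
      fix x :: real assume x: "x \<in> {0<..<1}"
      have "(\<Sum>k. sibuya a k * x ^ k) \<le> suminf (sibuya a)"
        using x sibuya_nonneg[OF a] real[of x] sm
        by (intro suminf_le) (auto simp: sums_iff mult_left_le power_le_one)
      then show "1 - (1 - x) powr a \<le> suminf (sibuya a)"
        using x real[of x] by (simp add: sums_iff)
    qed simp
  qed simp
  ultimately show ?thesis using sm by (simp add: sums_iff)
qed

text \<open>Summability at 1 makes the series uniformly convergent on the closed disc, so both sides
  are limits along the radius through \<open>z\<close>. The point \<open>z = 1\<close> is separate,
  as the power has its branch point there.\<close>

lemma sibuya_sums_closed:
  assumes a: "0 < a" "a < 1" and z: "norm (z::complex) \<le> 1"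
  shows "(\<lambda>k. of_real (sibuya a k) * z ^ k) sums (1 - (1 - z) powr of_real a)"
proof (cases "z = 1")
  case True
  then show ?thesis using sibuya_sums_1[OF a] by (simp add: sums_of_real_iff[of _ 1, simplified])
next
  case False
  let ?f = "\<lambda>k z. of_real (sibuya a k) * z ^ k :: complex"
  have bound: "norm (?f k w) \<le> sibuya a k" if "norm w \<le> 1" for k w
    using that sibuya_nonneg[OF a, of k]
    by (simp add: norm_mult norm_power mult_left_le power_le_one)
  have sm: "summable (\<lambda>k. ?f k w)" if "norm w \<le> 1" for w
    by (rule summable_comparison_test'[OF sums_summable[OF sibuya_sums_1[OF a]]]) (use bound[OF that] in auto)
  have "uniform_limit (cball 0 1) (\<lambda>n w. \<Sum>k<n. ?f k w) (\<lambda>w. \<Sum>k. ?f k w) sequentially"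
    by (rule Weierstrass_m_test[OF _ sums_summable[OF sibuya_sums_1[OF a]]]) (use bound in auto)
  then have cont: "continuous_on (cball 0 1) (\<lambda>w. \<Sum>k. ?f k w)"
    by (rule uniform_limit_theorem[rotated]) (auto intro!: continuous_intros always_eventually)
  define \<rho> where "\<rho> n = 1 - 1 / (real n + 2)" for n
  have \<rho>: "0 < \<rho> n" "\<rho> n < 1" for n by (auto simp: \<rho>_def field_simps)
  have "(\<lambda>n. 1 / (real n + 2)) \<longlonglongrightarrow> 0" by real_asymp
  then have "\<rho> \<longlonglongrightarrow> 1 - 0" unfolding \<rho>_def by (intro tendsto_intros)
  then have lim: "(\<lambda>n. of_real (\<rho> n) * z) \<longlonglongrightarrow> z"
    by (auto intro!: tendsto_eq_intros)
  have nz: "norm (of_real (\<rho> n) * z) < 1" for n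
  proof -
    have "norm (of_real (\<rho> n) * z) \<le> \<rho> n * 1"
      using \<rho>[of n] z by (simp add: norm_mult)
    then show ?thesis using \<rho>[of n] by simp
  qed
  have "(\<lambda>n. \<Sum>k. ?f k (of_real (\<rho> n) * z)) \<longlonglongrightarrow> (\<Sum>k. ?f k z)"
    by (rule continuous_on_tendsto_compose[OF cont lim]) (use z nz in \<open>auto intro!: always_eventually less_imp_le\<close>)
  moreover have "(\<Sum>k. ?f k (of_real (\<rho> n) * z)) = 1 - (1 - of_real (\<rho> n) * z) powr of_real a" for n
    using sibuya_sums_open[OF nz] by (simp add: sums_iff)
  moreover have "(\<lambda>n. 1 - (1 - of_real (\<rho> n) * z) powr of_real a) \<longlonglongrightarrow> 1 - (1 - z) powr of_real a"
  proof -
    \<comment> \<open>The closed disc meets the line of real part 1 only at 1, so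
      \<open>1 - z\<close> avoids the branch cut.\<close>
    have "Re (1 - z) > 0"
    proof -
      have "Re z < 1"
      proof (rule ccontr)
        assume *: "\<not> Re z < 1"
        then have "Re z = 1" using complex_Re_le_cmod[of z] z by linarith
        moreover have "(Re z)\<^sup>2 + (Im z)\<^sup>2 \<le> 1" using z by (simp add: cmod_def)
        ultimately have "Im z = 0" by simp
        then show False using \<open>Re z = 1\<close> False by (simp add: complex_eq_iff)
      qed
      then show ?thesis by simp
    qed
    then have "1 - z \<notin> \<real>\<^sub>\<le>\<^sub>0" by (auto simp: complex_nonpos_Reals_iff)
    then show ?thesis by (intro tendsto_intros tendsto_powr_complex lim)
  qed
  ultimately have "(\<Sum>k. ?f k z) = 1 - (1 - z) powr of_real a"
    using LIMSEQ_unique by simp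
  then show ?thesis using sm[OF z] by (simp add: sums_iff)
qed

definition sibuya_law :: "real \<Rightarrow> real measure" where
  "sibuya_law a = distr (measure_pmf (embed_pmf (sibuya a))) borel real"

lemma pmf_sibuya:
  assumes a: "0 < a" "a < 1"
  shows "pmf (embed_pmf (sibuya a)) k = sibuya a k"
proof (rule pmf_embed_pmf)
  show "0 \<le> sibuya a k" for k by (rule sibuya_nonneg[OF a])
  show "(\<integral>\<^sup>+k. ennreal (sibuya a k) \<partial>count_space UNIV) = 1"
    using suminf_ennreal_eq[OF sibuya_nonneg[OF a] sibuya_sums_1[OF a]]
    by (simp add: nn_integral_count_space_nat)
qed

lemma nonneg_law_sibuya_law: "nonneg_law (sibuya_law a)"
  unfolding sibuya_law_def by (intro nonneg_law_distr) (auto simp: measure_pmf.prob_space_axioms)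

lemma integral_measure_pmf_nat:
  fixes f :: "nat \<Rightarrow> 'a::{banach, second_countable_topology}"
  assumes "integrable (measure_pmf p) f"
  shows "(\<integral>k. f k \<partial>measure_pmf p) = (\<Sum>k. pmf p k *\<^sub>R f k)"
proof -
  have int: "integrable (count_space UNIV) (\<lambda>k. pmf p k *\<^sub>R f k)"
    using assms by (simp add: measure_pmf_eq_density integrable_density)
  have "(\<integral>k. f k \<partial>measure_pmf p) = (\<integral>k. pmf p k *\<^sub>R f k \<partial>count_space UNIV)"
    by (simp add: measure_pmf_eq_density integral_density)
  also have "\<dots> = (\<Sum>k. pmf p k *\<^sub>R f k)"
    by (rule integral_count_space_nat[OF int])
  finally show ?thesis .
qed

lemma complex_laplace_sibuya_law:
  assumes a: "0 < a" "a < 1" and z: "0 \<le> Re z"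
  shows "complex_laplace (sibuya_law a) z = 1 - (1 - exp (- z)) powr of_real a"
proof -
  let ?p = "measure_pmf (embed_pmf (sibuya a))"
  have "integrable ?p (\<lambda>k. exp (- z * of_real (real k)))"
    using norm_exp_nonneg_le_1[OF z] by (intro measure_pmf.integrable_const_bound[where B = 1]) auto
  then have "complex_laplace (sibuya_law a) z = (\<Sum>k. sibuya a k *\<^sub>R exp (- z * of_real (real k)))"
    unfolding complex_laplace_def sibuya_law_def
    by (subst integral_distr) (simp_all add: integral_measure_pmf_nat pmf_sibuya[OF a])
  also have "\<dots> = (\<Sum>k. of_real (sibuya a k) * exp (- z) ^ k)"
    by (simp add: scaleR_conv_of_real exp_of_nat_mult[symmetric] mult.commute)
  also have "\<dots> = 1 - (1 - exp (- z)) powr of_real a"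
    using sibuya_sums_closed[OF a, of "exp (- z)"] z by (simp add: sums_iff)
  finally show ?thesis .
qed

text \<open>If \<open>n * w n\<close> tends to \<open>b\<close>, then \<open>(1 - w n) ^ n\<close>
  tends to \<open>exp (- b)\<close>; here \<open>w n\<close> behaves like
  \<open>(z * h n) powr a\<close> with \<open>h n = n powr (- 1 / a)\<close>, chosen so that
  \<open>n * h n powr a = 1\<close>. Caratheodory's form of the derivative replaces expansions with
  remainder by exact factorisations with continuous factors \<open>g\<close> and
  \<open>f\<close>.\<close>

lemma sibuya_power_limit:
  assumes a: "0 < a" and z: "0 \<le> Re z" "z \<noteq> 0"
  shows "(\<lambda>n. (1 - (1 - exp (- (z / of_real (real n powr (1 / a))))) powr of_real a) ^ n)
    \<longlonglongrightarrow> exp (- (z powr of_real a))"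
proof -
  define h where "h n = real n powr (- 1 / a)" for n
  have h0: "h \<longlonglongrightarrow> 0"
    unfolding h_def using a by real_asymp
  have hpos: "0 < h n" if "n \<ge> 1" for n using that by (simp add: h_def)
  have nh: "real n * h n powr a = 1" if "n \<ge> 1" for n
    using that a unfolding h_def powr_powr by (simp add: powr_minus)
  have "((\<lambda>w. 1 - exp (- (z * w))) has_field_derivative z) (at 0)"
    by (auto intro!: derivative_eq_intros)
  then obtain g where g: "\<And>w. 1 - exp (- (z * w)) = g w * w" "isCont g 0" "g 0 = z"
    unfolding CARAT_DERIV by auto
  define u where "u n = g (of_real (h n))" for n
  have u: "u \<longlonglongrightarrow> z"
    unfolding u_def using isCont_tendsto_compose[OF g(2), of "\<lambda>n. of_real (h n)" sequentially] tendsto_of_real[OF h0] g(3)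
    by simp
  \<comment> \<open>Away from 0 the principal power is continuous on the closed right half-plane,
    the imaginary axis included.\<close>
  have z': "z \<notin> \<real>\<^sub>\<le>\<^sub>0"
    using z by (auto simp: complex_nonpos_Reals_iff complex_eq_iff)
  define w where "w n = (of_real (h n) * u n) powr of_real a" for n
  have nw: "(\<lambda>n. of_nat n * w n) \<longlonglongrightarrow> z powr of_real a"
  proof (rule Lim_transform_eventually)
    show "(\<lambda>n. u n powr of_real a) \<longlonglongrightarrow> z powr of_real a"
      by (intro tendsto_powr_complex u tendsto_const z')
    have "\<forall>\<^sub>F n in sequentially. u n \<noteq> 0"
      using u z(2) by (rule tendsto_imp_eventually_ne)
    then show "\<forall>\<^sub>F n in sequentially. u n powr of_real a = of_nat n * w n"
      using eventually_ge_at_top[of 1]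
    proof eventually_elim
      case (elim n)
      \<comment> \<open>\<open>Ln\<close> splits exactly over a positive real factor, so
        \<open>h n\<close> leaves the power without a multiple of
        \<open>2 * pi * \<i>\<close>.\<close>
      have "w n = of_real (h n powr a) * u n powr of_real a"
        using elim hpos[of n] unfolding w_def powr_def
        by (simp add: Ln_times_of_real Ln_of_real exp_add distrib_left exp_of_real[symmetric])
      then have "of_nat n * w n = of_real (real n * h n powr a) * u n powr of_real a"
        by simp
      then show ?case using nh[of n] elim by simp
    qed
  qed
  have w0: "w \<longlonglongrightarrow> 0"
  proof -
    have "(\<lambda>n. (of_nat n * w n) * (1 / of_nat n)) \<longlonglongrightarrow> z powr of_real a * 0"
      by (intro tendsto_mult nw lim_1_over_n)
    moreover have "\<forall>\<^sub>F n in sequentially. (of_nat n * w n) * (1 / of_nat n) = w n"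
      using eventually_gt_at_top[of 0] by eventually_elim simp
    ultimately show ?thesis
      by (simp add: tendsto_cong)
  qed
  have "((\<lambda>w. Ln (1 - w)) has_field_derivative - 1) (at 0)"
    by (auto intro!: derivative_eq_intros)
  then obtain f where f: "\<And>w. Ln (1 - w) = f w * w" "isCont f 0" "f 0 = - 1"
    unfolding CARAT_DERIV by auto
  have "(\<lambda>n. f (w n)) \<longlonglongrightarrow> - 1"
    using isCont_tendsto_compose[OF f(2) w0] f(3) by simp
  then have "(\<lambda>n. exp (f (w n) * (of_nat n * w n))) \<longlonglongrightarrow> exp (- 1 * z powr of_real a)"
    by (intro tendsto_intros nw)
  then have "(\<lambda>n. exp (f (w n) * (of_nat n * w n))) \<longlonglongrightarrow> exp (- (z powr of_real a))"
    by simp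
  then show ?thesis
  proof (rule Lim_transform_eventually)
    have "\<forall>\<^sub>F n in sequentially. w n \<noteq> 1"
      using w0 by (rule tendsto_imp_eventually_ne) simp
    then show "\<forall>\<^sub>F n in sequentially. exp (f (w n) * (of_nat n * w n)) =
      (1 - (1 - exp (- (z / of_real (real n powr (1 / a))))) powr of_real a) ^ n"
      using eventually_ge_at_top[of 1]
    proof eventually_elim
      case (elim n)
      have "z / of_real (real n powr (1 / a)) = z * of_real (h n)"
        by (simp add: h_def powr_minus divide_inverse)
      then have "(1 - exp (- (z / of_real (real n powr (1 / a))))) powr of_real a = w n"
        using g(1)[of "of_real (h n)"] by (simp add: w_def u_def mult.commute)
      moreover have "exp (f (w n) * (of_nat n * w n)) = exp (of_nat n * Ln (1 - w n))"
        using f(1)[of "w n"] by (simp add: mult_ac)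
      moreover have "\<dots> = (1 - w n) ^ n"
        using elim by (simp add: exp_of_nat_mult)
      ultimately show ?case by simp
    qed
  qed
qed

text \<open>The stable law arises as the limit of normalised sums of Sibuya variables, whose probability
  generating function is \<open>1 - (1 - z)\<^sup>a\<close>.\<close>

lemma complex_laplace_stable_exists_open:
  assumes a: "0 < a" "a < 1"
  obtains T where "nonneg_law T"
    "\<And>z. 0 \<le> Re z \<Longrightarrow> z \<noteq> 0 \<Longrightarrow> complex_laplace T z = exp (- (z powr of_real a))"
proof -
  define Mn where "Mn n = distr (conv_power n (sibuya_law a)) borel (\<lambda>x. x / real n powr (1 / a))" for n
  have Q: "nonneg_law (conv_power n (sibuya_law a))" for n
    by (intro nonneg_law_conv_power nonneg_law_sibuya_law)
  have Mn: "nonneg_law (Mn n)" for n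
    unfolding Mn_def using nonneg_lawD[OF Q[of n]]
    by (intro nonneg_law_distr) (auto cong: measurable_cong_sets elim!: eventually_mono)
  have lim: "(\<lambda>n. complex_laplace (Mn n) z) \<longlonglongrightarrow> exp (- (z powr of_real a))"
    if z: "0 \<le> Re z" "z \<noteq> 0" for z
  proof -
    have "complex_laplace (Mn n) z = (1 - (1 - exp (- (z / of_real (real n powr (1 / a))))) powr of_real a) ^ n" for n
      unfolding Mn_def complex_laplace_scale[OF nonneg_lawD(4)[OF Q]]
      using z a by (simp add: complex_laplace_conv_power nonneg_law_sibuya_law complex_laplace_sibuya_law)
    then show ?thesis using sibuya_power_limit[OF a(1) z] by simp
  qed
  have "(\<lambda>n. laplace (Mn n) s) \<longlonglongrightarrow> exp (- (s powr a))" if "0 < s" for s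
  proof -
    have "(\<lambda>n. complex_of_real (laplace (Mn n) s)) \<longlonglongrightarrow> of_real (exp (- (s powr a)))"
      using lim[of "of_real s"] that
      by (simp add: complex_laplace_of_real powr_of_real exp_of_real[symmetric])
    then show ?thesis by (simp only: tendsto_of_real_iff)
  qed
  moreover have "((\<lambda>s. exp (- (s powr a))) \<longlongrightarrow> 1) (at_right 0)"
  proof -
    have "((\<lambda>s. exp (- (s powr a))) \<longlongrightarrow> exp (- (0 powr a))) (at_right 0)"
      by (intro tendsto_intros tendsto_powr') (use a in \<open>auto simp: eventually_at_filter\<close>)
    then show ?thesis by simp
  qed
  ultimately obtain T where T: "nonneg_law T" "weak_conv_m Mn T"
    using laplace_compactness[where Mn = Mn, OF Mn, where \<phi> = "\<lambda>s. exp (- (s powr a))"] by blast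
  \<comment> \<open>Real arguments suffice to find the weak limit \<open>T\<close>; weak convergence
    then carries the limit over to the whole closed half-plane.\<close>
  have "complex_laplace T z = exp (- (z powr of_real a))" if z: "0 \<le> Re z" "z \<noteq> 0" for z
    using complex_laplace_weak_conv[OF Mn T z(1)] lim[OF z] by (rule LIMSEQ_unique)
  then show ?thesis using that T by blast
qed

text \<open>Index 1 is included because \<open>\<alpha>'\<close> may equal 1; the law is then the
  point mass at 1.\<close>

lemma complex_laplace_stable_exists:
  assumes a: "0 < a" "a \<le> 1"
  obtains T where "nonneg_law T"
    "\<And>z. 0 \<le> Re z \<Longrightarrow> z \<noteq> 0 \<Longrightarrow> complex_laplace T z = exp (- (z powr of_real a))"
proof (cases "a = 1")
  case True
  have "nonneg_law (return borel (1::real))"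
    by (rule nonneg_law_return) simp
  moreover have "complex_laplace (return borel 1) z = exp (- (z powr of_real a))" if "z \<noteq> 0" for z
    using that True by (simp add: complex_laplace_def integral_return)
  ultimately show ?thesis using that by blast
next
  case False
  then show ?thesis using complex_laplace_stable_exists_open[of a] a that by auto
qed

definition positive_stable :: "real \<Rightarrow> real measure \<Rightarrow> bool" where
  "positive_stable a T \<longleftrightarrow> nonneg_law T \<and> (\<forall>s\<ge>0. laplace T s = exp (- (s powr a)))"

lemma positive_stable_of_complex_laplace:
  assumes T: "nonneg_law T"
    and lap: "\<And>z. 0 \<le> Re z \<Longrightarrow> z \<noteq> 0 \<Longrightarrow> complex_laplace T z = exp (- (z powr of_real a))"
  shows "positive_stable a T" 
proof -
  have "laplace T s = exp (- (s powr a))" if "0 \<le> s" for s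
  proof (cases "s = 0")
    case False
    then have "complex_of_real (laplace T s) = of_real (exp (- (s powr a)))"
      using lap[of "of_real s"] that
      by (simp add: complex_laplace_of_real powr_of_real exp_of_real[symmetric])
    then show ?thesis by (simp only: of_real_eq_iff)
  qed (use T in simp)
  then show ?thesis using T by (simp add: positive_stable_def)
qed

lemma positive_stable_exists:
  assumes "0 < a" "a \<le> 1"
  shows "\<exists>T. positive_stable a T"
  using complex_laplace_stable_exists[OF assms] positive_stable_of_complex_laplace by metis

text \<open>Levy's uniqueness theorem identifies \<open>S\<close> with the constructed
  \<open>T\<close>. At \<open>z = - \<i> t\<close> the principal argument is
  \<open>- pi * sgn t / 2\<close>, whence \<open>z powr a\<close> is
  \<open>\<bar>t\<bar> powr a\<close> times \<open>exp (- \<i> * pi * a * sgn t / 2)\<close>, the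
  exponent in the definition of \<open>S\<close>.\<close>

lemma one_sided_stable_imp_positive_stable:
  assumes a: "0 < a" "a \<le> 1" and S: "one_sided_stable a S"
  shows "positive_stable a S"
proof -
  obtain T where T: "nonneg_law T"
    and lap: "\<And>z. 0 \<le> Re z \<Longrightarrow> z \<noteq> 0 \<Longrightarrow> complex_laplace T z = exp (- (z powr of_real a))"
    using complex_laplace_stable_exists[OF a] by blast
  have pT: "positive_stable a T" by (rule positive_stable_of_complex_laplace[OF T lap])
  have "char S t = char T t" for t
  proof (cases "t = 0")
    case True
    then show ?thesis
      using S nonneg_lawD(1)[OF T] by (simp add: one_sided_stable_def real_distribution.char_zero)
  next
    case False
    have "- (\<i> * of_real t) = of_real \<bar>t\<bar> * (- (\<i> * of_real (sgn t)))"
      by (simp add: of_real_mult[symmetric] mult.left_commute abs_mult_sgn)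
    moreover have "Ln (- (\<i> * of_real (sgn t))) = - (\<i> * of_real (pi * sgn t / 2))"
      using False by (cases "t > 0") (auto simp: sgn_if)
    ultimately have "Ln (- (\<i> * of_real t)) = of_real (ln \<bar>t\<bar>) - \<i> * of_real (pi * sgn t / 2)"
      using False by (subst \<open>- (\<i> * of_real t) = _\<close>, subst Ln_times_of_real) (auto simp: sgn_if Ln_of_real)
    then have "(- (\<i> * of_real t)) powr of_real a = of_real (\<bar>t\<bar> powr a) * exp (- (\<i> * of_real (pi * a * sgn t / 2)))"
    proof -
      assume Ln: "Ln (- (\<i> * of_real t)) = of_real (ln \<bar>t\<bar>) - \<i> * of_real (pi * sgn t / 2)"
      have "(- (\<i> * of_real t)) powr of_real a = exp (of_real (a * ln \<bar>t\<bar>) + - (\<i> * of_real (pi * a * sgn t / 2)))"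
        using False unfolding powr_def Ln by (simp add: algebra_simps)
      then show ?thesis
        using False by (simp only: exp_add exp_of_real) (simp add: powr_def)
    qed
    then show ?thesis
      using S False lap[of "- (\<i> * of_real t)"]
      by (simp add: one_sided_stable_def char_eq_complex_laplace[of T])
  qed
  then have "S = T"
    using S nonneg_lawD(1)[OF T]
    by (intro Levy_uniqueness) (auto simp: one_sided_stable_def)
  then show "positive_stable a S" using pT by simp
qed

text \<open>The mass of \<open>{..0}\<close> is at most the transform at every \<open>n\<close>,
  which is \<open>exp (- (n powr a))\<close> and tends to 0. Strict positivity is what allows
  division by \<open>S\<close>.\<close>

lemma positive_stable_AE_pos:
  assumes "positive_stable a S" "0 < a"
  shows "AE x in S. 0 < x"
proof -
  have S: "nonneg_law S" and lap: "\<And>s. 0 \<le> s \<Longrightarrow> laplace S s = exp (- (s powr a))"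
    using assms by (auto simp: positive_stable_def)
  interpret real_distribution S using S by (rule nonneg_lawD)
  have "measure S {..0} \<le> exp (- (real n powr a))" for n
  proof -
    have "measure S {..0} = (\<integral>x. indicator {..0} x \<partial>S)" by simp
    also have "\<dots> \<le> (\<integral>x. exp (- real n * x) \<partial>S)"
      using integrable_exp_nonneg[OF S, of "real n"]
      by (intro integral_mono) (auto simp: mult_le_0_iff emeasure_eq_measure split: split_indicator)
    also have "\<dots> = exp (- (real n powr a))"
      using lap[of "real n"] by (simp add: laplace_def)
    finally show ?thesis .
  qed
  moreover have "(\<lambda>n. exp (- (real n powr a))) \<longlonglongrightarrow> 0"
    using assms(2) by real_asymp
  ultimately have "measure S {..0} \<le> 0"
    by (intro LIMSEQ_le_const[where X = "\<lambda>n. exp (- (real n powr a))"]) auto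
  then have "emeasure S {..0} = 0"
    by (simp add: emeasure_eq_measure measure_le_0_iff)
  then have "AE x in S. x \<notin> {..0}"
    by (intro AE_not_in) (auto simp: null_sets_def)
  then show ?thesis by eventually_elim simp
qed

section \<open>Roots of log-convex distributions\<close>

text \<open>Kaluza's theorem: since \<open>p (n + 1) / p n\<close> increases, the recursion for the coefficients of
  \<open>p 0 / P\<close> propagates their sign.\<close>

lemma kaluza:
  fixes P C :: "real fps"
  assumes pos: "\<And>k. 0 < fps_nth P k"
    and log_convex: "\<And>k. (fps_nth P (Suc k))\<^sup>2 \<le> fps_nth P k * fps_nth P (Suc (Suc k))"
    and PC: "C * P = fps_const (fps_nth P 0)" and n: "1 \<le> n"
  shows "fps_nth C n \<le> 0"
  using n
proof (induction n rule: less_induct)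
  case (less n)
  let ?p = "fps_nth P" and ?c = "fps_nth C"
  have ratio: "?p (Suc i) * ?p j \<le> ?p i * ?p (Suc j)" if "i \<le> j" for i j
  proof -
    have "?p (Suc i) / ?p i \<le> ?p (Suc j) / ?p j"
    proof (rule lift_Suc_mono_le[OF _ that])
      fix k show "?p (Suc k) / ?p k \<le> ?p (Suc (Suc k)) / ?p (Suc k)"
        using pos[of k] pos[of "Suc k"] log_convex[of k] by (simp add: field_simps power2_eq_square)
    qed
    then show ?thesis using pos[of i] pos[of j] by (simp add: field_simps)
  qed
  have conv: "(\<Sum>i=0..k. ?c i * ?p (k - i)) = 0" if "k \<noteq> 0" for k
    using arg_cong[OF PC, of "\<lambda>F. fps_nth F k"] that by (simp add: fps_mult_nth)
  have c0: "?c 0 = 1"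
    using arg_cong[OF PC, of "\<lambda>F. fps_nth F 0"] pos[of 0] by (simp add: fps_mult_nth)
  obtain k where k: "n = Suc k" using less.prems by (cases n) auto
  show ?case
  proof (cases "k = 0")
    case True
    then have "?c 1 * ?p 0 = - ?p 1"
      using conv[of 1] c0 by (simp add: atLeast0AtMost)
    then have "?c 1 * ?p 0 \<le> 0" using pos[of 1] by simp
    then show ?thesis using pos[of 0] True k by (simp add: mult_le_0_iff)
  next
    case False
    \<comment> \<open>Solve the \<open>k\<close>-th identity for \<open>p k\<close>, multiply by
      \<open>p (k + 1)\<close>, and use the ratios to exchange \<open>p (k - i) * p (k + 1)\<close>
      for the smaller \<open>p (k + 1 - i) * p k\<close>; the weights \<open>- c i\<close> are
      nonnegative by induction. Dividing by \<open>p k\<close> bounds the sum that determines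
      \<open>c (k + 1)\<close>.\<close>
    have "?p k = - (\<Sum>i=1..k. ?c i * ?p (k - i))"
      using conv[OF False] c0 by (simp add: sum.atLeast_Suc_atMost)
    then have "?p k * ?p (Suc k) = (\<Sum>i=1..k. - ?c i * (?p (k - i) * ?p (Suc k)))"
      by (simp add: sum_negf sum_distrib_left mult_ac)
    also have "\<dots> \<ge> (\<Sum>i=1..k. - ?c i * (?p (Suc k - i) * ?p k))"
    proof (intro sum_mono mult_left_mono)
      fix i assume i: "i \<in> {1..k}"
      then show "0 \<le> - ?c i" using less.IH[of i] k by simp
      show "?p (Suc k - i) * ?p k \<le> ?p (k - i) * ?p (Suc k)"
        using ratio[of "k - i" k] i by (simp add: Suc_diff_le)
    qed
    finally have *: "?p k * (\<Sum>i=1..k. - ?c i * ?p (Suc k - i)) \<le> ?p k * ?p (Suc k)"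
      by (simp add: sum_distrib_left mult_ac)
    then have "(\<Sum>i=1..k. - ?c i * ?p (Suc k - i)) \<le> ?p (Suc k)"
      using pos[of k] by simp
    moreover have "?c (Suc k) * ?p 0 = - ?p (Suc k) - (\<Sum>i=1..k. ?c i * ?p (Suc k - i))"
      using conv[of "Suc k"] c0 by (simp add: sum.atLeast_Suc_atMost[of 0] del: sum.cl_ivl_Suc) simp
    ultimately have "?c (Suc k) * ?p 0 \<le> 0" by (simp add: sum_negf)
    then show ?thesis using pos[of 0] k by (simp add: mult_le_0_iff)
  qed
qed

text \<open>With \<open>P (1 - B) = p 0\<close>, the root \<open>Q = P\<^bsup>1/m\<^esup>\<close> solves \<open>m Q' = m Q' B + Q B'\<close>, a recursion
  with nonnegative coefficients.\<close>

lemma log_convex_fps_root: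
  fixes P :: "real fps"
  assumes pos: "\<And>k. 0 < fps_nth P k"
    and log_convex: "\<And>k. (fps_nth P (Suc k))\<^sup>2 \<le> fps_nth P k * fps_nth P (Suc (Suc k))"
  obtains Q where "Q ^ Suc m = P" "\<And>k. 0 \<le> fps_nth Q k"
proof -
  define Q where "Q = fps_radical root (Suc m) P"
  have QP: "Q ^ Suc m = P"
    unfolding Q_def using power_radical[of P root m] pos[of 0] by (simp only: real_root_pow_pos2 less_imp_le) simp
  have Q0: "0 < fps_nth Q 0"
    unfolding Q_def using pos[of 0] by simp
  define C where "C = fps_const (fps_nth P 0) * inverse P"
  have "P \<noteq> 0" using pos[of 0] by auto
  have CP: "C * P = fps_const (fps_nth P 0)"
    unfolding C_def using pos[of 0] by (simp add: mult.assoc inverse_mult_eq_1)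
  define B where "B = 1 - C"
  have C: "C = 1 - B" by (simp add: B_def)
  have B0: "fps_nth B 0 = 0"
    using arg_cong[OF CP, of "\<lambda>F. fps_nth F 0"] pos[of 0] by (simp add: B_def)
  have B: "0 \<le> fps_nth B k" for k
    using kaluza[OF pos log_convex CP, of k] B0 by (cases "k = 0") (auto simp: B_def)
  have "fps_deriv (C * P) = 0" unfolding CP by simp
  then have "(1 - B) * fps_deriv P = fps_deriv B * P"
    by (simp add: C algebra_simps)
  moreover have "fps_deriv P = of_nat (Suc m) * Q ^ m * fps_deriv Q"
    unfolding QP[symmetric] by (subst fps_deriv_power) (simp add: mult_ac fps_of_nat[symmetric] del: of_nat_Suc)
  ultimately have "Q ^ m * (of_nat (Suc m) * (1 - B) * fps_deriv Q) = Q ^ m * (fps_deriv B * Q)"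
    using QP by (simp add: mult_ac)
  \<comment> \<open>Formal power series over the reals have no zero divisors, so
    \<open>Q ^ m\<close> cancels and a linear equation for \<open>Q\<close> remains.\<close>
  moreover have "Q ^ m \<noteq> 0" using Q0 by auto
  ultimately have "of_nat (Suc m) * (1 - B) * fps_deriv Q = fps_deriv B * Q"
    using mult_left_cancel by blast
  then have ode: "of_nat (Suc m) * fps_deriv Q = of_nat (Suc m) * (B * fps_deriv Q) + fps_deriv B * Q"
    by (simp add: algebra_simps del: of_nat_Suc)
  have "0 \<le> fps_nth Q k" for k
  proof (induction k rule: less_induct)
    case (less k)
    show ?case
    proof (cases k)
      case 0
      then show ?thesis using Q0 by simp
    next
      case (Suc n)
      have "real (Suc m) * (real (Suc n) * fps_nth Q (Suc n)) =
          fps_nth (of_nat (Suc m) * fps_deriv Q) n"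
        by (simp add: fps_of_nat[symmetric] del: of_nat_Suc)
      also have "\<dots> = real (Suc m) * (\<Sum>i=0..n. fps_nth B i * fps_nth (fps_deriv Q) (n - i))
          + (\<Sum>i=0..n. fps_nth (fps_deriv B) i * fps_nth Q (n - i))"
        using arg_cong[OF ode, of "\<lambda>F. fps_nth F n"]
        by (simp only: fps_add_nth fps_mult_nth[symmetric] fps_of_nat[symmetric] fps_mult_left_const_nth)
      also have "\<dots> \<ge> 0"
      proof (intro add_nonneg_nonneg mult_nonneg_nonneg[OF of_nat_0_le_iff] sum_nonneg)
        fix i assume i: "i \<in> {0..n}"
        show "0 \<le> fps_nth (fps_deriv B) i * fps_nth Q (n - i)"
          using B[of "Suc i"] Suc less i by simp
        show "0 \<le> fps_nth B i * fps_nth (fps_deriv Q) (n - i)"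
        \<comment> \<open>The one term containing the unknown coefficient \<open>n + 1\<close> of
          \<open>Q\<close> has \<open>i = 0\<close> and is killed by \<open>B 0 = 0\<close>.\<close>
        proof (cases "i = 0")
          case False
          then show ?thesis using B[of i] less[of "Suc (n - i)"] Suc i by simp
        qed (simp add: B0)
      qed
      finally show ?thesis using Suc by (simp add: zero_le_mult_iff)
    qed
  qed
  then show ?thesis using that QP by blast
qed

section \<open>From formal roots to generating functions\<close>

text \<open>Working in \<open>ennreal\<close> avoids presupposing summability, which is not yet
  known for the formal root. Extending the inner sums by 0 through \<open>h\<close> makes the
  exchange of summations an instance of Tonelli's theorem.\<close>

lemma suminf_ennreal_Cauchy_product:
  fixes f g :: "nat \<Rightarrow> ennreal"
  shows "(\<Sum>n. \<Sum>i=0..n. f i * g (n - i)) = (\<Sum>n. f n) * (\<Sum>n. g n)"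
proof -
  define h where "h i n = (if i \<le> n then f i * g (n - i) else 0)" for i n
  have "(\<Sum>i=0..n. f i * g (n - i)) = (\<Sum>i. h i n)" for n
    by (subst suminf_finite[of "{0..n}"]) (auto simp: h_def)
  then have "(\<Sum>n. \<Sum>i=0..n. f i * g (n - i)) = (\<Sum>n. \<integral>\<^sup>+i. h i n \<partial>count_space UNIV)"
    by (simp add: nn_integral_count_space_nat)
  also have "\<dots> = (\<integral>\<^sup>+i. (\<Sum>n. h i n) \<partial>count_space UNIV)"
    by (subst nn_integral_suminf) auto
  also have "\<dots> = (\<Sum>i. \<Sum>n. h i n)"
    by (simp add: nn_integral_count_space_nat)
  also have "\<dots> = (\<Sum>i. f i * (\<Sum>n. g n))"
  proof (intro suminf_cong)
    fix i
    have "(\<Sum>n. h i n) = (\<Sum>n. h i (n + i)) + (\<Sum>n<i. h i n)"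
      by (rule suminf_offset) simp
    also have "(\<Sum>n<i. h i n) = 0" by (simp add: h_def)
    also have "(\<Sum>n. h i (n + i)) = f i * (\<Sum>n. g n)" by (simp add: h_def)
    finally show "(\<Sum>n. h i n) = f i * (\<Sum>n. g n)" by simp
  qed
  finally show ?thesis by simp
qed

lemma suminf_ennreal_fps_power:
  fixes Q :: "real fps"
  assumes Q: "\<And>k. 0 \<le> fps_nth Q k" and x: "0 \<le> x"
  shows "(\<Sum>n. ennreal (fps_nth (Q ^ m) n * x ^ n)) = (\<Sum>n. ennreal (fps_nth Q n * x ^ n)) ^ m"
proof -
  have nonneg: "0 \<le> fps_nth (Q ^ m) k" for m k
    by (induction m arbitrary: k) (auto simp: fps_one_nth fps_mult_nth intro!: sum_nonneg mult_nonneg_nonneg Q)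
  show ?thesis
  proof (induction m)
    case 0
    have "(\<Sum>n. ennreal (fps_nth (Q ^ 0) n * x ^ n)) = (\<Sum>n\<in>{0}. ennreal (fps_nth (Q ^ 0) n * x ^ n))"
      by (rule suminf_finite) auto
    then show ?case by simp
  next
    case (Suc m)
    have "ennreal (fps_nth (Q ^ Suc m) n * x ^ n) =
        (\<Sum>i=0..n. ennreal (fps_nth Q i * x ^ i) * ennreal (fps_nth (Q ^ m) (n - i) * x ^ (n - i)))" for n
    proof -
      have "fps_nth (Q ^ Suc m) n * x ^ n =
          (\<Sum>i=0..n. (fps_nth Q i * x ^ i) * (fps_nth (Q ^ m) (n - i) * x ^ (n - i)))"
        unfolding power_Suc fps_mult_nth sum_distrib_right
        by (intro sum.cong refl) (simp add: power_add[symmetric] mult_ac)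
      then show ?thesis
        using Q nonneg x by (simp add: ennreal_mult[symmetric] sum_nonneg)
    qed
    then show ?case
      by (simp only: power_Suc Suc.IH[symmetric]
          suminf_ennreal_Cauchy_product[of "\<lambda>i. ennreal (fps_nth Q i * x ^ i)" "\<lambda>i. ennreal (fps_nth (Q ^ m) i * x ^ i)"])
  qed
qed

text \<open>Convergence of the root comes out of the identity itself: the \<open>m\<close>-th power
  of its series in \<open>ennreal\<close> equals the finite sum of \<open>p\<close>, so the series
  is finite. At \<open>x = 1\<close> this gives \<open>suminf q ^ m = 1\<close>, so \<open>q\<close>
  is a probability distribution.\<close>

lemma log_convex_root:
  fixes p :: "nat \<Rightarrow> real"
  assumes pos: "\<And>k. 0 < p k" and log_convex: "\<And>k. (p (Suc k))\<^sup>2 \<le> p k * p (Suc (Suc k))"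
    and sums: "p sums 1" and m: "1 \<le> m"
  obtains q where "\<And>k. 0 \<le> q k" "q sums 1"
    "\<And>x. 0 \<le> x \<Longrightarrow> x \<le> 1 \<Longrightarrow> (\<Sum>k. q k * x ^ k) ^ m = (\<Sum>k. p k * x ^ k)"
proof -
  obtain m' where m': "m = Suc m'" using m by (cases m) auto
  obtain Q where Q: "Q ^ m = Abs_fps p" "\<And>k. 0 \<le> fps_nth Q k"
    unfolding m' by (rule log_convex_fps_root[of "Abs_fps p" m']) (use pos log_convex in auto)
  define q where "q = fps_nth Q"
  have q: "0 \<le> q k" for k using Q by (simp add: q_def)
  have sump: "summable (\<lambda>k. p k * x ^ k)" if "0 \<le> x" "x \<le> 1" for x
    using sums_summable[OF sums]
    by (rule summable_comparison_test'[where N = 0])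
       (use that pos in \<open>auto simp: abs_mult power_abs mult_left_le power_le_one less_imp_le abs_of_pos\<close>)
  have eq: "summable (\<lambda>k. q k * x ^ k) \<and> (\<Sum>k. q k * x ^ k) ^ m = (\<Sum>k. p k * x ^ k)" if x: "0 \<le> x" "x \<le> 1" for x
  proof -
    have "ennreal (\<Sum>k. p k * x ^ k) = (\<Sum>k. ennreal (p k * x ^ k))"
      using sump[OF x] pos x by (intro suminf_ennreal2[symmetric]) (auto intro!: mult_nonneg_nonneg intro: less_imp_le)
    also have "\<dots> = (\<Sum>k. ennreal (q k * x ^ k)) ^ m"
      using suminf_ennreal_fps_power[OF Q(2) x(1), of m] by (simp add: Q(1) q_def)
    finally have e: "ennreal (\<Sum>k. p k * x ^ k) = (\<Sum>k. ennreal (q k * x ^ k)) ^ m" .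
    then have fin: "(\<Sum>k. ennreal (q k * x ^ k)) \<noteq> top"
      using m by (metis ennreal_neq_top power_eq_top_ennreal not_one_le_zero)
    then have sm: "summable (\<lambda>k. q k * x ^ k)"
      using q x by (intro summable_suminf_not_top) auto
    have "(\<Sum>k. ennreal (q k * x ^ k)) = ennreal (\<Sum>k. q k * x ^ k)"
      using sm q x by (intro suminf_ennreal2) auto
    then have "ennreal (\<Sum>k. p k * x ^ k) = ennreal ((\<Sum>k. q k * x ^ k) ^ m)"
      using e sm q x by (simp add: ennreal_power suminf_nonneg)
    then have "(\<Sum>k. p k * x ^ k) = (\<Sum>k. q k * x ^ k) ^ m"
      using sm q x sump[OF x] pos by (subst (asm) ennreal_inj) (auto intro!: suminf_nonneg zero_le_power mult_nonneg_nonneg intro: less_imp_le)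
    then show ?thesis using sm by simp
  qed
  have "suminf q ^ m = 1" "summable q"
    using eq[of 1] sums by (auto simp: sums_iff)
  then have "q sums 1"
    using q m power_eq_1_iff[of "suminf q" m] suminf_nonneg[of q] by (auto simp: sums_iff)
  then show ?thesis using that q eq by blast
qed

section \<open>Infinite divisibility of mixed exponential laws\<close>

lemma nn_integral_exp_laplace:
  assumes "nonneg_law M" "0 \<le> s"
  shows "(\<integral>\<^sup>+x. ennreal (exp (- s * x)) \<partial>M) = ennreal (laplace M s)"
  unfolding laplace_def
  using integrable_exp_nonneg[OF assms] by (intro nn_integral_eq_integral) auto

text \<open>Transforms of mixtures are computed as integrals of nonnegative functions, where Fubini
  applies at once; this rule returns to \<open>laplace\<close>.\<close>

lemma laplace_eqI:
  assumes "nonneg_law M" "0 \<le> s" "0 \<le> c" "(\<integral>\<^sup>+x. ennreal (exp (- s * x)) \<partial>M) = ennreal c"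
  shows "laplace M s = c"
  using assms nn_integral_exp_laplace[OF assms(1,2)] laplace_pos[OF assms(1,2)] by simp

lemma laplace_at_right_0:
  assumes M: "nonneg_law M"
  shows "(laplace M \<longlongrightarrow> 1) (at_right 0)"
proof -
  interpret real_distribution M using M by (rule nonneg_lawD)
  show ?thesis
    unfolding tendsto_at_iff_sequentially
  proof (intro allI impI)
    fix X :: "nat \<Rightarrow> real" assume X: "\<forall>i. X i \<in> {0<..} - {0}" "X \<longlonglongrightarrow> 0"
    have "(\<lambda>n. \<integral>x. exp (- X n * x) \<partial>M) \<longlonglongrightarrow> (\<integral>x. exp (- 0 * x) \<partial>M)"
    proof (rule integral_dominated_convergence[where w = "\<lambda>_. 1"])
      show "AE x in M. norm (exp (- X n * x)) \<le> 1" for n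
        using nonneg_lawD(2)[OF M] X(1)[rule_format, of n] by (auto elim!: eventually_mono)
      show "AE x in M. (\<lambda>n. exp (- X n * x)) \<longlonglongrightarrow> exp (- 0 * x)"
        by (intro AE_I2 tendsto_intros X)
    qed auto
    then show "(laplace M \<circ> X) \<longlonglongrightarrow> 1"
      using prob_space by (simp add: comp_def laplace_def)
  qed
qed

text \<open>The two densities differ at 0, where \<open>0 powr 0 = 0\<close>, and so agree only
  almost everywhere.\<close>

lemma weibull_law_1: "weibull_law 1 = density lborel (exponential_density 1)"
  unfolding weibull_law_def exponential_density_def
  by (intro density_cong AE_I[where N = "{0}"]) auto

lemma nonneg_law_weibull_1 [simp]: "nonneg_law (weibull_law 1)"
  unfolding weibull_law_1 nonneg_law_def
  by (auto simp: AE_density real_distributionI prob_space_exponential_density)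
     (auto simp: exponential_density_def)

interpretation W: real_distribution "weibull_law 1"
  using nonneg_law_weibull_1 by (rule nonneg_lawD)

lemma laplace_exponential:
  assumes "0 \<le> s"
  shows "laplace (weibull_law 1) s = 1 / (1 + s)"
proof (rule laplace_eqI[OF nonneg_law_weibull_1 assms])
  interpret E: prob_space "density lborel (exponential_density (1 + s))"
    using assms by (intro prob_space_exponential_density) simp
  have "(\<integral>\<^sup>+x. ennreal (exp (- s * x)) \<partial>weibull_law 1) =
      (\<integral>\<^sup>+x. ennreal (1 / (1 + s)) * ennreal (exponential_density (1 + s) x) \<partial>lborel)"
    unfolding weibull_law_1
    by (subst nn_integral_density)
       (use assms in \<open>auto simp: exponential_density_def ennreal_mult[symmetric] exp_add[symmetric]
          intro!: nn_integral_cong arg_cong[where f = ennreal]\<close>, simp add: algebra_simps)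
  also have "\<dots> = ennreal (1 / (1 + s)) * (\<integral>\<^sup>+x. ennreal (exponential_density (1 + s) x) \<partial>lborel)"
    by (rule nn_integral_cmult) simp
  also have "(\<integral>\<^sup>+x. ennreal (exponential_density (1 + s) x) \<partial>lborel) = 1"
    using E.emeasure_space_1 by (simp add: emeasure_density)
  finally show "(\<integral>\<^sup>+x. ennreal (exp (- s * x)) \<partial>weibull_law 1) = ennreal (1 / (1 + s))" by simp
qed (use assms in simp)

text \<open>Given \<open>V = v\<close>, the quotient \<open>W / v\<close> is exponential with rate
  \<open>v\<close> and has transform \<open>v / (v + s)\<close>.\<close>

lemma laplace_mixed_exponential:
  assumes V: "prob_space V" "sets V = sets borel" "AE v in V. 0 < v"
  defines "A \<equiv> distr (weibull_law 1 \<Otimes>\<^sub>M V) borel (\<lambda>(w, v). w / v)"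
  shows "nonneg_law A" "0 \<le> s \<Longrightarrow> laplace A s = (\<integral>v. v / (v + s) \<partial>V)"
proof -
  interpret V: real_distribution V using V by (intro real_distributionI)
  interpret P: pair_prob_space "weibull_law 1" V ..
  have "AE x in weibull_law 1 \<Otimes>\<^sub>M V. 0 \<le> fst x / snd x"
    by (rule AE_pair_measureI[OF W.prob_space_axioms V(1) nonneg_lawD(2)[OF nonneg_law_weibull_1] V(3)])
       (simp, measurable)
  then show A: "nonneg_law A"
    unfolding A_def by (intro nonneg_law_distr P.prob_space_axioms) (auto simp: case_prod_beta)
  assume s: "0 \<le> s"
  show "laplace A s = (\<integral>v. v / (v + s) \<partial>V)"
  proof (rule laplace_eqI[OF A s])
    have bound: "AE v in V. 0 \<le> v / (v + s) \<and> v / (v + s) \<le> 1"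
      using V(3) by eventually_elim (use s in auto)
    then have "AE v in V. norm (v / (v + s)) \<le> 1"
      by eventually_elim (simp only: real_norm_def abs_of_nonneg)
    then have int: "integrable V (\<lambda>v. v / (v + s))"
      by (intro V.integrable_const_bound[where B = 1]) auto
    show "0 \<le> (\<integral>v. v / (v + s) \<partial>V)"
      using bound by (intro integral_nonneg_AE) auto
    have "(\<integral>\<^sup>+x. ennreal (exp (- s * x)) \<partial>A) = (\<integral>\<^sup>+v. \<integral>\<^sup>+w. ennreal (exp (- (s / v) * w)) \<partial>weibull_law 1 \<partial>V)"
      unfolding A_def by (simp add: nn_integral_distr case_prod_beta P.nn_integral_snd[symmetric])
    also have "\<dots> = (\<integral>\<^sup>+v. ennreal (v / (v + s)) \<partial>V)"
    proof (rule nn_integral_cong_AE)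
      show "AE v in V. (\<integral>\<^sup>+w. ennreal (exp (- (s / v) * w)) \<partial>weibull_law 1) = ennreal (v / (v + s))"
        using V(3)
      proof eventually_elim
        case (elim v)
        then show ?case
          using s by (subst nn_integral_exp_laplace[OF nonneg_law_weibull_1])
            (auto simp: laplace_exponential field_simps)
      qed
    qed
    also have "\<dots> = ennreal (\<integral>v. v / (v + s) \<partial>V)"
      using bound int by (intro nn_integral_eq_integral) auto
    finally show "(\<integral>\<^sup>+x. ennreal (exp (- s * x)) \<partial>A) = ennreal (\<integral>v. v / (v + s) \<partial>V)" .
  qed
qed

text \<open>Mixtures of geometric laws are log-convex; at lattice width \<open>h\<close> they approximate the mixed
  exponential law.\<close>

lemma geometric_mixture_root:
  assumes V: "prob_space V" "sets V = sets borel" "AE v in V. 0 < v" and h: "0 < h" and m: "1 \<le> m"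
  obtains Q where "nonneg_law Q"
    "\<And>s. 0 \<le> s \<Longrightarrow> laplace Q s ^ m = (\<integral>v. (1 - exp (- h * v)) / (1 - exp (- h * (v + s))) \<partial>V)"
proof -
  interpret V: real_distribution V using V by (intro real_distributionI)
  define u where "u v = exp (- h * v)" for v
  have [measurable]: "u \<in> borel_measurable borel" by (simp add: u_def[abs_def])
  have u: "AE v in V. 0 < u v \<and> u v < 1"
    using V(3) by eventually_elim (use h in \<open>simp add: u_def\<close>)
  have int: "integrable V (\<lambda>v. (1 - u v) * u v ^ k)" for k
  proof (rule V.integrable_const_bound[where B = 1])
    show "AE v in V. norm ((1 - u v) * u v ^ k) \<le> 1"
      using u by eventually_elim (auto simp: abs_mult intro!: mult_le_one power_le_one)
  qed measurable
  define p where "p k = (\<integral>v. (1 - u v) * u v ^ k \<partial>V)" for k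
  have pos: "0 < p k" for k
  proof -
    have nn: "AE v in V. 0 \<le> (1 - u v) * u v ^ k" using u by eventually_elim simp
    have "p k \<noteq> 0"
    proof
      assume "p k = 0"
      then have "AE v in V. (1 - u v) * u v ^ k = 0"
        using integral_nonneg_eq_0_iff_AE[OF int nn] by (simp add: p_def)
      with u have "AE v in V. False" by eventually_elim auto
      then show False by simp
    qed
    moreover have "0 \<le> p k" unfolding p_def using nn by (rule integral_nonneg_AE)
    ultimately show ?thesis by simp
  qed
  have log_convex: "(p (Suc k))\<^sup>2 \<le> p k * p (Suc (Suc k))" for k
  proof -
    \<comment> \<open>Cauchy-Schwarz by completing the square: this \<open>t\<close> minimises
      \<open>t^2 * p k - 2 * t * p (Suc k) + p (Suc (Suc k))\<close>, which is the integral of a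
      nonnegative function.\<close>
    define t where "t = p (Suc k) / p k"
    have "0 \<le> (\<integral>v. (1 - u v) * u v ^ k * (t - u v)\<^sup>2 \<partial>V)"
      by (rule integral_nonneg_AE) (use u in \<open>eventually_elim, simp\<close>)
    also have "\<dots> = (\<integral>v. t\<^sup>2 * ((1 - u v) * u v ^ k) - 2 * t * ((1 - u v) * u v ^ Suc k) + (1 - u v) * u v ^ Suc (Suc k) \<partial>V)"
      by (intro Bochner_Integration.integral_cong refl) (simp add: power2_eq_square algebra_simps)
    also have "\<dots> = t\<^sup>2 * p k - 2 * t * p (Suc k) + p (Suc (Suc k))"
      unfolding p_def using int[of k] int[of "Suc k"] int[of "Suc (Suc k)"] by simp
    also have "\<dots> = p (Suc (Suc k)) - (p (Suc k))\<^sup>2 / p k"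
      using pos[of k] by (simp add: t_def power2_eq_square field_simps)
    finally show ?thesis using pos[of k] by (simp add: field_simps)
  qed
  have gf: "(\<lambda>k. p k * x ^ k) sums (\<integral>v. (1 - u v) / (1 - x * u v) \<partial>V)" if x: "0 \<le> x" "x \<le> 1" for x
  proof -
    have geo: "AE v in V. (\<lambda>k. (1 - u v) * u v ^ k * x ^ k) sums ((1 - u v) / (1 - x * u v)) \<and>
        0 \<le> (1 - u v) / (1 - x * u v) \<and> (1 - u v) / (1 - x * u v) \<le> 1"
      using u
    proof eventually_elim
      case (elim v)
      have xu: "0 \<le> x * u v" "x * u v \<le> u v" using elim x by (auto simp: mult_left_le_one_le)
      then have "(\<lambda>k. (x * u v) ^ k) sums (1 / (1 - x * u v))"
        using elim by (intro geometric_sums) (simp only: real_norm_def abs_of_nonneg, linarith)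
      then have "(\<lambda>k. (1 - u v) * (x * u v) ^ k) sums ((1 - u v) * (1 / (1 - x * u v)))"
        by (rule sums_mult)
      then have "(\<lambda>k. (1 - u v) * u v ^ k * x ^ k) sums ((1 - u v) / (1 - x * u v))"
        by (simp add: power_mult_distrib mult_ac)
      moreover have "0 < 1 - x * u v" "0 \<le> 1 - u v" "1 - u v \<le> 1 - x * u v" using xu elim by linarith+
      ultimately show ?case by auto
    qed
    have nn: "AE v in V. \<forall>k. 0 \<le> (1 - u v) * u v ^ k * x ^ k"
      using u by eventually_elim (use x in auto)
    \<comment> \<open>Summing in \<open>ennreal\<close> exchanges series and integral and yields
      summability at once, \<open>x = 1\<close> included.\<close>
    have "(\<Sum>k. ennreal (p k * x ^ k)) = (\<Sum>k. \<integral>\<^sup>+v. ennreal ((1 - u v) * u v ^ k * x ^ k) \<partial>V)"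
    proof (intro suminf_cong)
      fix k
      show "ennreal (p k * x ^ k) = (\<integral>\<^sup>+v. ennreal ((1 - u v) * u v ^ k * x ^ k) \<partial>V)"
        using int[of k] nn by (subst nn_integral_eq_integral) (auto simp: p_def)
    qed
    also have "\<dots> = (\<integral>\<^sup>+v. (\<Sum>k. ennreal ((1 - u v) * u v ^ k * x ^ k)) \<partial>V)"
      by (rule nn_integral_suminf[symmetric]) simp
    also have "\<dots> = (\<integral>\<^sup>+v. ennreal ((1 - u v) / (1 - x * u v)) \<partial>V)"
      using geo nn by (intro nn_integral_cong_AE) (auto elim!: eventually_elim2 intro!: suminf_ennreal_eq)
    also have "\<dots> = ennreal (\<integral>v. (1 - u v) / (1 - x * u v) \<partial>V)"
    proof (rule nn_integral_eq_integral)
      show "integrable V (\<lambda>v. (1 - u v) / (1 - x * u v))"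
      proof (rule V.integrable_const_bound[where B = 1])
        show "AE v in V. norm ((1 - u v) / (1 - x * u v)) \<le> 1"
          using geo by eventually_elim (simp only: real_norm_def abs_of_nonneg)
      qed measurable
    qed (use geo in auto)
    finally have eq: "(\<Sum>k. ennreal (p k * x ^ k)) = ennreal (\<integral>v. (1 - u v) / (1 - x * u v) \<partial>V)" .
    have pk: "0 \<le> p k * x ^ k" for k using pos[of k] x by simp
    have sm: "summable (\<lambda>k. p k * x ^ k)"
      using pk eq by (intro summable_suminf_not_top) auto
    moreover have "ennreal (\<Sum>k. p k * x ^ k) = ennreal (\<integral>v. (1 - u v) / (1 - x * u v) \<partial>V)"
      using eq suminf_ennreal2[OF pk sm] by simp
    then have "(\<Sum>k. p k * x ^ k) = (\<integral>v. (1 - u v) / (1 - x * u v) \<partial>V)"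
      using geo pk sm by (subst (asm) ennreal_inj) (auto intro!: suminf_nonneg integral_nonneg_AE)
    ultimately show ?thesis by (simp add: sums_iff)
  qed
  have "p sums 1"
  proof -
    have "(\<integral>v. (1 - u v) / (1 - 1 * u v) \<partial>V) = (\<integral>v. 1 \<partial>V)"
    proof (rule integral_cong_AE)
      show "AE v in V. (1 - u v) / (1 - 1 * u v) = 1" using u by eventually_elim simp
    qed auto
    then show ?thesis using gf[of 1] V.prob_space by simp
  qed
  then obtain q where q: "\<And>k. 0 \<le> q k" "q sums 1"
    and root: "\<And>x. 0 \<le> x \<Longrightarrow> x \<le> 1 \<Longrightarrow> (\<Sum>k. q k * x ^ k) ^ m = (\<Sum>k. p k * x ^ k)"
    using log_convex_root[of p m] pos log_convex m by blast
  have pmf_q: "pmf (embed_pmf q) k = q k" for k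
    using q suminf_ennreal_eq[OF q] by (intro pmf_embed_pmf) (auto simp: nn_integral_count_space_nat)
  \<comment> \<open>On the lattice of multiples of \<open>h\<close> the transform at
    \<open>s\<close> is the generating function at \<open>x = exp (- s * h)\<close>.\<close>
  define Q where "Q = distr (measure_pmf (embed_pmf q)) borel (\<lambda>k. h * real k)"
  have Q: "nonneg_law Q"
    unfolding Q_def using h by (intro nonneg_law_distr) (auto simp: measure_pmf.prob_space_axioms)
  have "laplace Q s ^ m = (\<integral>v. (1 - exp (- h * v)) / (1 - exp (- h * (v + s))) \<partial>V)" if s: "0 \<le> s" for s
  proof -
    have "integrable (measure_pmf (embed_pmf q)) (\<lambda>k. exp (- s * (h * real k)))"
      using s h by (intro measure_pmf.integrable_const_bound[where B = 1]) auto
    then have "laplace Q s = (\<Sum>k. q k * exp (- s * (h * real k)))"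
      unfolding laplace_def Q_def
      by (subst integral_distr) (simp_all add: integral_measure_pmf_nat pmf_q)
    also have "\<dots> = (\<Sum>k. q k * exp (- s * h) ^ k)"
      by (simp add: exp_of_nat_mult[symmetric] mult_ac)
    finally have "laplace Q s ^ m = (\<integral>v. (1 - u v) / (1 - exp (- s * h) * u v) \<partial>V)"
      using root[of "exp (- s * h)"] gf[of "exp (- s * h)"] s h by (simp add: sums_iff)
    also have "\<dots> = (\<integral>v. (1 - exp (- h * v)) / (1 - exp (- h * (v + s))) \<partial>V)"
      by (intro Bochner_Integration.integral_cong refl) (simp add: u_def exp_add[symmetric] algebra_simps)
    finally show ?thesis .
  qed
  then show ?thesis using that Q by blast
qed

text \<open>The Goldie-Steutel theorem. The lattice transform
  \<open>(1 - exp (- h * v)) / (1 - exp (- h * (v + s)))\<close> is bounded by 1 and tends to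
  \<open>v / (v + s)\<close> as \<open>h\<close> tends to 0. Its mixtures have \<open>m\<close>-th
  roots that are transforms of laws \<open>Q n\<close>; these converge, their limit tends to 1 at 0,
  and compactness provides a law whose \<open>m\<close>-th convolution power is
  \<open>A\<close>.\<close>

theorem mixed_exponential_infinitely_divisible:
  assumes "mixed_exponential A"
  shows "infinitely_divisible A"
  unfolding infinitely_divisible_def
proof (intro allI impI)
  fix m :: nat assume m: "1 \<le> m"
  obtain V where V: "prob_space V" "sets V = sets borel" "AE v in V. 0 < v"
    and A: "A = distr (weibull_law 1 \<Otimes>\<^sub>M V) borel (\<lambda>(w, v). w / v)"
    using assms unfolding mixed_exponential_def by blast
  interpret V: real_distribution V using V by (intro real_distributionI)
  have nA: "nonneg_law A" and lapA: "\<And>s. 0 \<le> s \<Longrightarrow> laplace A s = (\<integral>v. v / (v + s) \<partial>V)"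
    unfolding A using laplace_mixed_exponential[OF V] by auto
  define h where "h n = 1 / real (Suc n)" for n
  have h: "0 < h n" for n by (simp add: h_def)
  have h0: "h \<longlonglongrightarrow> 0" unfolding h_def by real_asymp
  let ?\<phi> = "\<lambda>n s. \<integral>v. (1 - exp (- h n * v)) / (1 - exp (- h n * (v + s))) \<partial>V"
  have "\<forall>n. \<exists>Q. nonneg_law Q \<and> (\<forall>s\<ge>0. laplace Q s ^ m = ?\<phi> n s)"
    using geometric_mixture_root[OF V h m] by metis
  then obtain Q where Q: "\<And>n. nonneg_law (Q n)"
    and lapQ: "\<And>n s. 0 \<le> s \<Longrightarrow> laplace (Q n) s ^ m = ?\<phi> n s"
    by metis
  have lim: "(\<lambda>n. laplace (Q n) s) \<longlonglongrightarrow> root m (laplace A s)" if s: "0 < s" for s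
  proof -
    have "(\<lambda>n. ?\<phi> n s) \<longlonglongrightarrow> (\<integral>v. v / (v + s) \<partial>V)"
    proof (rule integral_dominated_convergence[where w = "\<lambda>_. 1"])
      show "AE v in V. (\<lambda>n. (1 - exp (- h n * v)) / (1 - exp (- h n * (v + s)))) \<longlonglongrightarrow> v / (v + s)"
        using V(3)
      proof eventually_elim
        case (elim v)
        then have "(\<lambda>n. (1 - exp (- h n * v)) / (1 - exp (- h n * (v + s)))) \<longlonglongrightarrow> v * inverse (s + v)"
          using s unfolding h_def by real_asymp
        then show ?case by (simp add: divide_inverse add.commute)
      qed
      show "AE v in V. norm ((1 - exp (- h n * v)) / (1 - exp (- h n * (v + s)))) \<le> 1" for n
        using V(3)
      proof eventually_elim
        case (elim v)
        have "exp (- h n * (v + s)) \<le> exp (- h n * v)" "exp (- h n * v) < 1"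
          using elim s h[of n] by auto
        then have "0 \<le> 1 - exp (- h n * v)" "1 - exp (- h n * v) \<le> 1 - exp (- h n * (v + s))"
          "0 < 1 - exp (- h n * (v + s))" by linarith+
        then show ?case unfolding real_norm_def abs_divide by (subst pos_divide_le_eq) auto
      qed
    qed auto
    then have "(\<lambda>n. root m (laplace (Q n) s ^ m)) \<longlonglongrightarrow> root m (laplace A s)"
      using s by (intro tendsto_real_root) (simp add: lapQ lapA)
    moreover have "root m (laplace (Q n) s ^ m) = laplace (Q n) s" for n
      using m s laplace_pos[OF Q, of s n] by (simp add: real_root_power_cancel)
    ultimately show ?thesis by simp
  qed
  have "((\<lambda>s. root m (laplace A s)) \<longlongrightarrow> root m 1) (at_right 0)"
    by (intro tendsto_real_root laplace_at_right_0 nA)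
  then obtain L where L: "nonneg_law L" "\<And>s. 0 < s \<Longrightarrow> laplace L s = root m (laplace A s)"
    using laplace_compactness[where Mn = Q, OF Q lim] m by auto
  have "conv_power m L = A"
    using m nA laplace_pos[OF nA]
    by (intro laplace_uniqueness nonneg_law_conv_power L(1))
       (auto simp: laplace_conv_power L real_root_pow_pos2 less_imp_le)
  then show "\<exists>Q. real_distribution Q \<and> conv_power m Q = A"
    using nonneg_lawD(1)[OF L(1)] by blast
qed

section \<open>Multiplicative convolution\<close>

definition mult_conv :: "real measure \<Rightarrow> real measure \<Rightarrow> real measure" where
  "mult_conv M N = distr (M \<Otimes>\<^sub>M N) borel (\<lambda>(x, y). x * y)"

text \<open>Division by a factor becomes \<open>mult_conv\<close> with its
  \<open>pow_law (- 1)\<close>. On the half-line this matches \<open>/\<close> at 0 as well, since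
  \<open>0 powr (- 1) = 0\<close> and \<open>x / 0 = 0\<close>.\<close>

definition pow_law :: "real \<Rightarrow> real measure \<Rightarrow> real measure" where
  "pow_law c M = distr M borel (\<lambda>x. x powr c)"

text \<open>Quotients, absolute values and square roots factor only on the support of the laws,
  hence the factorisation is demanded almost everywhere.\<close>

lemma distr_pair_eq_mult_conv:
  assumes "prob_space M" "prob_space N"
    and f[measurable]: "f \<in> borel_measurable M" and g[measurable]: "g \<in> borel_measurable N"
    and F[measurable]: "F \<in> borel_measurable (M \<Otimes>\<^sub>M N)"
    and eq: "AE x in M. AE y in N. F (x, y) = f x * g y"
  shows "distr (M \<Otimes>\<^sub>M N) borel F = mult_conv (distr M borel f) (distr N borel g)"
proof -
  interpret M: prob_space M by fact
  interpret N: prob_space N by fact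
  interpret P: pair_prob_space M N ..
  interpret g: prob_space "distr N borel g" by (rule N.prob_space_distr) simp
  have "mult_conv (distr M borel f) (distr N borel g) = distr (M \<Otimes>\<^sub>M N) borel (\<lambda>x. f (fst x) * g (snd x))"
    unfolding mult_conv_def
    by (subst pair_measure_distr) (auto simp: distr_distr comp_def case_prod_beta g.sigma_finite_measure_axioms)
  moreover have "AE x in M \<Otimes>\<^sub>M N. F x = f (fst x) * g (snd x)"
    by (rule P.AE_pair_measure) (use eq in auto)
  then have "distr (M \<Otimes>\<^sub>M N) borel F = distr (M \<Otimes>\<^sub>M N) borel (\<lambda>x. f (fst x) * g (snd x))"
    by (intro distr_cong_AE) auto
  ultimately show ?thesis by simp
qed

lemma real_distribution_mult_conv [simp]:
  assumes "real_distribution M" "real_distribution N"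
  shows "real_distribution (mult_conv M N)"
proof -
  interpret M: real_distribution M by fact
  interpret N: real_distribution N by fact
  interpret P: pair_prob_space M N ..
  show ?thesis
    unfolding mult_conv_def by (intro real_distributionI P.prob_space_distr) auto
qed

lemma real_distribution_pow_law [simp]:
  assumes "real_distribution M"
  shows "real_distribution (pow_law c M)"
proof -
  interpret M: real_distribution M by fact
  show ?thesis
    unfolding pow_law_def by (intro real_distributionI M.prob_space_distr) auto
qed

lemma nn_integral_mult_conv:
  assumes "real_distribution M" "real_distribution N" and [measurable]: "f \<in> borel_measurable borel"
  shows "(\<integral>\<^sup>+x. f x \<partial>mult_conv M N) = (\<integral>\<^sup>+x. \<integral>\<^sup>+y. f (x * y) \<partial>N \<partial>M)"
    and "(\<integral>\<^sup>+x. f x \<partial>mult_conv M N) = (\<integral>\<^sup>+y. \<integral>\<^sup>+x. f (x * y) \<partial>M \<partial>N)"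
proof -
  interpret M: real_distribution M by fact
  interpret N: real_distribution N by fact
  interpret P: pair_prob_space M N ..
  show "(\<integral>\<^sup>+x. f x \<partial>mult_conv M N) = (\<integral>\<^sup>+x. \<integral>\<^sup>+y. f (x * y) \<partial>N \<partial>M)"
    unfolding mult_conv_def by (simp add: nn_integral_distr case_prod_beta N.nn_integral_fst[symmetric])
  show "(\<integral>\<^sup>+x. f x \<partial>mult_conv M N) = (\<integral>\<^sup>+y. \<integral>\<^sup>+x. f (x * y) \<partial>M \<partial>N)"
    unfolding mult_conv_def by (simp add: nn_integral_distr case_prod_beta P.nn_integral_snd[symmetric])
qed

lemma real_distribution_eqI:
  assumes "real_distribution M" "real_distribution N"
    and eq: "\<And>A. A \<in> sets borel \<Longrightarrow> (\<integral>\<^sup>+x. indicator A x \<partial>M) = (\<integral>\<^sup>+x. indicator A x \<partial>N)"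
  shows "M = N"
proof -
  interpret M: real_distribution M by fact
  interpret N: real_distribution N by fact
  show ?thesis
    by (rule measure_eqI) (use eq in auto)
qed

lemma mult_conv_commute:
  assumes "real_distribution M" "real_distribution N"
  shows "mult_conv M N = mult_conv N M"
  using assms by (intro real_distribution_eqI)
    (simp_all add: nn_integral_mult_conv(1)[of M N] nn_integral_mult_conv(2)[of N M] mult.commute)

lemma mult_conv_assoc:
  assumes "real_distribution M" "real_distribution N" "real_distribution L"
  shows "mult_conv (mult_conv M N) L = mult_conv M (mult_conv N L)"
proof -
  interpret M: real_distribution M by fact
  interpret N: real_distribution N by fact
  interpret L: real_distribution L by fact
  show ?thesis
  proof (rule real_distribution_eqI)
    fix A :: "real set" assume [measurable]: "A \<in> sets borel"
    have [measurable]: "(\<lambda>x. \<integral>\<^sup>+y. indicator A (x * y) \<partial>L) \<in> borel_measurable borel"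
      by (rule L.borel_measurable_nn_integral) simp
    show "(\<integral>\<^sup>+x. indicator A x \<partial>mult_conv (mult_conv M N) L) = (\<integral>\<^sup>+x. indicator A x \<partial>mult_conv M (mult_conv N L))"
      using assms by (simp add: nn_integral_mult_conv(1) mult.assoc)
  qed (use assms in simp_all)
qed

lemma mult_conv_left_commute:
  assumes "real_distribution M" "real_distribution N" "real_distribution L"
  shows "mult_conv M (mult_conv N L) = mult_conv N (mult_conv M L)"
  using assms by (metis mult_conv_assoc mult_conv_commute)

lemma AE_mult_conv:
  assumes "real_distribution M" "real_distribution N"
    and P: "AE x in M. P x" and Q: "AE y in N. Q y"
    and R: "\<And>x y. P x \<Longrightarrow> Q y \<Longrightarrow> R (x * y)" and [measurable]: "Measurable.pred borel R"
  shows "AE x in mult_conv M N. R x"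
proof -
  interpret M: real_distribution M by fact
  interpret N: real_distribution N by fact
  interpret P: pair_prob_space M N ..
  have "AE z in M \<Otimes>\<^sub>M N. R (fst z * snd z)"
    by (rule AE_pair_measureI[OF M.prob_space_axioms N.prob_space_axioms P Q]) (simp add: R, measurable)
  then show ?thesis
    unfolding mult_conv_def by (subst AE_distr_iff) (auto simp: case_prod_beta)
qed

lemma nonneg_law_mult_conv [simp]:
  assumes "nonneg_law M" "nonneg_law N"
  shows "nonneg_law (mult_conv M N)"
  using assms AE_mult_conv[of M N "\<lambda>x. 0 \<le> x" "\<lambda>x. 0 \<le> x" "\<lambda>x. 0 \<le> x"]
  by (simp add: nonneg_law_def)

lemma nonneg_law_pow_law [simp]:
  assumes "real_distribution M"
  shows "nonneg_law (pow_law c M)"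
proof -
  interpret real_distribution M by fact
  show ?thesis
    unfolding pow_law_def by (intro nonneg_law_distr prob_space_axioms) auto
qed

lemma real_distribution_nonneg [simp]: "nonneg_law M \<Longrightarrow> real_distribution M"
  by (rule nonneg_lawD)

lemma AE_pow_law_pos:
  assumes "real_distribution M" "AE x in M. 0 < x"
  shows "AE x in pow_law c M. 0 < x"
proof -
  interpret real_distribution M by fact
  show ?thesis
    unfolding pow_law_def using assms(2) by (subst AE_distr_iff) (auto elim!: eventually_mono)
qed

lemma pow_law_pow_law: "sets M = sets borel \<Longrightarrow> pow_law c (pow_law d M) = pow_law (d * c) M"
  unfolding pow_law_def by (subst distr_distr) (auto simp: comp_def powr_powr cong: measurable_cong_sets)

lemma pow_law_1:
  assumes "nonneg_law M"
  shows "pow_law 1 M = M"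
proof -
  interpret real_distribution M using assms by simp
  have "pow_law 1 M = distr M borel (\<lambda>x. x)"
    unfolding pow_law_def using nonneg_lawD(2)[OF assms]
    by (intro distr_cong_AE) auto
  then show ?thesis by (simp add: distr_id2)
qed

lemma pow_law_mult_conv:
  assumes "real_distribution M" "real_distribution N"
  shows "pow_law c (mult_conv M N) = mult_conv (pow_law c M) (pow_law c N)"
proof -
  interpret M: real_distribution M by fact
  interpret N: real_distribution N by fact
  have "pow_law c (mult_conv M N) = distr (M \<Otimes>\<^sub>M N) borel (\<lambda>(x, y). (x * y) powr c)"
    unfolding pow_law_def mult_conv_def by (subst distr_distr) (auto simp: comp_def case_prod_beta')
  also have "\<dots> = mult_conv (pow_law c M) (pow_law c N)"
    unfolding pow_law_def
    by (rule distr_pair_eq_mult_conv) (auto simp: powr_mult intro: M.prob_space_axioms N.prob_space_axioms)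
  finally show ?thesis .
qed

section \<open>Gamma, Weibull and beta laws\<close>

text \<open>The map \<open>(x / c) powr a\<close> is a bijection of the open half-line for either
  sign of \<open>a\<close>; it decreases for \<open>a < 0\<close>, hence the absolute value and a
  change of variables for injective maps. Finiteness permits the passage to gauge integrals.\<close>

lemma nn_integral_powr_substitution:
  fixes f :: "real \<Rightarrow> real"
  assumes a: "a \<noteq> 0" and c: "0 < c"
    and f[measurable]: "f \<in> borel_measurable borel" "\<And>x. 0 \<le> f x"
    and fin: "(\<integral>\<^sup>+x. ennreal (f x * indicator {0<..} x) \<partial>lborel) < \<infinity>"
  shows "(\<integral>\<^sup>+x. ennreal (\<bar>a\<bar> / c * (x / c) powr (a - 1) * f ((x / c) powr a) * indicator {0<..} x) \<partial>lborel) =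
    (\<integral>\<^sup>+x. ennreal (f x * indicator {0<..} x) \<partial>lborel)"
proof -
  let ?S = "{0<..} :: real set"
  let ?\<phi> = "\<lambda>x. (x / c) powr a" and ?\<phi>' = "\<lambda>x. a / c * (x / c) powr (a - 1)"
  obtain I where I: "(\<integral>\<^sup>+x. ennreal (f x * indicator {0<..} x) \<partial>lborel) = ennreal I" "0 \<le> I"
    using fin by (cases "\<integral>\<^sup>+x. ennreal (f x * indicator {0<..} x) \<partial>lborel") auto
  have "((\<lambda>x. f x * indicator ?S x) has_integral I) UNIV"
    using I by (intro nn_integral_has_integral) (auto simp: f)
  then have hI: "(f has_integral I) ?S"
    by (subst has_integral_restrict_UNIV[symmetric]) (simp add: indicator_times_eq_if)
  have img: "?\<phi> ` ?S = ?S"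
  proof (intro set_eqI iffI)
    fix y :: real assume y: "y \<in> ?S"
    then have "y = ?\<phi> (c * y powr (1 / a))" using a c by (simp add: powr_powr)
    then show "y \<in> ?\<phi> ` ?S" using y c by (intro image_eqI[of _ _ "c * y powr (1 / a)"]) auto
  qed (use c in auto)
  have inj: "inj_on ?\<phi> ?S"
  proof (rule inj_onI)
    fix x y :: real assume xy: "x \<in> ?S" "y \<in> ?S" "?\<phi> x = ?\<phi> y"
    then have "?\<phi> x powr (1 / a) = ?\<phi> y powr (1 / a)" by simp
    then show "x = y" using xy(1,2) a c unfolding powr_powr by simp
  qed
  have "(\<lambda>x. \<bar>?\<phi>' x\<bar> * f (?\<phi> x)) absolutely_integrable_on ?S \<and> integral ?S (\<lambda>x. \<bar>?\<phi>' x\<bar> * f (?\<phi> x)) = I"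
  proof (rule iffD2[OF has_absolute_integral_change_of_variables_1'[where g = ?\<phi> and g' = ?\<phi>']])
    show "(?\<phi> has_real_derivative ?\<phi>' x) (at x within ?S)" if "x \<in> ?S" for x
      using that c by (auto intro!: derivative_eq_intros simp: powr_diff field_simps)
    have "f absolutely_integrable_on ?S"
      using hI f(2) by (intro nonnegative_absolutely_integrable_1) auto
    then show "f absolutely_integrable_on ?\<phi> ` ?S \<and> integral (?\<phi> ` ?S) f = I"
      using hI unfolding img by (auto simp: integral_unique)
  qed (use inj in auto)
  then have "((\<lambda>x. \<bar>?\<phi>' x\<bar> * f (?\<phi> x)) has_integral I) ?S"
    using set_lebesgue_integral_eq_integral(1) by (metis integrable_integral)
  then have "((\<lambda>x. \<bar>a\<bar> / c * (x / c) powr (a - 1) * f ((x / c) powr a) * indicator ?S x) has_integral I) UNIV"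
    using c by (subst (asm) has_integral_restrict_UNIV[symmetric], elim has_integral_eq[rotated])
      (simp_all add: indicator_def abs_mult)
  then have "(\<integral>\<^sup>+x. ennreal (\<bar>a\<bar> / c * (x / c) powr (a - 1) * f ((x / c) powr a) * indicator ?S x) \<partial>lborel) = I"
    using c f(2) by (intro nn_integral_has_integral_lborel) auto
  then show ?thesis using I by simp
qed

lemma nonneg_law_gamma_law [simp]:
  assumes "0 < r"
  shows "nonneg_law (gamma_law r)"
proof -
  have "(\<integral>\<^sup>+x. ennreal (if 0 \<le> x then x powr (r - 1) * exp (- x) / Gamma r else 0) \<partial>lborel) = ennreal 1"
  proof (rule nn_integral_has_integral_lborel)
    have "((\<lambda>t. t powr (r - 1) / exp t / Gamma r) has_integral Gamma r / Gamma r) {0..}"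
      by (intro has_integral_divide Gamma_integral_real assms)
    then show "((\<lambda>x. if 0 \<le> x then x powr (r - 1) * exp (- x) / Gamma r else 0) has_integral 1) UNIV"
      using Gamma_real_pos[OF assms]
      by (subst (asm) has_integral_restrict_UNIV[symmetric]) (simp add: exp_minus divide_inverse cong: if_cong)
  qed (use Gamma_real_pos[OF assms] in auto)
  then have "prob_space (gamma_law r)"
    unfolding gamma_law_def by (intro prob_spaceI) (simp add: emeasure_density)
  then show ?thesis
    unfolding nonneg_law_def gamma_law_def
    by (auto simp: AE_density intro!: real_distributionI)
qed

lemma AE_gamma_law_pos: "AE x in gamma_law r. 0 < x"
proof -
  have "AE x in lborel. x \<noteq> (0::real)" by (rule AE_lborel_singleton)
  then show ?thesis
    unfolding gamma_law_def by (subst AE_density) (auto elim!: eventually_mono)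
qed

text \<open>A rate \<open>1 / c powr a\<close> acts as a scale factor \<open>c\<close>. With
  \<open>c = n\<close> and \<open>a = \<alpha>'\<close> this is what the choice of
  \<open>\<mu>\<close> in the theorem achieves.\<close>

lemma gen_gamma_eq_distr:
  assumes r: "0 < r" and a: "a \<noteq> 0" and c: "0 < c"
  shows "gen_gamma r a (1 / c powr a) = distr (gamma_law r) borel (\<lambda>g. c * g powr (1 / a))"
proof (rule measure_eqI)
  let ?D = "distr (gamma_law r) borel (\<lambda>g. c * g powr (1 / a))" and ?gg = "gg_density r a (1 / c powr a)"
  interpret G: real_distribution "gamma_law r" using r by simp
  have Gamma: "0 < Gamma r" by (rule Gamma_real_pos) fact
  fix A assume "A \<in> sets (gen_gamma r a (1 / c powr a))"
  then have A[measurable]: "A \<in> sets borel" by (simp add: gen_gamma_def)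
  define f where "f g = (if 0 \<le> g then g powr (r - 1) * exp (- g) / Gamma r else 0) * indicator A (c * g powr (1 / a))" for g
  have f[measurable]: "f \<in> borel_measurable borel" unfolding f_def by measurable
  have f_nonneg: "0 \<le> f g" for g using Gamma by (simp add: f_def)
  have zero: "AE x in lborel. x \<noteq> (0::real)" by (rule AE_lborel_singleton)
  have "emeasure ?D A =
      (\<integral>\<^sup>+g. indicator A (c * g powr (1 / a)) \<partial>gamma_law r)"
    by (subst nn_integral_indicator[symmetric]) (simp_all add: nn_integral_distr del: nn_integral_indicator)
  also have "\<dots> = (\<integral>\<^sup>+g. ennreal (f g * indicator {0<..} g) \<partial>lborel)"
    unfolding gamma_law_def
    by (subst nn_integral_density)
       (auto simp: f_def ennreal_mult'' ennreal_indicator intro!: nn_integral_cong_AE eventually_mono[OF zero] split: split_indicator)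
  finally have distr: "emeasure ?D A =
      (\<integral>\<^sup>+g. ennreal (f g * indicator {0<..} g) \<partial>lborel)" .
  have "emeasure ?D A < \<infinity>"
    by (simp add: emeasure_distr less_top[symmetric])
  with distr have fin: "(\<integral>\<^sup>+g. ennreal (f g * indicator {0<..} g) \<partial>lborel) < \<infinity>" by simp
  have "?gg x * indicator A x = \<bar>a\<bar> / c * (x / c) powr (a - 1) * f ((x / c) powr a)"
    if x: "0 < x" for x
  proof -
    have "c * ((x / c) powr a) powr (1 / a) = x"
      using x a c by (simp add: powr_powr)
    moreover have "(1 / c powr a) powr r * x powr (a * r - 1) = (x / c) powr (a - 1) * ((x / c) powr a) powr (r - 1) / c"
    proof -
      have "(x / c) powr (a - 1) * ((x / c) powr a) powr (r - 1) = (x / c) powr (a * r - 1)"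
        by (simp add: powr_powr powr_add[symmetric] algebra_simps)
      also have "\<dots> = x powr (a * r - 1) / (c powr (a * r) / c)"
        using x c by (simp add: powr_divide powr_diff)
      also have "\<dots> = x powr (a * r - 1) * ((1 / c powr a) powr r) * c"
        using c by (simp add: powr_divide powr_powr field_simps)
      finally show ?thesis using c by simp
    qed
    moreover have "1 / c powr a * x powr a = (x / c) powr a"
      using x c by (simp add: powr_divide)
    ultimately show ?thesis
      using x unfolding gg_density_def f_def by (simp add: mult_ac)
  qed
  then have eq: "ennreal (?gg x) * indicator A x =
      ennreal (\<bar>a\<bar> / c * (x / c) powr (a - 1) * f ((x / c) powr a) * indicator {0<..} x)" if "x \<noteq> 0" for x
    using that by (cases "0 < x")
      (simp_all add: ennreal_indicator[symmetric] ennreal_mult''[symmetric] gg_density_def)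
  have [measurable]: "?gg \<in> borel_measurable borel"
    unfolding gg_density_def[abs_def] by measurable
  have "emeasure (gen_gamma r a (1 / c powr a)) A = (\<integral>\<^sup>+x. ennreal (?gg x) * indicator A x \<partial>lborel)"
    unfolding gen_gamma_def by (simp add: emeasure_density)
  also have "\<dots> = (\<integral>\<^sup>+x. ennreal (\<bar>a\<bar> / c * (x / c) powr (a - 1) * f ((x / c) powr a) * indicator {0<..} x) \<partial>lborel)"
    by (intro nn_integral_cong_AE eventually_mono[OF zero] eq)
  also have "\<dots> = (\<integral>\<^sup>+g. ennreal (f g * indicator {0<..} g) \<partial>lborel)"
    by (rule nn_integral_powr_substitution[OF a c f f_nonneg fin])
  finally show "emeasure (gen_gamma r a (1 / c powr a)) A = emeasure ?D A"
    using distr by simp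
qed (simp add: gen_gamma_def)

lemma gen_gamma_eq_pow_law:
  assumes "0 < r" "a \<noteq> 0"
  shows "gen_gamma r a 1 = pow_law (1 / a) (gamma_law r)"
  using gen_gamma_eq_distr[of r a 1] assms by (simp add: pow_law_def)

lemma gamma_law_1: "gamma_law 1 = weibull_law 1"
  unfolding gamma_law_def weibull_law_def by (intro density_cong) auto

lemma weibull_law_eq_pow_law:
  assumes "0 < b"
  shows "weibull_law b = pow_law (1 / b) (weibull_law 1)"
proof -
  have "weibull_law b = gen_gamma 1 b 1"
    unfolding weibull_law_def gen_gamma_def gg_density_def using assms
    by (intro density_cong AE_I2) auto
  then show ?thesis using gen_gamma_eq_pow_law[of 1 b] assms by (simp add: gamma_law_1)
qed

lemma nn_integral_gamma_law:
  assumes [measurable]: "f \<in> borel_measurable borel"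
  shows "(\<integral>\<^sup>+x. f x \<partial>gamma_law r) =
    (\<integral>\<^sup>+x. ennreal (if 0 \<le> x then x powr (r - 1) * exp (- x) / Gamma r else 0) * f x \<partial>lborel)"
  unfolding gamma_law_def by (subst nn_integral_density) auto

text \<open>The substitution is \<open>a = t u\<close>, \<open>b = t (1 - u)\<close>, with Jacobian \<open>t\<close>.\<close>

lemma gamma_pair_sum_ratio:
  fixes f :: "real \<Rightarrow> real \<Rightarrow> ennreal"
  assumes r: "0 < r" "r < 1" and f: "case_prod f \<in> borel_measurable (borel \<Otimes>\<^sub>M borel)"
  shows "(\<integral>\<^sup>+a. \<integral>\<^sup>+b. f (a + b) (a / (a + b)) \<partial>gamma_law (1 - r) \<partial>gamma_law r) =
    (\<integral>\<^sup>+t. \<integral>\<^sup>+u. ennreal (u powr (r - 1) * (1 - u) powr (- r) / (Gamma r * Gamma (1 - r)) * indicator {0<..<1} u) * f t u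
      \<partial>lborel \<partial>weibull_law 1)"
proof -
  have [measurable]: "(\<lambda>x. f (g x) (h x)) \<in> borel_measurable M"
    if "g \<in> borel_measurable M" "h \<in> borel_measurable M" for g h and M :: "'b measure"
    using measurable_compose[OF measurable_Pair[OF that] f] by simp
  define d where "d s x = (if 0 \<le> x then x powr (s - 1) * exp (- x) / Gamma s else 0)" for s x :: real
  have [measurable]: "d s \<in> borel_measurable borel" for s unfolding d_def by measurable
  have [measurable]: "(\<lambda>x. d s (g x)) \<in> borel_measurable M" if "g \<in> borel_measurable M" for s g and M :: "'c measure"
    using that by measurable
  have G: "0 < Gamma r" "0 < Gamma (1 - r)" using r by (auto intro: Gamma_real_pos)
  have d_nonneg: "0 \<le> d r x" "0 \<le> d (1 - r) x" for x using G by (auto simp: d_def)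
  let ?\<nu> = "\<lambda>u. u powr (r - 1) * (1 - u) powr (- r) / (Gamma r * Gamma (1 - r)) * indicator {0<..<1} u"
  have [measurable]: "(\<lambda>a. \<integral>\<^sup>+b. f (a + b) (a / (a + b)) \<partial>gamma_law (1 - r)) \<in> borel_measurable borel"
  proof -
    interpret real_distribution "gamma_law (1 - r)" using r by simp
    show ?thesis by (rule borel_measurable_nn_integral) simp
  qed
  have "(\<integral>\<^sup>+a. \<integral>\<^sup>+b. f (a + b) (a / (a + b)) \<partial>gamma_law (1 - r) \<partial>gamma_law r) =
      (\<integral>\<^sup>+a. ennreal (d r a) * (\<integral>\<^sup>+b. ennreal (d (1 - r) b) * f (a + b) (a / (a + b)) \<partial>lborel) \<partial>lborel)"
    by (subst nn_integral_gamma_law) (simp_all add: nn_integral_gamma_law d_def)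
  \<comment> \<open>The planar substitution is carried out in two one-dimensional pieces: the shift
    \<open>b = t - a\<close> here, and, after the integrals are exchanged, the scaling
    \<open>a = t * u\<close> for each fixed \<open>t\<close>.\<close>
  also have "\<dots> = (\<integral>\<^sup>+a. ennreal (d r a) * (\<integral>\<^sup>+t. ennreal (d (1 - r) (t - a)) * f t (a / t) \<partial>lborel) \<partial>lborel)"
  proof -
    have "(\<integral>\<^sup>+b. ennreal (d (1 - r) b) * f (a + b) (a / (a + b)) \<partial>lborel) =
        (\<integral>\<^sup>+t. ennreal (d (1 - r) (t - a)) * f t (a / t) \<partial>lborel)" for a
      by (subst nn_integral_real_affine[where c = 1 and t = "- a"]) (auto simp: algebra_simps)
    then show ?thesis by simp
  qed
  also have "\<dots> = (\<integral>\<^sup>+a. \<integral>\<^sup>+t. ennreal (d r a) * (ennreal (d (1 - r) (t - a)) * f t (a / t)) \<partial>lborel \<partial>lborel)"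
    by (intro nn_integral_cong nn_integral_cmult[symmetric]) simp
  also have "\<dots> = (\<integral>\<^sup>+t. \<integral>\<^sup>+a. ennreal (d r a) * (ennreal (d (1 - r) (t - a)) * f t (a / t)) \<partial>lborel \<partial>lborel)"
    by (rule lborel_pair.Fubini') simp
  also have "\<dots> = (\<integral>\<^sup>+t. ennreal (exponential_density 1 t) * (\<integral>\<^sup>+u. ennreal (?\<nu> u) * f t u \<partial>lborel) \<partial>lborel)"
  proof (rule nn_integral_cong_AE, rule eventually_mono[OF AE_lborel_singleton[of 0]])
    fix t :: real assume t: "t \<noteq> 0"
    show "(\<integral>\<^sup>+a. ennreal (d r a) * (ennreal (d (1 - r) (t - a)) * f t (a / t)) \<partial>lborel) =
        ennreal (exponential_density 1 t) * (\<integral>\<^sup>+u. ennreal (?\<nu> u) * f t u \<partial>lborel)"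
    proof (cases "0 < t")
      case True
      have "t * (d r (t * u) * d (1 - r) (t - t * u)) = exp (- t) * ?\<nu> u" for u
      proof (cases "0 < u \<and> u < 1")
        case True
        have "t - t * u = t * (1 - u)" by (simp add: algebra_simps)
        moreover have "(t * u) powr (r - 1) * (t * (1 - u)) powr (- r) = u powr (r - 1) * (1 - u) powr (- r) / t"
          using True \<open>0 < t\<close> by (simp add: powr_mult powr_diff powr_minus divide_simps)
        moreover have "exp (- (t * u)) * exp (- (t * (1 - u))) = exp (- t)"
          by (simp add: exp_add[symmetric] algebra_simps)
        moreover have "d r (t * u) * d (1 - r) (t * (1 - u)) = ((t * u) powr (r - 1) * (t * (1 - u)) powr (- r))
            * (exp (- (t * u)) * exp (- (t * (1 - u)))) / (Gamma r * Gamma (1 - r))"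
          using True \<open>0 < t\<close> by (simp add: d_def mult_ac)
        ultimately show ?thesis using True \<open>0 < t\<close> by simp
      next
        case False
        \<comment> \<open>Outside the unit interval one argument is negative; at its endpoints one
          factor is 0 because \<open>0 powr _ = 0\<close>.\<close>
        have "d r (t * u) * d (1 - r) (t - t * u) = 0"
        proof (cases "u \<le> 0")
          case True
          then show ?thesis using \<open>0 < t\<close> by (cases "u = 0") (auto simp: d_def zero_le_mult_iff)
        next
          case u: False
          then have "t - t * u = 0 \<or> t - t * u < 0"
            using False \<open>0 < t\<close> by (cases "u = 1") auto
          then show ?thesis by (auto simp: d_def)
        qed
        then show ?thesis using False by auto
      qed
      then have eq: "ennreal t * (ennreal (d r (t * u)) * (ennreal (d (1 - r) (t - t * u)) * f t u)) =
          ennreal (exp (- t)) * (ennreal (?\<nu> u) * f t u)" for u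
        using d_nonneg True G by (simp add: ennreal_mult'[symmetric] mult.assoc[symmetric])
      have "(\<integral>\<^sup>+a. ennreal (d r a) * (ennreal (d (1 - r) (t - a)) * f t (a / t)) \<partial>lborel) =
          ennreal t * (\<integral>\<^sup>+u. ennreal (d r (t * u)) * (ennreal (d (1 - r) (t - t * u)) * f t u) \<partial>lborel)"
        using True by (subst nn_integral_real_affine[where c = t and t = 0]) auto
      also have "\<dots> = (\<integral>\<^sup>+u. ennreal (exp (- t)) * (ennreal (?\<nu> u) * f t u) \<partial>lborel)"
        by (subst nn_integral_cmult[symmetric]) (simp_all add: eq)
      also have "\<dots> = ennreal (exp (- t)) * (\<integral>\<^sup>+u. ennreal (?\<nu> u) * f t u \<partial>lborel)"
        by (rule nn_integral_cmult) simp
      finally show ?thesis using True by (simp add: exponential_density_def)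
    next
      case False
      then have "d r a * d (1 - r) (t - a) = 0" for a using t by (auto simp: d_def)
      then have "ennreal (d r a) * (ennreal (d (1 - r) (t - a)) * f t (a / t)) = 0" for a
        using d_nonneg by (simp add: mult.assoc[symmetric] ennreal_mult'[symmetric])
      then show ?thesis using False t by (simp only: exponential_density_def) simp
    qed
  qed
  also have "\<dots> = (\<integral>\<^sup>+t. \<integral>\<^sup>+u. ennreal (?\<nu> u) * f t u \<partial>lborel \<partial>weibull_law 1)"
    unfolding weibull_law_1 by (subst nn_integral_density) auto
  finally show ?thesis .
qed

lemma nonneg_law_Z_law [simp]:
  assumes r: "0 < r" "r < 1"
  shows "nonneg_law (Z_law r)" "AE z in Z_law r. 0 < z"
proof -
  let ?P = "gamma_law r \<Otimes>\<^sub>M gamma_law (1 - r)"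
  interpret G: real_distribution "gamma_law r" using r by simp
  interpret H: real_distribution "gamma_law (1 - r)" using r by simp
  interpret P: pair_prob_space "gamma_law r" "gamma_law (1 - r)" ..
  have "AE x in ?P. 0 < (fst x + snd x) / fst x"
    by (rule AE_pair_measureI[OF G.prob_space_axioms H.prob_space_axioms AE_gamma_law_pos AE_gamma_law_pos])
       (simp, measurable)
  then have pos: "AE x in ?P. 0 < (case x of (a, b) \<Rightarrow> (a + b) / a)"
    by (simp add: case_prod_beta)
  then show "AE z in Z_law r. 0 < z"
    unfolding Z_law_def by (subst AE_distr_iff) auto
  have "AE x in ?P. 0 \<le> (case x of (a, b) \<Rightarrow> (a + b) / a)"
    using pos by (rule eventually_mono) simp
  then show "nonneg_law (Z_law r)"
    unfolding Z_law_def by (intro nonneg_law_distr P.prob_space_axioms) auto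
qed

text \<open>Beta-gamma algebra: the ratio \<open>1 / Z\<close> is beta distributed and independent
  of the sum of the two gamma variables, which is exponential because the shapes \<open>r\<close>
  and \<open>1 - r\<close> add up to 1. The first gamma variable is the sum times the ratio.\<close>

lemma gamma_law_eq_exponential_over_Z:
  assumes r: "0 < r" "r < 1"
  shows "gamma_law r = mult_conv (weibull_law 1) (pow_law (- 1) (Z_law r))"
proof -
  let ?P = "gamma_law r \<Otimes>\<^sub>M gamma_law (1 - r)" and ?B = "pow_law (- 1) (Z_law r)"
  define \<nu> where "\<nu> = density lborel
    (\<lambda>u. ennreal (u powr (r - 1) * (1 - u) powr (- r) / (Gamma r * Gamma (1 - r)) * indicator {0<..<1} u))"
  interpret G: real_distribution "gamma_law r" using r by simp
  interpret H: real_distribution "gamma_law (1 - r)" using r by simp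
  interpret P: pair_prob_space "gamma_law r" "gamma_law (1 - r)" ..
  have sum_ratio: "(\<integral>\<^sup>+a. \<integral>\<^sup>+b. f (a + b) (a / (a + b)) \<partial>gamma_law (1 - r) \<partial>gamma_law r) =
      (\<integral>\<^sup>+t. \<integral>\<^sup>+u. f t u \<partial>\<nu> \<partial>weibull_law 1)"
    if f: "case_prod f \<in> borel_measurable (borel \<Otimes>\<^sub>M borel)" for f :: "real \<Rightarrow> real \<Rightarrow> ennreal"
  proof -
    have "(\<lambda>u. f t u) \<in> borel_measurable borel" for t
      using measurable_compose[OF measurable_Pair[OF measurable_const[of t] measurable_ident] f] by simp
    then show ?thesis
      unfolding gamma_pair_sum_ratio[OF r f] \<nu>_def
      by (subst nn_integral_density) auto
  qed
  have sets_\<nu>: "sets \<nu> = sets borel" by (simp add: \<nu>_def)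
  have ratio: "?B = \<nu>"
  proof (rule measure_eqI)
    fix A assume "A \<in> sets ?B"
    then have A[measurable]: "A \<in> sets borel" by (simp add: pow_law_def)
    have "?B = distr ?P borel (\<lambda>x. ((fst x + snd x) / fst x) powr (- 1))"
      unfolding pow_law_def Z_law_def by (subst distr_distr) (auto simp: comp_def case_prod_beta')
    also have "\<dots> = distr ?P borel (\<lambda>x. fst x / (fst x + snd x))"
    proof (rule distr_cong_AE)
      show "AE x in ?P. ((fst x + snd x) / fst x) powr (- 1) = fst x / (fst x + snd x)"
        by (rule AE_pair_measureI[OF G.prob_space_axioms H.prob_space_axioms AE_gamma_law_pos AE_gamma_law_pos])
           (simp add: powr_minus, measurable)
    qed auto
    finally have "emeasure ?B A =
        (\<integral>\<^sup>+x. indicator A (fst x / (fst x + snd x)) \<partial>?P)"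
      by (subst nn_integral_indicator[symmetric]) (simp_all add: nn_integral_distr del: nn_integral_indicator)
    also have "\<dots> = (\<integral>\<^sup>+a. \<integral>\<^sup>+b. indicator A (a / (a + b)) \<partial>gamma_law (1 - r) \<partial>gamma_law r)"
      by (subst H.nn_integral_fst[symmetric]) auto
    also have "\<dots> = (\<integral>\<^sup>+t. \<integral>\<^sup>+u. indicator A u \<partial>\<nu> \<partial>weibull_law 1)"
      by (rule sum_ratio[of "\<lambda>t u. indicator A u"]) simp
    also have "\<dots> = emeasure \<nu> A"
      using W.emeasure_space_1 sets_\<nu> by simp
    finally show "emeasure ?B A = emeasure \<nu> A" .
  qed (simp add: sets_\<nu> pow_law_def)
  \<comment> \<open>The normalisation of the beta density comes from its being the law of
    \<open>1 / Z\<close>.\<close>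
  have \<nu>: "real_distribution \<nu>"
    unfolding ratio[symmetric] using r by simp
  show ?thesis
    unfolding ratio
  proof (rule real_distribution_eqI)
    fix A :: "real set" assume A[measurable]: "A \<in> sets borel"
    have "(\<integral>\<^sup>+x. indicator A x \<partial>gamma_law r) = (\<integral>\<^sup>+a. \<integral>\<^sup>+b. indicator A a \<partial>gamma_law (1 - r) \<partial>gamma_law r)"
      using H.emeasure_space_1 by simp
    also have "\<dots> = (\<integral>\<^sup>+a. \<integral>\<^sup>+b. indicator A ((a + b) * (a / (a + b))) \<partial>gamma_law (1 - r) \<partial>gamma_law r)"
    proof (rule nn_integral_cong_AE)
      show "AE a in gamma_law r. (\<integral>\<^sup>+b. indicator A a \<partial>gamma_law (1 - r)) =
          (\<integral>\<^sup>+b. indicator A ((a + b) * (a / (a + b))) \<partial>gamma_law (1 - r))"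
        using AE_gamma_law_pos[of r]
      proof eventually_elim
        case (elim a)
        show ?case
        proof (rule nn_integral_cong_AE)
          show "AE b in gamma_law (1 - r). indicator A a = (indicator A ((a + b) * (a / (a + b))) :: ennreal)"
            using AE_gamma_law_pos[of "1 - r"] by eventually_elim (use elim in auto)
        qed
      qed
    qed
    also have "\<dots> = (\<integral>\<^sup>+t. \<integral>\<^sup>+u. indicator A (t * u) \<partial>\<nu> \<partial>weibull_law 1)"
      by (rule sum_ratio[of "\<lambda>t u. indicator A (t * u)"]) simp
    also have "\<dots> = (\<integral>\<^sup>+x. indicator A x \<partial>mult_conv (weibull_law 1) \<nu>)"
      using \<nu> by (subst nn_integral_mult_conv) auto
    finally show "(\<integral>\<^sup>+x. indicator A x \<partial>gamma_law r) = (\<integral>\<^sup>+x. indicator A x \<partial>mult_conv (weibull_law 1) \<nu>)" .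
  qed (use \<nu> r in auto)
qed

section \<open>Exponential quotients and mixtures of stable laws\<close>

lemma emeasure_exponential_tail:
  assumes "0 \<le> c"
  shows "emeasure (weibull_law 1) {c<..} = ennreal (exp (- c))"
proof -
  have "distributed (weibull_law 1) lborel (\<lambda>x. x) (exponential_density 1)"
    unfolding distributed_def weibull_law_1 by (simp add: distr_id2)
  then have "measure (weibull_law 1) {c<..} = exp (- c)"
    using W.exponential_distributedD_gt[of "\<lambda>x. x" 1 c] assms by (simp add: greaterThan_def)
  then show ?thesis by (simp add: W.emeasure_eq_measure)
qed

lemma nonneg_law_eqI_tail:
  assumes M: "nonneg_law M" and N: "nonneg_law N"
    and eq: "\<And>x. 0 \<le> x \<Longrightarrow> emeasure M {x<..} = emeasure N {x<..}"
  shows "M = N"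
proof -
  interpret M: real_distribution M using M by simp
  interpret N: real_distribution N using N by simp
  have "cdf M x = cdf N x" for x
  proof (cases "0 \<le> x")
    case True
    have "{..x} = space M - {x<..}" "{..x} = space N - {x<..}" by auto
    then have "cdf M x = 1 - measure M {x<..}" "cdf N x = 1 - measure N {x<..}"
      using M.prob_compl[of "{x<..}"] N.prob_compl[of "{x<..}"] by (simp_all add: cdf_def)
    then show ?thesis using eq[OF True] by (simp add: measure_def)
  next
    case False
    have "cdf L x = 0" if "nonneg_law L" for L
    proof -
      interpret L: real_distribution L using that by simp
      have "cdf L x = measure L {}"
        unfolding cdf_def using nonneg_lawD(2)[OF that] False
        by (intro L.finite_measure_eq_AE) (auto elim!: eventually_mono)
      then show ?thesis by simp
    qed
    then show ?thesis using M N by simp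
  qed
  then show ?thesis
    by (intro cdf_unique') (auto simp: fun_eq_iff M.finite_borel_measure_axioms N.finite_borel_measure_axioms
      intro: real_distribution_nonneg M N)
qed

lemma positive_stable_nonneg [simp]: "positive_stable a S \<Longrightarrow> nonneg_law S"
  by (simp add: positive_stable_def)

text \<open>The transform of \<open>S\<close> is a tail probability: given \<open>S = s\<close>, the
  event \<open>W / s > x\<close> has probability \<open>exp (- x * s)\<close>, and averaging gives
  \<open>exp (- (x powr a))\<close>, the tail of \<open>W powr (1 / a)\<close>.\<close>

lemma exponential_over_stable:
  assumes S: "positive_stable a S" and a: "0 < a"
  shows "pow_law (1 / a) (weibull_law 1) = mult_conv (weibull_law 1) (pow_law (- 1) S)"
proof (rule nonneg_law_eqI_tail)
  let ?Q = "mult_conv (weibull_law 1) (pow_law (- 1) S)" and ?L = "pow_law (1 / a) (weibull_law 1)"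
  have nS: "nonneg_law S" using S by simp
  interpret S: real_distribution S using nS by simp
  fix x :: real assume x: "0 \<le> x"
  have "emeasure ?L {x<..} = emeasure (weibull_law 1) {x powr a<..}"
  proof -
    have iff: "x < w powr (1 / a) \<longleftrightarrow> x powr a < w" if "0 \<le> w" for w
    proof -
      have "x < w powr (1 / a) \<longleftrightarrow> x powr a < (w powr (1 / a)) powr a"
        using a x that by (metis linorder_not_less powr_ge_zero powr_less_mono2 powr_mono2 less_imp_le)
      then show ?thesis using a that by (simp add: powr_powr)
    qed
    have "emeasure ?L {x<..} = emeasure (weibull_law 1) {w. x < w powr (1 / a)}"
      unfolding pow_law_def by (subst emeasure_distr) (auto simp: vimage_def)
    also have "\<dots> = emeasure (weibull_law 1) {x powr a<..}"
      using nonneg_lawD(2)[OF nonneg_law_weibull_1]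
      by (intro emeasure_eq_AE) (auto elim!: eventually_mono simp: iff)
    finally show ?thesis .
  qed
  also have "\<dots> = ennreal (exp (- (x powr a)))"
    by (rule emeasure_exponential_tail) simp
  finally have lhs: "emeasure ?L {x<..} = ennreal (exp (- (x powr a)))" .
  have "emeasure ?Q {x<..} =
      (\<integral>\<^sup>+w. indicator {x<..} w \<partial>?Q)"
    by (simp add: mult_conv_def)
  also have "\<dots> = (\<integral>\<^sup>+s. \<integral>\<^sup>+w. indicator {x<..} (w * s) \<partial>weibull_law 1 \<partial>pow_law (- 1) S)"
    by (subst nn_integral_mult_conv(2)) (auto simp: nS)
  also have "\<dots> = (\<integral>\<^sup>+s. \<integral>\<^sup>+w. indicator {x<..} (w * s powr (- 1)) \<partial>weibull_law 1 \<partial>S)"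
    unfolding pow_law_def
    by (subst nn_integral_distr) (auto intro!: W.borel_measurable_nn_integral)
  also have "\<dots> = (\<integral>\<^sup>+s. ennreal (exp (- x * s)) \<partial>S)"
  proof (rule nn_integral_cong_AE)
    show "AE s in S. (\<integral>\<^sup>+w. indicator {x<..} (w * s powr (- 1)) \<partial>weibull_law 1) = ennreal (exp (- x * s))"
      using positive_stable_AE_pos[OF S a]
    proof eventually_elim
      case (elim s)
      have "(\<integral>\<^sup>+w. indicator {x<..} (w * s powr (- 1)) \<partial>weibull_law 1) =
          (\<integral>\<^sup>+w. indicator {x * s<..} w \<partial>weibull_law 1)"
        using elim by (intro nn_integral_cong) (auto simp: powr_minus field_simps indicator_def)
      also have "\<dots> = emeasure (weibull_law 1) {x * s<..}" by simp
      also have "\<dots> = ennreal (exp (- (x * s)))"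
        using x elim by (intro emeasure_exponential_tail) simp
      finally show ?case by simp
    qed
  qed
  also have "\<dots> = ennreal (exp (- (x powr a)))"
    using nn_integral_exp_laplace[OF nS x] S x by (simp add: positive_stable_def)
  finally show "emeasure ?L {x<..} =
      emeasure ?Q {x<..}"
    using lhs by simp
qed (use S in auto)

text \<open>Given \<open>U = u\<close>, the variable \<open>S * u powr (1 / a)\<close> has transform
  \<open>exp (- (s powr a) * u)\<close>; averaging over \<open>u\<close> is the transform of
  \<open>U\<close> at \<open>s powr a\<close>.\<close>

lemma laplace_stable_mixture:
  assumes S: "positive_stable a S" and a: "0 < a" and U: "nonneg_law U" and s: "0 \<le> s"
  shows "laplace (mult_conv S (pow_law (1 / a) U)) s = laplace U (s powr a)"
proof (rule laplace_eqI)
  let ?A = "mult_conv S (pow_law (1 / a) U)"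
  have nS: "nonneg_law S" using S by simp
  interpret S: real_distribution S using nS by simp
  interpret U: real_distribution U using U by simp
  show "nonneg_law ?A" using nS U by simp
  show "0 \<le> laplace U (s powr a)"
    using laplace_pos[OF U, of "s powr a"] by simp
  have "(\<integral>\<^sup>+x. ennreal (exp (- s * x)) \<partial>?A) =
      (\<integral>\<^sup>+u. \<integral>\<^sup>+x. ennreal (exp (- s * (x * u))) \<partial>S \<partial>pow_law (1 / a) U)"
    by (subst nn_integral_mult_conv(2)) (auto simp: U nS)
  also have "\<dots> = (\<integral>\<^sup>+u. \<integral>\<^sup>+x. ennreal (exp (- s * (x * u powr (1 / a)))) \<partial>S \<partial>U)"
    unfolding pow_law_def by (subst nn_integral_distr) (auto intro!: S.borel_measurable_nn_integral)
  also have "\<dots> = (\<integral>\<^sup>+u. ennreal (exp (- (s powr a) * u)) \<partial>U)"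
  proof (rule nn_integral_cong_AE)
    show "AE u in U. (\<integral>\<^sup>+x. ennreal (exp (- s * (x * u powr (1 / a)))) \<partial>S) = ennreal (exp (- (s powr a) * u))"
      using nonneg_lawD(2)[OF U]
    proof eventually_elim
      case (elim u)
      have "(\<integral>\<^sup>+x. ennreal (exp (- s * (x * u powr (1 / a)))) \<partial>S) = (\<integral>\<^sup>+x. ennreal (exp (- (s * u powr (1 / a)) * x)) \<partial>S)"
        by (simp add: mult_ac)
      also have "\<dots> = ennreal (exp (- ((s * u powr (1 / a)) powr a)))"
        using nn_integral_exp_laplace[OF nS, of "s * u powr (1 / a)"] S s by (simp add: positive_stable_def)
      also have "(s * u powr (1 / a)) powr a = s powr a * u"
        using s elim a by (simp add: powr_mult powr_powr)
      finally show ?case by simp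
    qed
  qed
  also have "\<dots> = ennreal (laplace U (s powr a))"
    by (rule nn_integral_exp_laplace[OF U]) simp
  finally show "(\<integral>\<^sup>+x. ennreal (exp (- s * x)) \<partial>?A) = ennreal (laplace U (s powr a))" .
qed fact

text \<open>The stable mixture with exponential \<open>U\<close> has transform
  \<open>1 / (1 + s powr a)\<close>, which determines the law.\<close>

lemma mittag_leffler_eq:
  assumes S: "positive_stable a S" and a: "0 < a" and ml: "mittag_leffler a mlaw"
  shows "mlaw = mult_conv (pow_law (1 / a) (weibull_law 1)) S"
proof (rule laplace_uniqueness)
  let ?A = "mult_conv (pow_law (1 / a) (weibull_law 1)) S"
  have comm: "?A = mult_conv S (pow_law (1 / a) (weibull_law 1))"
    using S by (intro mult_conv_commute) auto
  show "nonneg_law mlaw" using ml by (simp add: mittag_leffler_def nonneg_law_def)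
  show "nonneg_law ?A" using S by simp
  fix s :: real assume "0 < s"
  then show "laplace mlaw s = laplace ?A s"
    using ml laplace_stable_mixture[OF S a nonneg_law_weibull_1, of s]
    unfolding comm mittag_leffler_def by (simp add: laplace_def[of mlaw] laplace_exponential)
qed

section \<open>The Laplace law as a normal mixture\<close>

text \<open>The imaginary axis is what the Laplace law requires. Integrability is inherited from the
  bounded integrand \<open>exp (- z * x)\<close> under the exponential law, also for
  \<open>Re z = 0\<close>; the value then follows from the fundamental theorem of calculus.\<close>

lemma complex_laplace_exponential:
  assumes z: "0 \<le> Re z"
  shows "complex_laplace (weibull_law 1) z = 1 / (1 + z)"
proof -
  have nz: "1 + z \<noteq> 0" using z by (auto simp: complex_eq_iff)
  let ?F = "\<lambda>x::real. - exp (- (1 + z) * of_real x) / (1 + z)"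
  let ?f = "\<lambda>x::real. exp (- (1 + z) * of_real x)"
  have int: "integrable (weibull_law 1) (\<lambda>x. exp (- z * of_real x))"
    by (rule integrable_complex_exp[OF nonneg_law_weibull_1 z])
  have dens: "exponential_density 1 x *\<^sub>R exp (- z * of_real x) = indicator {0..} x *\<^sub>R ?f x" for x
    by (auto simp: exponential_density_def scaleR_conv_of_real exp_of_real[symmetric] exp_add[symmetric] algebra_simps split: split_indicator)
  have "integrable lborel (\<lambda>x. exponential_density 1 x *\<^sub>R exp (- z * of_real x))"
    using int unfolding weibull_law_1
    by (subst (asm) integrable_density) (auto simp: exponential_density_def)
  then have int0: "set_integrable lborel {0..} ?f"
    unfolding dens set_integrable_def .
  then have int': "set_integrable lborel (einterval 0 \<infinity>) ?f"
    by (rule set_integrable_subset) (auto simp: einterval_def zero_ereal_def)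
  have "(LBINT x=0..\<infinity>. ?f x) = 0 - (- 1 / (1 + z))"
  proof (rule interval_integral_FTC_integrable[where F = ?F])
    show "(?F has_vector_derivative ?f x) (at x)" for x
    proof -
      have "((\<lambda>w. - exp (- (1 + z) * w) / (1 + z)) has_field_derivative exp (- (1 + z) * of_real x)) (at (of_real x))"
        by (rule derivative_eq_intros refl)+ (use nz in \<open>simp_all del: minus_add_distrib\<close>)
      then show ?thesis by (rule has_vector_derivative_real_field)
    qed
    show "((?F \<circ> real_of_ereal) \<longlongrightarrow> - 1 / (1 + z)) (at_right 0)"
      unfolding zero_ereal_def ereal_tendsto_simps using nz by (auto intro!: tendsto_eq_intros)
    show "((?F \<circ> real_of_ereal) \<longlongrightarrow> 0) (at_left \<infinity>)"
      unfolding ereal_tendsto_simps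
    proof (rule tendsto_norm_zero_cancel)
      have "((\<lambda>x. exp (- (1 + Re z) * x) / norm (1 + z)) \<longlongrightarrow> 0) at_top"
        using z nz by real_asymp
      then show "((\<lambda>x. norm (?F x)) \<longlongrightarrow> 0) at_top"
        by (simp add: norm_divide norm_exp_eq_Re)
    qed
  qed (use int' in \<open>auto intro!: continuous_intros\<close>)
  moreover have "complex_laplace (weibull_law 1) z = (\<integral>x. indicator {0..} x *\<^sub>R ?f x \<partial>lborel)"
    unfolding complex_laplace_def weibull_law_1
    by (subst integral_density) (simp_all only: dens, auto simp: exponential_density_def)
  moreover have "(\<integral>x. indicator {0..} x *\<^sub>R ?f x \<partial>lborel) = (LBINT x=0..\<infinity>. ?f x)"
    unfolding zero_ereal_def interval_integral_to_infinity_eq set_lebesgue_integral_def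
    by (intro integral_cong_AE eventually_mono[OF AE_lborel_singleton[of 0]]) (auto split: split_indicator)
  ultimately show ?thesis by simp
qed

text \<open>The Laplace law is the even mixture of the laws of \<open>W\<close> and
  \<open>- W\<close>, so its characteristic function is half of
  \<open>1 / (1 - \<i> t) + 1 / (1 + \<i> t)\<close>.\<close>

lemma char_laplace_law: "char laplace_law t = of_real (1 / (1 + t\<^sup>2))"
proof -
  let ?d = "exponential_density 1"
  have d: "?d \<in> borel_measurable borel" "\<And>x. 0 \<le> ?d x" by (auto simp: exponential_density_def)
  have char_W: "char (weibull_law 1) u = (\<integral>x. ?d x *\<^sub>R iexp (u * x) \<partial>lborel)" for u
    unfolding char_def weibull_law_1 using d by (subst integral_density) auto
  have int: "integrable lborel (\<lambda>x. ?d x *\<^sub>R iexp (u * x))" for u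
  proof -
      have "integrable (weibull_law 1) (\<lambda>x. iexp (u * x))"
      by (intro W.integrable_const_bound[where B = 1]) auto
    then show ?thesis
      using d unfolding weibull_law_1 by (subst (asm) integrable_density) auto
  qed
  have int': "integrable lborel (\<lambda>x. ?d (- x) *\<^sub>R iexp (t * x))"
    using lborel_integrable_real_affine[OF int[of "- t"], of "- 1" 0] by simp
  have "char laplace_law t = (\<integral>x. (exp (- \<bar>x\<bar>) / 2) *\<^sub>R iexp (t * x) \<partial>lborel)"
    unfolding char_def laplace_law_def by (subst integral_density) auto
  also have "\<dots> = (\<integral>x. (1 / 2) *\<^sub>R (?d x *\<^sub>R iexp (t * x) + ?d (- x) *\<^sub>R iexp (t * x)) \<partial>lborel)"
    by (intro integral_cong_AE eventually_mono[OF AE_lborel_singleton[of 0]])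
       (auto simp: exponential_density_def scaleR_conv_of_real)
  also have "\<dots> = (1 / 2) *\<^sub>R (char (weibull_law 1) t + (\<integral>x. ?d (- x) *\<^sub>R iexp (t * x) \<partial>lborel))"
    using int[of t] int' by (simp add: char_W)
  also have "(\<integral>x. ?d (- x) *\<^sub>R iexp (t * x) \<partial>lborel) = char (weibull_law 1) (- t)"
    unfolding char_W by (subst lborel_integral_real_affine[where c = "- 1" and t = 0]) auto
  also have "char (weibull_law 1) t + char (weibull_law 1) (- t) = 1 / (1 - \<i> * of_real t) + 1 / (1 + \<i> * of_real t)"
    by (simp add: char_eq_complex_laplace complex_laplace_exponential)
  also have "\<dots> = 2 / (1 + (of_real t)\<^sup>2)"
  proof -
    have "1 - \<i> * of_real t \<noteq> 0" "1 + \<i> * of_real t \<noteq> 0" by (auto simp: complex_eq_iff)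
    moreover have "(1 - \<i> * of_real t) * (1 + \<i> * of_real t) = 1 + (of_real t)\<^sup>2"
      by (simp add: algebra_simps power2_eq_square)
    ultimately show ?thesis by (simp add: add_frac_eq)
  qed
  finally show ?thesis by (simp add: scaleR_conv_of_real)
qed

text \<open>Folding at 0 adds the two halves of the density. The same computation on the whole line
  gives total mass 1.\<close>

lemma real_distribution_laplace_law: "real_distribution laplace_law"
  and distr_abs_laplace_law: "distr laplace_law borel abs = weibull_law 1"
proof -
  let ?d = "exponential_density 1"
  have d[measurable]: "?d \<in> borel_measurable borel" and d0: "\<And>x. 0 \<le> ?d x" by (auto simp: exponential_density_def)
  have abs: "(\<integral>\<^sup>+x. indicator A \<bar>x\<bar> \<partial>laplace_law) = emeasure (weibull_law 1) A"
    if A[measurable]: "A \<in> sets borel" for A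
  proof -
    have "(\<integral>\<^sup>+x. indicator A \<bar>x\<bar> \<partial>laplace_law) = (\<integral>\<^sup>+x. ennreal (exp (- \<bar>x\<bar>) / 2) * indicator A \<bar>x\<bar> \<partial>lborel)"
      unfolding laplace_law_def by (subst nn_integral_density) auto
    also have "\<dots> = (\<integral>\<^sup>+x. ennreal (?d x / 2) * indicator A \<bar>x\<bar> + ennreal (?d (- x) / 2) * indicator A \<bar>x\<bar> \<partial>lborel)"
      by (intro nn_integral_cong_AE eventually_mono[OF AE_lborel_singleton[of 0]])
         (auto simp: exponential_density_def split: split_indicator)
    also have "\<dots> = (\<integral>\<^sup>+x. ennreal (?d x / 2) * indicator A \<bar>x\<bar> \<partial>lborel)
        + (\<integral>\<^sup>+x. ennreal (?d (- x) / 2) * indicator A \<bar>x\<bar> \<partial>lborel)"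
      by (rule nn_integral_add) simp_all
    also have "(\<integral>\<^sup>+x. ennreal (?d (- x) / 2) * indicator A \<bar>x\<bar> \<partial>lborel) = (\<integral>\<^sup>+x. ennreal (?d x / 2) * indicator A \<bar>x\<bar> \<partial>lborel)"
      by (subst nn_integral_real_affine[where c = "- 1" and t = 0]) auto
    also have "(\<integral>\<^sup>+x. ennreal (?d x / 2) * indicator A \<bar>x\<bar> \<partial>lborel) + (\<integral>\<^sup>+x. ennreal (?d x / 2) * indicator A \<bar>x\<bar> \<partial>lborel)
        = (\<integral>\<^sup>+x. ennreal (?d x) * indicator A x \<partial>lborel)"
      by (subst nn_integral_add[symmetric])
         (auto simp: exponential_density_def ennreal_plus[symmetric] simp del: ennreal_plus intro!: nn_integral_cong split: split_indicator)
    also have "\<dots> = emeasure (weibull_law 1) A"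
      unfolding weibull_law_1 by (simp add: emeasure_density)
    finally show ?thesis .
  qed
  have "emeasure laplace_law (space laplace_law) = 1"
    using abs[of UNIV] W.emeasure_space_1 by simp
  then show "real_distribution laplace_law"
    by (intro real_distributionI prob_spaceI) (auto simp: laplace_law_def)
  show "distr laplace_law borel abs = weibull_law 1"
  proof (rule measure_eqI)
    fix A assume "A \<in> sets (distr laplace_law borel abs)"
    then have [measurable]: "A \<in> sets borel" by simp
    have [measurable]: "abs \<in> borel_measurable laplace_law" by (simp add: laplace_law_def)
    have "emeasure (distr laplace_law borel abs) A = (\<integral>\<^sup>+x. indicator A \<bar>x\<bar> \<partial>laplace_law)"
      by (subst nn_integral_indicator[symmetric]) (simp_all add: nn_integral_distr del: nn_integral_indicator)
    then show "emeasure (distr laplace_law borel abs) A = emeasure (weibull_law 1) A"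
      using abs[of A] by simp
  qed simp
qed

text \<open>Given \<open>W = w\<close>, a standard normal variable times \<open>sqrt (2 * w)\<close>
  has characteristic function \<open>exp (- t^2 * w)\<close>; averaging gives
  \<open>1 / (1 + t^2)\<close>, the Laplace law, and absolute values turn that law into the
  exponential one.\<close>

lemma normal_times_sqrt_exponential:
  "mult_conv (distr std_normal_law borel abs) (distr (weibull_law 1) borel (\<lambda>w. sqrt (2 * w))) = weibull_law 1"
proof -
  let ?P = "std_normal_law \<Otimes>\<^sub>M weibull_law 1"
  have N: "real_distribution std_normal_law"
    unfolding std_normal_law_def by (rule real_dist_normal_dist)
  interpret N: real_distribution std_normal_law by (fact N)
  interpret P: pair_prob_space std_normal_law "weibull_law 1" ..
  define D where "D = distr ?P borel (\<lambda>(y, w). y * sqrt (2 * w))"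
  have D: "real_distribution D"
    unfolding D_def by (intro real_distributionI P.prob_space_distr) auto
  have "char D t = char laplace_law t" for t
  proof -
    have "char D t = (\<integral>x. iexp (t * (fst x * sqrt (2 * snd x))) \<partial>?P)"
      unfolding char_def D_def by (subst integral_distr) (auto simp: case_prod_beta)
    also have "\<dots> = (\<integral>w. \<integral>y. iexp (t * (y * sqrt (2 * w))) \<partial>std_normal_law \<partial>weibull_law 1)"
    proof -
      have "integrable ?P (\<lambda>(y, w). iexp (t * (y * sqrt (2 * w))))"
        by (intro P.integrable_const_bound[where B = 1]) (auto simp: case_prod_beta')
      from P.integral_snd[OF this] show ?thesis by (simp add: case_prod_beta')
    qed
    also have "\<dots> = (\<integral>w. char std_normal_law (t * sqrt (2 * w)) \<partial>weibull_law 1)"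
      by (simp add: char_def mult_ac)
    also have "\<dots> = (\<integral>w. of_real (exp (- (t\<^sup>2) * w)) \<partial>weibull_law 1)"
    proof (rule integral_cong_AE)
      show "AE w in weibull_law 1. char std_normal_law (t * sqrt (2 * w)) = of_real (exp (- (t\<^sup>2) * w))"
        using nonneg_lawD(2)[OF nonneg_law_weibull_1]
        by eventually_elim (simp add: std_normal_law_def char_std_normal_distribution power_mult_distrib)
      show "(\<lambda>w. char std_normal_law (t * sqrt (2 * w))) \<in> borel_measurable (weibull_law 1)"
        unfolding std_normal_law_def char_std_normal_distribution by measurable
    qed auto
    also have "\<dots> = of_real (laplace (weibull_law 1) (t\<^sup>2))"
      unfolding laplace_def by (rule integral_complex_of_real)
    also have "\<dots> = char laplace_law t"
      by (simp add: laplace_exponential char_laplace_law)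
    finally show ?thesis .
  qed
  then have "D = laplace_law"
    by (intro Levy_uniqueness D real_distribution_laplace_law) auto
  have "weibull_law 1 = distr D borel abs"
    unfolding \<open>D = laplace_law\<close> distr_abs_laplace_law ..
  also have "\<dots> = distr ?P borel (\<lambda>x. \<bar>fst x * sqrt (2 * snd x)\<bar>)"
    unfolding D_def by (subst distr_distr) (auto simp: comp_def case_prod_beta')
  also have "\<dots> = mult_conv (distr std_normal_law borel abs) (distr (weibull_law 1) borel (\<lambda>w. sqrt (2 * w)))"
  proof (rule distr_pair_eq_mult_conv)
    have "AE w in weibull_law 1. \<bar>y * sqrt (2 * w)\<bar> = \<bar>y\<bar> * sqrt (2 * w)" for y
      using nonneg_lawD(2)[OF nonneg_law_weibull_1]
      by eventually_elim (simp add: abs_mult)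
    then show "AE y in std_normal_law. AE w in weibull_law 1. \<bar>fst (y, w) * sqrt (2 * snd (y, w))\<bar> = \<bar>y\<bar> * sqrt (2 * w)"
      by simp
  qed (auto intro: N.prob_space_axioms W.prob_space_axioms)
  finally show ?thesis ..
qed

section \<open>Uniform convergence of distribution functions\<close>

text \<open>Polya's theorem: monotonicity controls \<open>G n - F\<close> between quantiles \<open>q j\<close> with
  \<open>F (q j) = j / k\<close>.\<close>

lemma polya_uniform_convergence:
  fixes F :: "real \<Rightarrow> real" and G :: "nat \<Rightarrow> real \<Rightarrow> real"
  assumes contF: "continuous_on UNIV F" and monoF: "mono F"
    and bot: "(F \<longlongrightarrow> 0) at_bot" and top: "(F \<longlongrightarrow> 1) at_top"
    and monoG: "\<And>n. mono (G n)" and G01: "\<And>n x. 0 \<le> G n x" "\<And>n x. G n x \<le> 1"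
    and lim: "\<And>x. (\<lambda>n. G n x) \<longlonglongrightarrow> F x" and "0 < e"
  shows "\<forall>\<^sub>F n in sequentially. \<forall>x. \<bar>G n x - F x\<bar> \<le> e"
proof -
  have F01: "0 \<le> F x" "F x \<le> 1" for x
    using lim[of x] G01 by (auto intro: LIMSEQ_le_const LIMSEQ_le_const2)
  \<comment> \<open>The estimates below lose \<open>2 / k\<close> upwards and \<open>3 / k\<close>
    downwards.\<close>
  obtain k :: nat where k: "3 / e < real k" using reals_Archimedean2 by blast
  then have "0 < real k" using \<open>0 < e\<close> by (meson divide_pos_pos less_trans zero_less_numeral)
  then have k0: "0 < k" and k3: "3 / real k \<le> e"
    using k \<open>0 < e\<close> by (auto simp: field_simps)
  have "\<exists>x. F x = p" if "0 < p" "p < 1" for p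
  proof -
    have "\<forall>\<^sub>F x in at_bot. F x < p" "\<forall>\<^sub>F x in at_top. p < F x"
      using order_tendstoD(2)[OF bot] order_tendstoD(1)[OF top] that by auto
    then obtain a b where ab: "F a < p" "p < F b"
      using eventually_happens'[OF trivial_limit_at_bot_linorder] eventually_happens'[OF trivial_limit_at_top_linorder]
      by blast
    then have "a \<le> b" using monoD[OF monoF, of b a] by linarith
    then show ?thesis
      using IVT'[of F a p b] ab continuous_on_subset[OF contF] by auto
  qed
  then have "\<exists>x. j \<in> {1..<k} \<longrightarrow> F x = real j / real k" for j
    using k0 by (cases "j \<in> {1..<k}") auto
  then obtain q where q: "\<And>j. j \<in> {1..<k} \<Longrightarrow> F (q j) = real j / real k" by metis
  have "\<forall>\<^sub>F n in sequentially. \<forall>j\<in>{1..<k}. \<bar>G n (q j) - F (q j)\<bar> < 1 / real k"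
  proof (rule eventually_ball_finite)
    show "\<forall>j\<in>{1..<k}. \<forall>\<^sub>F n in sequentially. \<bar>G n (q j) - F (q j)\<bar> < 1 / real k"
      using lim k0 unfolding tendsto_iff dist_real_def by simp
  qed simp
  then show ?thesis
  proof eventually_elim
    case (elim n)
    show ?case
    proof
      fix x
      define j where "j = nat \<lfloor>real k * F x\<rfloor>"
      have "0 \<le> real k * F x" using F01[of x] by simp
      then have j: "real j \<le> real k * F x" "real k * F x < real j + 1"
        unfolding j_def by linarith+
      have upper: "G n x \<le> F x + 2 / real k"
      \<comment> \<open>Near the top there is no quantile \<open>q (j + 1)\<close>, but
        \<open>F x\<close> is already within \<open>2 / k\<close> of 1.\<close>
      proof (cases "k \<le> Suc j")
        case True
        then have "real k * 1 \<le> real k * (F x + 2 / real k)" using j k0 by (simp add: distrib_left)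
        then have "1 \<le> F x + 2 / real k" using k0 by (subst (asm) mult_le_cancel_left_pos) auto
        then show ?thesis using G01(2)[of n x] by linarith
      next
        case False
        then have J: "Suc j \<in> {1..<k}" by simp
        have "F x < F (q (Suc j))"
          using j k0 by (simp add: q[OF J] field_simps)
        then have "x \<le> q (Suc j)" using monoD[OF monoF, of "q (Suc j)" x] by linarith
        then have "G n x \<le> G n (q (Suc j))" by (rule monoD[OF monoG])
        also have "\<dots> \<le> F (q (Suc j)) + 1 / real k" using elim[rule_format, OF J] by linarith
        also have "\<dots> = (real j + 2) / real k" by (simp add: q[OF J] add_divide_distrib)
        also have "\<dots> \<le> F x + 2 / real k" using j k0 by (simp add: field_simps)
        finally show ?thesis .
      qed
      have lower: "F x - 3 / real k \<le> G n x"
      proof (cases "j \<le> 1")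
        case True
        then have "real k * F x \<le> 3" using j by linarith
        then have "F x \<le> 3 / real k" using k0 by (simp add: field_simps)
        then show ?thesis using G01(1)[of n x] by linarith
      next
        case False
        have "real k * F x \<le> real k * 1" using F01[of x] by (intro mult_left_mono) auto
        then have "real j \<le> real k" using j by linarith
        then have J: "j - 1 \<in> {1..<k}" using False k0 by auto
        \<comment> \<open>Monotonicity of \<open>F\<close> orders two points only if their values
          differ strictly, and \<open>F (q j) = F x\<close> may occur; hence the step down to
          \<open>q (j - 1)\<close> and the constant 3.\<close>
        have "F (q (j - 1)) < F x"
          using j k0 False unfolding q[OF J] by (simp add: of_nat_diff field_simps)
        then have "q (j - 1) \<le> x" using monoD[OF monoF, of x "q (j - 1)"] by linarith
        then have "G n (q (j - 1)) \<le> G n x" by (rule monoD[OF monoG])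
        moreover have "F (q (j - 1)) - 1 / real k \<le> G n (q (j - 1))" using elim[rule_format, OF J] by linarith
        moreover have "F (q (j - 1)) - 1 / real k = (real j - 2) / real k"
          using False unfolding q[OF J] by (simp add: diff_divide_distrib[symmetric] of_nat_diff)
        moreover have "F x - 3 / real k \<le> (real j - 2) / real k"
        proof -
          have "F x \<le> (real j + 1) / real k" using j k0 by (simp add: field_simps)
          then show ?thesis by (simp add: add_divide_distrib diff_divide_distrib)
        qed
        ultimately show ?thesis by linarith
      qed
      have "2 / real k \<le> 3 / real k" using k0 by (simp add: divide_right_mono)
      then show "\<bar>G n x - F x\<bar> \<le> e" using upper lower k3 by linarith
    qed
  qed
qed

lemma atMost_minus_lessThan: "{..x} - {..<x} = {x :: 'a :: linorder}"
  by auto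

lemma weak_conv_uniform:
  assumes Mn: "\<And>n. real_distribution (Mn n)" and A: "real_distribution A"
    and wc: "weak_conv_m Mn A" and no_atoms: "\<And>x. measure A {x} = 0"
  shows "(\<lambda>n. SUP x\<in>{0::real..}. \<bar>measure (Mn n) {..<x} - measure A {..<x}\<bar>) \<longlonglongrightarrow> 0"
proof (rule tendstoI)
  fix e :: real assume e: "0 < e"
  interpret A: real_distribution A by fact
  have F: "measure A {..<x} = cdf A x" for x
  proof -
    have "cdf A x = measure A ({..<x} \<union> {x})" unfolding cdf_def by (rule arg_cong[where f = "measure A"]) auto
    also have "\<dots> = measure A {..<x} + measure A {x}" by (rule A.finite_measure_Union) auto
    finally show ?thesis using no_atoms by simp
  qed
  \<comment> \<open>\<open>e / 2\<close>, because passing to the supremum leaves only a weak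
    inequality.\<close>
  have "\<forall>\<^sub>F n in sequentially. \<forall>x. \<bar>measure (Mn n) {..<x} - measure A {..<x}\<bar> \<le> e / 2"
  proof (rule polya_uniform_convergence)
    show "continuous_on UNIV (\<lambda>x. measure A {..<x})"
      unfolding F using A.isCont_cdf no_atoms by (simp add: continuous_on_eq_continuous_at)
    show "mono (\<lambda>x. measure A {..<x})"
      unfolding F by (intro monoI A.cdf_nondecreasing)
    show "((\<lambda>x. measure A {..<x}) \<longlongrightarrow> 0) at_bot" "((\<lambda>x. measure A {..<x}) \<longlongrightarrow> 1) at_top"
      unfolding F by (rule A.cdf_lim_at_bot A.cdf_lim_at_top_prob)+
    show "mono (\<lambda>x. measure (Mn n) {..<x})" for n
    proof -
      interpret real_distribution "Mn n" by fact
      show ?thesis by (intro monoI finite_measure_mono) auto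
    qed
    show "measure (Mn n) {..<x} \<le> 1" for n x
    proof -
      interpret real_distribution "Mn n" by fact
      show ?thesis by simp
    qed
    show "(\<lambda>n. measure (Mn n) {..<x}) \<longlonglongrightarrow> measure A {..<x}" for x
      by (rule weak_conv_imp_continuity_set_conv[OF Mn A wc]) (use no_atoms in \<open>auto simp: frontier_def A.emeasure_eq_measure interior_open atMost_minus_lessThan\<close>)
  qed (use e in auto)
  then show "\<forall>\<^sub>F n in sequentially. dist (SUP x\<in>{0::real..}. \<bar>measure (Mn n) {..<x} - measure A {..<x}\<bar>) 0 < e"
  proof eventually_elim
    case (elim n)
    let ?f = "\<lambda>x. \<bar>measure (Mn n) {..<x} - measure A {..<x}\<bar>"
    have le: "(SUP x\<in>{0::real..}. ?f x) \<le> e / 2"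
      by (rule cSUP_least) (use elim in auto)
    have "?f 0 \<le> (SUP x\<in>{0::real..}. ?f x)"
      by (rule cSUP_upper) (use elim in \<open>auto intro!: bdd_aboveI[where M = "e / 2"]\<close>)
    then have "0 \<le> (SUP x\<in>{0::real..}. ?f x)" by linarith
    then show ?case using le e by (simp add: dist_real_def)
  qed
qed

section \<open>Random sums\<close>

lemma gamma_law_no_atoms: "AE g in gamma_law r. g \<noteq> c"
  unfolding gamma_law_def using AE_lborel_singleton[of c]
  by (subst AE_density) (auto elim!: eventually_mono)

text \<open>Given \<open>S = s > 0\<close>, the equation \<open>s * g powr c = x\<close> has at most
  one positive solution \<open>g\<close>, a null set for the gamma law.\<close>

lemma stable_gamma_no_atoms:
  assumes S: "real_distribution S" "AE s in S. 0 < s" and r: "0 < r" and c: "c \<noteq> 0"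
  shows "measure (mult_conv S (pow_law c (gamma_law r))) {x} = 0"
proof -
  let ?A = "mult_conv S (pow_law c (gamma_law r))"
  interpret S: real_distribution S by fact
  interpret G: real_distribution "gamma_law r" using r by simp
  have "emeasure ?A {x} = (\<integral>\<^sup>+y. indicator {x} y \<partial>?A)"
    by (simp add: mult_conv_def)
  also have "\<dots> = (\<integral>\<^sup>+s. \<integral>\<^sup>+y. indicator {x} (s * y) \<partial>pow_law c (gamma_law r) \<partial>S)"
    using S r by (subst nn_integral_mult_conv(1)) auto
  also have "\<dots> = (\<integral>\<^sup>+s. 0 \<partial>S)"
  proof (rule nn_integral_cong_AE)
    show "AE s in S. (\<integral>\<^sup>+y. indicator {x} (s * y) \<partial>pow_law c (gamma_law r)) = 0"
      using S(2)
    proof eventually_elim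
      case (elim s)
      have "(\<integral>\<^sup>+y. indicator {x} (s * y) \<partial>pow_law c (gamma_law r)) = (\<integral>\<^sup>+g. indicator {x} (s * g powr c) \<partial>gamma_law r)"
        unfolding pow_law_def by (subst nn_integral_distr) auto
      also have "\<dots> = (\<integral>\<^sup>+g. 0 \<partial>gamma_law r)"
      proof (rule nn_integral_cong_AE)
        show "AE g in gamma_law r. indicator {x} (s * g powr c) = (0 :: ennreal)"
          using gamma_law_no_atoms[where r = r and c = "(x / s) powr (1 / c)"] AE_gamma_law_pos[of r]
        proof eventually_elim
          case (elim g)
          have "s * g powr c \<noteq> x"
          proof
            assume "s * g powr c = x"
            then have "x / s = g powr c" using \<open>0 < s\<close> by auto
            then have "(x / s) powr (1 / c) = g" using elim c by (simp add: powr_powr)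
            then show False using elim by simp
          qed
          then show ?case by simp
        qed
      qed
      finally show ?case by simp
    qed
  qed
  finally show ?thesis by (simp add: measure_def)
qed

lemma laplace_tendsto:
  assumes M: "nonneg_law M" and X: "\<And>n. 0 \<le> X n" "X \<longlonglongrightarrow> a"
  shows "(\<lambda>n. laplace M (X n)) \<longlonglongrightarrow> laplace M a"
proof -
  interpret real_distribution M using M by simp
  show ?thesis
    unfolding laplace_def
  proof (rule integral_dominated_convergence[where w = "\<lambda>_. 1"])
    show "AE x in M. norm (exp (- X n * x)) \<le> 1" for n
      using nonneg_lawD(2)[OF M] by eventually_elim (use X(1)[of n] in simp)
    show "AE x in M. (\<lambda>n. exp (- X n * x)) \<longlonglongrightarrow> exp (- a * x)"
      by (intro AE_I2 tendsto_intros X)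
  qed auto
qed

text \<open>\<open>N\<close> is Poisson with random parameter \<open>U\<close>, and a Poisson
  variable with parameter \<open>u\<close> has generating function
  \<open>exp (- (1 - z) * u)\<close>. Averaging over \<open>U\<close>, which is \<open>c\<close>
  times a power of a gamma variable, gives a Laplace transform.\<close>

lemma gen_neg_binomial_pgf:
  assumes N: "gen_neg_binomial M N r a (1 / c powr a)" and r: "0 < r" and a: "a \<noteq> 0" and c: "0 < c"
    and z: "0 \<le> z" "z \<le> 1"
  shows "(\<Sum>k. ennreal (\<P>(\<omega> in M. N \<omega> = k)) * ennreal (z ^ k)) =
    ennreal (laplace (pow_law (1 / a) (gamma_law r)) (c * (1 - z)))"
proof -
  let ?H = "pow_law (1 / a) (gamma_law r)"
  let ?gg = "gg_density r a (1 / c powr a)"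
  define U where "U = gen_gamma r a (1 / c powr a)"
  have U_eq: "U = distr (gamma_law r) borel (\<lambda>g. c * g powr (1 / a))"
    unfolding U_def by (rule gen_gamma_eq_distr[OF r a c])
  interpret G: real_distribution "gamma_law r" using r by simp
  have U: "nonneg_law U"
    unfolding U_eq using c by (intro nonneg_law_distr G.prob_space_axioms) auto
  interpret U: real_distribution U using U by simp
  have [measurable]: "?gg \<in> borel_measurable borel"
    unfolding gg_density_def[abs_def] by measurable
  have gg: "0 \<le> ?gg x" for x
    using Gamma_real_pos[OF r] by (simp add: gg_density_def)
  have p: "ennreal (\<P>(\<omega> in M. N \<omega> = k)) = (\<integral>\<^sup>+u. ennreal (exp (- u) * u ^ k / fact k) \<partial>U)" for k
  proof -
    \<comment> \<open>A Poisson weight is one term of the series for \<open>exp u\<close>, divided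
      by \<open>exp u\<close>; being at most 1, it is integrable.\<close>
    have bound: "exp (- u) * u ^ k / fact k \<le> 1" if "0 \<le> u" for u :: real
    proof -
      have "(\<Sum>i\<in>{k}. u ^ i /\<^sub>R fact i) \<le> exp u"
        unfolding exp_def using that summable_exp_generic[of u]
        by (intro sum_le_suminf) auto
      then show ?thesis by (simp add: exp_minus field_simps)
    qed
    have "(\<integral>u\<in>{0..}. exp (- u) * u ^ k * ?gg u \<partial>lborel) =
        (\<integral>u. ?gg u *\<^sub>R (exp (- u) * u ^ k) \<partial>lborel)"
      unfolding set_lebesgue_integral_def
      by (intro Bochner_Integration.integral_cong refl) (auto simp: gg_density_def split: split_indicator)
    also have "\<dots> = (\<integral>u. exp (- u) * u ^ k \<partial>U)"
      unfolding U_def gen_gamma_def using gg by (subst integral_density) auto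
    finally have "\<P>(\<omega> in M. N \<omega> = k) = (\<integral>u. exp (- u) * u ^ k / fact k \<partial>U)"
      using N by (simp add: gen_neg_binomial_def)
    also have "ennreal (\<integral>u. exp (- u) * u ^ k / fact k \<partial>U) = (\<integral>\<^sup>+u. ennreal (exp (- u) * u ^ k / fact k) \<partial>U)"
    proof (rule nn_integral_eq_integral[symmetric])
      show "integrable U (\<lambda>u. exp (- u) * u ^ k / fact k)"
        by (rule integrable_bounded_nonneg[OF U, where B = 1]) (use bound in auto)
      show "AE u in U. 0 \<le> exp (- u) * u ^ k / fact k"
        using nonneg_lawD(2)[OF U] by eventually_elim simp
    qed
    finally show ?thesis .
  qed
  have "(\<Sum>k. ennreal (\<P>(\<omega> in M. N \<omega> = k)) * ennreal (z ^ k)) =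
      (\<Sum>k. \<integral>\<^sup>+u. ennreal (exp (- u) * u ^ k / fact k) * ennreal (z ^ k) \<partial>U)"
    unfolding p by (simp add: nn_integral_multc)
  also have "\<dots> = (\<integral>\<^sup>+u. (\<Sum>k. ennreal (exp (- u) * u ^ k / fact k) * ennreal (z ^ k)) \<partial>U)"
    by (rule nn_integral_suminf[symmetric]) simp
  also have "\<dots> = (\<integral>\<^sup>+u. ennreal (exp (- (1 - z) * u)) \<partial>U)"
  proof (rule nn_integral_cong_AE)
    show "AE u in U. (\<Sum>k. ennreal (exp (- u) * u ^ k / fact k) * ennreal (z ^ k)) = ennreal (exp (- (1 - z) * u))"
      using nonneg_lawD(2)[OF U]
    proof eventually_elim
      case (elim u)
      have "(\<lambda>k. exp (- u) * ((u * z) ^ k /\<^sub>R fact k)) sums (exp (- u) * exp (u * z))"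
        by (intro sums_mult exp_converges)
      then have "(\<lambda>k. exp (- u) * u ^ k / fact k * z ^ k) sums exp (- (1 - z) * u)"
        by (simp add: power_mult_distrib exp_add[symmetric] algebra_simps divide_inverse)
      then have "(\<Sum>k. ennreal (exp (- u) * u ^ k / fact k * z ^ k)) = ennreal (exp (- (1 - z) * u))"
        using elim z by (intro suminf_ennreal_eq) auto
      then show ?case using z by (simp only: ennreal_mult'' zero_le_power)
    qed
  qed
  also have "\<dots> = (\<integral>\<^sup>+g. ennreal (exp (- (c * (1 - z)) * g powr (1 / a))) \<partial>gamma_law r)"
    unfolding U_eq by (subst nn_integral_distr) (auto simp: algebra_simps)
  also have "\<dots> = (\<integral>\<^sup>+u. ennreal (exp (- (c * (1 - z)) * u)) \<partial>?H)"
    unfolding pow_law_def by (subst nn_integral_distr) auto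
  also have "\<dots> = ennreal (laplace ?H (c * (1 - z)))"
    using r c z by (intro nn_integral_exp_laplace) auto
  finally show ?thesis .
qed

text \<open>By \<open>1 - L \<le> - ln L \<le> (1 - L) / L\<close>, the quantity
  \<open>n * (1 - L n)\<close> lies between \<open>L n * y n\<close> and \<open>y n\<close>, and
  \<open>L n\<close> tends to 1 because \<open>y n / n\<close> tends to 0.\<close>

lemma power_limit_imp_linear_limit:
  fixes L :: "nat \<Rightarrow> real"
  assumes L: "\<And>n. 0 < L n" "\<And>n. L n \<le> 1" and lim: "(\<lambda>n. L n ^ n) \<longlonglongrightarrow> exp (- b)"
  shows "(\<lambda>n. real n * (1 - L n)) \<longlonglongrightarrow> b"
proof -
  define y where "y n = - (real n * ln (L n))" for n
  have y: "y \<longlonglongrightarrow> b"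
  proof -
    have "(\<lambda>n. - ln (L n ^ n)) \<longlonglongrightarrow> - ln (exp (- b))"
      by (intro tendsto_intros lim) simp
    then show ?thesis using L unfolding y_def[abs_def] by (simp add: ln_realpow)
  qed
  have L1: "L \<longlonglongrightarrow> 1"
  proof -
    have "(\<lambda>n. exp (- (y n * (1 / real n)))) \<longlonglongrightarrow> exp (- (b * 0))"
      by (intro tendsto_intros y lim_1_over_n)
    moreover have "\<forall>\<^sub>F n in sequentially. exp (- (y n * (1 / real n))) = L n"
      using eventually_gt_at_top[of 0] by eventually_elim (use L in \<open>simp add: y_def\<close>)
    ultimately show ?thesis by (simp add: tendsto_cong)
  qed
  show ?thesis
  proof (rule tendsto_sandwich)
    show "(\<lambda>n. L n * y n) \<longlonglongrightarrow> b" using tendsto_mult[OF L1 y] by simp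
    show "y \<longlonglongrightarrow> b" by fact
    show "\<forall>\<^sub>F n in sequentially. real n * (1 - L n) \<le> y n"
    proof (rule always_eventually, rule allI)
      fix n
      have "real n * ln (L n) \<le> real n * (L n - 1)"
        using ln_le_minus_one[OF L(1)[of n]] by (intro mult_left_mono) auto
      then show "real n * (1 - L n) \<le> y n" by (simp add: y_def algebra_simps)
    qed
    show "\<forall>\<^sub>F n in sequentially. L n * y n \<le> real n * (1 - L n)"
    proof (rule always_eventually, rule allI)
      fix n
      have "- ln (L n) \<le> 1 / L n - 1"
        using ln_le_minus_one[of "1 / L n"] L(1)[of n] by (simp add: ln_div)
      then have "L n * - ln (L n) \<le> L n * (1 / L n - 1)"
        using L(1)[of n] by (intro mult_left_mono) auto
      also have "\<dots> = 1 - L n" using L(1)[of n] by (simp add: algebra_simps)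
      finally have "real n * (L n * - ln (L n)) \<le> real n * (1 - L n)"
        by (intro mult_left_mono) auto
      then show "L n * y n \<le> real n * (1 - L n)" by (simp add: y_def mult_ac)
    qed
  qed
qed

text \<open>The index \<open>None\<close> puts \<open>N\<close> into one independent family with the
  summands. A weight \<open>h\<close> on \<open>N\<close> serves both statements: the constant 1 for
  a fixed number of summands, the indicator of \<open>k\<close> for the event
  \<open>N = k\<close>.\<close>

lemma nn_integral_exp_random_sum:
  fixes X :: "nat \<Rightarrow> 's \<Rightarrow> real" and N :: "'s \<Rightarrow> nat"
  assumes M: "prob_space M" and X_rv: "\<And>i. X i \<in> borel_measurable M"
    and X_ident: "\<And>i. distr M borel (X i) = distr M borel (X 0)"
    and N: "N \<in> measurable M (count_space UNIV)"
    and indep: "prob_space.indep_vars M (\<lambda>_. borel)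
        (\<lambda>j \<omega>. case j of None \<Rightarrow> real (N \<omega>) | Some i \<Rightarrow> X i \<omega>) UNIV"
  defines "L \<equiv> (\<lambda>t. \<integral>\<^sup>+x. ennreal (exp (- t * x)) \<partial>distr M borel (X 0))"
  shows "(\<integral>\<^sup>+\<omega>. ennreal (exp (- t * (\<Sum>i<k. X i \<omega>))) \<partial>M) = L t ^ k" (is ?sum)
    and "(\<integral>\<^sup>+\<omega>. ennreal (exp (- t * (\<Sum>i<N \<omega>. X i \<omega>))) \<partial>M) =
      (\<Sum>k. ennreal (\<P>(\<omega> in M. N \<omega> = k)) * L t ^ k)" (is ?random_sum)
proof -
  interpret prob_space M by fact
  note [measurable] = X_rv N
  have LX: "(\<integral>\<^sup>+\<omega>. ennreal (exp (- t * X i \<omega>)) \<partial>M) = L t" for i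
  proof -
    have "(\<integral>\<^sup>+\<omega>. ennreal (exp (- t * X i \<omega>)) \<partial>M) = (\<integral>\<^sup>+x. ennreal (exp (- t * x)) \<partial>distr M borel (X i))"
      by (subst nn_integral_distr) auto
    then show ?thesis by (simp only: X_ident[of i] L_def)
  qed
  have exp_sum: "ennreal (exp (- t * (\<Sum>i<k. X i \<omega>))) = (\<Prod>i<k. ennreal (exp (- t * X i \<omega>)))" for k \<omega>
    by (subst prod_ennreal) (auto simp: exp_sum[symmetric] sum_distrib_left)
  have prod: "(\<integral>\<^sup>+\<omega>. h (real (N \<omega>)) * (\<Prod>i<k. ennreal (exp (- t * X i \<omega>))) \<partial>M) =
      (\<integral>\<^sup>+\<omega>. h (real (N \<omega>)) \<partial>M) * L t ^ k"
    if h[measurable]: "h \<in> borel_measurable borel" for h :: "real \<Rightarrow> ennreal" and k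
  proof -
    define I where "I = insert None (Some ` {..<k})"
    define Y where "Y j = (\<lambda>x. case j of None \<Rightarrow> h x | Some i \<Rightarrow> ennreal (exp (- t * x)))" for j :: "nat option"
    have Y[measurable]: "Y j \<in> borel_measurable borel" for j
      unfolding Y_def by (cases j) auto
    let ?Z = "\<lambda>j \<omega>. case j of None \<Rightarrow> real (N \<omega>) | Some i \<Rightarrow> X i \<omega>"
    have "indep_vars (\<lambda>_. borel) (\<lambda>j \<omega>. Y j (?Z j \<omega>)) I"
      by (rule indep_vars_compose2[OF indep_vars_subset[OF indep]]) auto
    then have "(\<integral>\<^sup>+\<omega>. (\<Prod>j\<in>I. Y j (?Z j \<omega>)) \<partial>M) = (\<Prod>j\<in>I. \<integral>\<^sup>+\<omega>. Y j (?Z j \<omega>) \<partial>M)"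
      by (intro indep_vars_nn_integral) (auto simp: I_def)
    moreover have "(\<Prod>j\<in>I. F j) = F None * (\<Prod>i<k. F (Some i))" for F :: "nat option \<Rightarrow> ennreal"
      unfolding I_def by (subst prod.insert) (auto simp: prod.reindex)
    ultimately show ?thesis using LX by (simp add: Y_def)
  qed
  show ?sum
    using prod[of "\<lambda>_. 1" k] unfolding exp_sum by (simp add: emeasure_space_1)
  have pk: "(\<integral>\<^sup>+\<omega>. indicator {real k} (real (N \<omega>)) \<partial>M) = ennreal (\<P>(\<omega> in M. N \<omega> = k))" for k
  proof -
    have "(\<integral>\<^sup>+\<omega>. indicator {real k} (real (N \<omega>)) \<partial>M) = (\<integral>\<^sup>+\<omega>. indicator {\<omega> \<in> space M. N \<omega> = k} \<omega> \<partial>M)"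
      by (intro nn_integral_cong) (auto split: split_indicator)
    then show ?thesis by (simp add: emeasure_eq_measure)
  qed
  have "ennreal (exp (- t * (\<Sum>i<N \<omega>. X i \<omega>))) =
      (\<Sum>k. indicator {real k} (real (N \<omega>)) * (\<Prod>i<k. ennreal (exp (- t * X i \<omega>))))" for \<omega>
    unfolding exp_sum by (subst suminf_finite[of "{N \<omega>}"]) auto
  then have "(\<integral>\<^sup>+\<omega>. ennreal (exp (- t * (\<Sum>i<N \<omega>. X i \<omega>))) \<partial>M) =
      (\<Sum>k. \<integral>\<^sup>+\<omega>. indicator {real k} (real (N \<omega>)) * (\<Prod>i<k. ennreal (exp (- t * X i \<omega>))) \<partial>M)"
    by (simp add: nn_integral_suminf)
  also have "\<dots> = (\<Sum>k. (\<integral>\<^sup>+\<omega>. indicator {real k} (real (N \<omega>)) \<partial>M) * L t ^ k)"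
    by (subst prod) auto
  finally show ?random_sum unfolding pk .
qed

text \<open>The law of \<open>N n\<close> is prescribed for \<open>n \<ge> 1\<close> while the
  continuity theorem wants every index, hence the shift to \<open>Suc n\<close>. The random sum has
  the transform of \<open>U\<close> at \<open>n * (1 - L (s / n powr (1 / a)))\<close>, and the
  assumed convergence of the fixed sums says that the \<open>n\<close>-th powers of
  \<open>L (s / n powr (1 / a))\<close> tend to \<open>exp (- (s powr a))\<close>.\<close>

lemma random_sum_weak_conv:
  fixes M :: "'s measure" and X :: "nat \<Rightarrow> 's \<Rightarrow> real" and N :: "nat \<Rightarrow> 's \<Rightarrow> nat"
    and S :: "real measure" and a b r :: real
  assumes M: "prob_space M"
    and a: "0 < a"
    and S: "positive_stable a S"
    and X_rv: "\<And>i. X i \<in> borel_measurable M"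
    and X_nonneg: "\<And>i \<omega>. \<omega> \<in> space M \<Longrightarrow> X i \<omega> \<ge> 0"
    and X_ident: "\<And>i. distr M borel (X i) = distr M borel (X 0)"
    and conv: "weak_conv_m
        (\<lambda>n. distr M borel (\<lambda>\<omega>. (\<Sum>i<n. X i \<omega>) / real n powr (1 / a))) S"
    and r: "0 < r" and b: "b \<noteq> 0"
    and N_law: "\<And>n. n \<ge> 1 \<Longrightarrow> gen_neg_binomial M (N n) r b (1 / real n powr b)"
    and indep: "\<And>n. n \<ge> 1 \<Longrightarrow> prob_space.indep_vars M (\<lambda>_. borel)
        (\<lambda>j \<omega>. case j of None \<Rightarrow> real (N n \<omega>) | Some i \<Rightarrow> X i \<omega>) UNIV"
  defines "Y \<equiv> \<lambda>n \<omega>. (\<Sum>i<N (Suc n) \<omega>. X i \<omega>) / real (Suc n) powr (1 / a)"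
  shows "Y n \<in> borel_measurable M"
    and "weak_conv_m (\<lambda>n. distr M borel (Y n)) (mult_conv S (pow_law (1 / (a * b)) (gamma_law r)))"
proof -
  interpret prob_space M by fact
  note [measurable] = X_rv
  have N[measurable]: "N n \<in> measurable M (count_space UNIV)" if "n \<ge> 1" for n
    using N_law[OF that] by (simp add: gen_neg_binomial_def)
  have Y[measurable]: "Y n \<in> borel_measurable M" for n
  proof -
    have [measurable]: "N (Suc n) \<in> measurable M (count_space UNIV)" by (rule N) simp
    have "(\<lambda>\<omega>. \<Sum>i<N (Suc n) \<omega>. X i \<omega>) \<in> borel_measurable M"
      by (rule measurable_compose_countable[where f = "\<lambda>k \<omega>. \<Sum>i<k. X i \<omega>"]) auto
    then show ?thesis unfolding Y_def by simp
  qed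
  then show "Y n \<in> borel_measurable M" .
  let ?L = "laplace (distr M borel (X 0))"
  have X0: "nonneg_law (distr M borel (X 0))"
    by (intro nonneg_law_distr prob_space_axioms) (use X_nonneg in auto)
  have L: "(\<integral>\<^sup>+x. ennreal (exp (- t * x)) \<partial>distr M borel (X 0)) = ennreal (?L t)" if "0 \<le> t" for t
    by (rule nn_integral_exp_laplace[OF X0 that])
  define U where "U = pow_law (1 / b) (gamma_law r)"
  have U: "nonneg_law U" unfolding U_def using r by simp
  have A: "mult_conv S (pow_law (1 / (a * b)) (gamma_law r)) = mult_conv S (pow_law (1 / a) U)"
  proof -
    interpret G: real_distribution "gamma_law r" using r by simp
    show ?thesis by (simp add: U_def pow_law_pow_law mult.commute)
  qed
  have nY: "nonneg_law (distr M borel (Y n))" for n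
    by (intro nonneg_law_distr prob_space_axioms Y)
       (auto simp: Y_def intro!: AE_I2 divide_nonneg_nonneg sum_nonneg X_nonneg)
  have lapY: "laplace (distr M borel (Y n)) s =
      laplace U (real (Suc n) * (1 - ?L (s / real (Suc n) powr (1 / a))))" if s: "0 < s" for n s
  proof (rule laplace_eqI[OF nY])
    let ?t = "s / real (Suc n) powr (1 / a)"
    have t: "0 \<le> ?t" using s by simp
    note L01 = laplace_pos[OF X0 t] laplace_le_1[OF X0 t]
    show "0 \<le> laplace U (real (Suc n) * (1 - ?L ?t))"
      using L01 by (intro less_imp_le[OF laplace_pos[OF U]] mult_nonneg_nonneg) simp_all
    have "(\<integral>\<^sup>+x. ennreal (exp (- s * x)) \<partial>distr M borel (Y n)) = (\<integral>\<^sup>+\<omega>. ennreal (exp (- ?t * (\<Sum>i<N (Suc n) \<omega>. X i \<omega>))) \<partial>M)"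
      by (subst nn_integral_distr) (auto simp: Y_def)
    also have "\<dots> = (\<Sum>k. ennreal (\<P>(\<omega> in M. N (Suc n) \<omega> = k)) * (ennreal (?L ?t)) ^ k)"
      using nn_integral_exp_random_sum(2)[OF M X_rv X_ident N indep, of "Suc n" ?t] L[OF t] by simp
    also have "\<dots> = (\<Sum>k. ennreal (\<P>(\<omega> in M. N (Suc n) \<omega> = k)) * ennreal (?L ?t ^ k))"
      using L01 by (simp add: ennreal_power)
    also have "\<dots> = ennreal (laplace U (real (Suc n) * (1 - ?L ?t)))"
      unfolding U_def by (rule gen_neg_binomial_pgf[OF N_law r b]) (use L01 in auto)
    finally show "(\<integral>\<^sup>+x. ennreal (exp (- s * x)) \<partial>distr M borel (Y n)) =
        ennreal (laplace U (real (Suc n) * (1 - ?L ?t)))" .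
  qed (use s in simp)
  have limL: "(\<lambda>n. real n * (1 - ?L (s / real n powr (1 / a)))) \<longlonglongrightarrow> s powr a" if s: "0 < s" for s
  proof (rule power_limit_imp_linear_limit)
    fix n
    show "0 < ?L (s / real n powr (1 / a))" "?L (s / real n powr (1 / a)) \<le> 1"
      using s by (auto intro!: laplace_pos laplace_le_1 X0)
  next
    let ?Mn = "\<lambda>n. distr M borel (\<lambda>\<omega>. (\<Sum>i<n. X i \<omega>) / real n powr (1 / a))"
    have nn: "nonneg_law (?Mn n)" for n
      by (intro nonneg_law_distr prob_space_axioms)
         (auto intro!: AE_I2 divide_nonneg_nonneg sum_nonneg X_nonneg)
    have "(\<lambda>n. laplace (?Mn n) s) \<longlonglongrightarrow> laplace S s"
      by (rule laplace_weak_conv[OF nn _ conv]) (use S s in auto)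
    moreover have "laplace (?Mn n) s = ?L (s / real n powr (1 / a)) ^ n" for n
    proof (rule laplace_eqI[OF nn])
      let ?t = "s / real n powr (1 / a)"
      have t: "0 \<le> ?t" using s by simp
      show "0 \<le> ?L ?t ^ n" using laplace_pos[OF X0 t] by simp
      have "(\<integral>\<^sup>+x. ennreal (exp (- s * x)) \<partial>?Mn n) = (\<integral>\<^sup>+\<omega>. ennreal (exp (- ?t * (\<Sum>i<n. X i \<omega>))) \<partial>M)"
        by (subst nn_integral_distr) auto
      also have "\<dots> = ennreal (?L ?t) ^ n"
        using nn_integral_exp_random_sum(1)[OF M X_rv X_ident N indep, of 1 ?t n] L[OF t] by simp
      also have "\<dots> = ennreal (?L ?t ^ n)"
        using laplace_pos[OF X0 t] by (simp add: ennreal_power)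
      finally show "(\<integral>\<^sup>+x. ennreal (exp (- s * x)) \<partial>?Mn n) = ennreal (?L ?t ^ n)" .
    qed (use s in simp)
    ultimately show "(\<lambda>n. ?L (s / real n powr (1 / a)) ^ n) \<longlonglongrightarrow> exp (- (s powr a))"
      using S s by (simp add: positive_stable_def)
  qed
  show "weak_conv_m (\<lambda>n. distr M borel (Y n)) (mult_conv S (pow_law (1 / (a * b)) (gamma_law r)))"
    unfolding A
  proof (rule laplace_continuity[OF nY])
    show "nonneg_law (mult_conv S (pow_law (1 / a) U))" using S U by simp
    fix s :: real assume s: "0 < s"
    show "(\<lambda>n. laplace (distr M borel (Y n)) s) \<longlonglongrightarrow> laplace (mult_conv S (pow_law (1 / a) U)) s"
      unfolding lapY[OF s] laplace_stable_mixture[OF S a U less_imp_le[OF s]]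
    proof (rule laplace_tendsto[OF U])
      show "0 \<le> real (Suc n) * (1 - ?L (s / real (Suc n) powr (1 / a)))" for n
        using s by (intro mult_nonneg_nonneg) (auto intro!: laplace_le_1 X0)
      show "(\<lambda>n. real (Suc n) * (1 - ?L (s / real (Suc n) powr (1 / a)))) \<longlonglongrightarrow> s powr a"
        using limL[OF s] by (rule LIMSEQ_Suc)
    qed
  qed
qed

section \<open>The limit law and its representations\<close>

text \<open>Condition on the gamma variable: for \<open>g > 0\<close>,
  \<open>S * g powr c < x\<close> means \<open>S < x * g powr (- c)\<close>.\<close>

lemma mixed_distribution_function:
  assumes S: "real_distribution S" and r: "0 < r"
  shows "measure (mult_conv S (pow_law c (gamma_law r))) {..<x} =
    1 / Gamma r * (\<integral>z\<in>{0..}. measure S {..< x * z powr (- c)} * z powr (r - 1) * exp (- z) \<partial>lborel)"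
proof -
  let ?A = "mult_conv S (pow_law c (gamma_law r))"
  interpret S: real_distribution S by fact
  interpret G: real_distribution "gamma_law r" using r by simp
  interpret GS: pair_prob_space "gamma_law r" S ..
  define F where "F t = measure S {..<t}" for t
  have "mono F" unfolding F_def by (intro monoI S.finite_measure_mono) auto
  then have [measurable]: "F \<in> borel_measurable borel" by (rule borel_measurable_mono)
  have "emeasure ?A {..<x} =
      (\<integral>\<^sup>+y. indicator {..<x} y \<partial>?A)"
    by (simp add: mult_conv_def)
  also have "\<dots> = (\<integral>\<^sup>+y. \<integral>\<^sup>+s. indicator {..<x} (s * y) \<partial>S \<partial>pow_law c (gamma_law r))"
    using S r by (subst nn_integral_mult_conv(2)) auto
  also have "\<dots> = (\<integral>\<^sup>+g. \<integral>\<^sup>+s. indicator {..<x} (s * g powr c) \<partial>S \<partial>gamma_law r)"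
    unfolding pow_law_def by (subst nn_integral_distr) (auto intro!: S.borel_measurable_nn_integral)
  also have "\<dots> = (\<integral>\<^sup>+g. ennreal (F (x * g powr (- c))) \<partial>gamma_law r)"
  proof (rule nn_integral_cong_AE)
    show "AE g in gamma_law r. (\<integral>\<^sup>+s. indicator {..<x} (s * g powr c) \<partial>S) = ennreal (F (x * g powr (- c)))"
      using AE_gamma_law_pos[of r]
    proof eventually_elim
      case (elim g)
      have "(\<integral>\<^sup>+s. indicator {..<x} (s * g powr c) \<partial>S) = (\<integral>\<^sup>+s. indicator {..<x * g powr (- c)} s \<partial>S)"
        using elim by (intro nn_integral_cong) (auto simp: powr_minus field_simps split: split_indicator)
      then show ?case by (simp add: F_def S.emeasure_eq_measure)
    qed
  qed
  finally have "measure ?A {..<x} = (\<integral>g. F (x * g powr (- c)) \<partial>gamma_law r)"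
    by (subst integral_eq_nn_integral) (simp_all add: measure_def, simp add: F_def)
  also have "\<dots> = (\<integral>g. (if 0 \<le> g then g powr (r - 1) * exp (- g) / Gamma r else 0) *\<^sub>R F (x * g powr (- c)) \<partial>lborel)"
    unfolding gamma_law_def using Gamma_real_pos[OF r] by (subst integral_density) auto
  also have "\<dots> = (\<integral>g. 1 / Gamma r * (indicator {0..} g *\<^sub>R (F (x * g powr (- c)) * g powr (r - 1) * exp (- g))) \<partial>lborel)"
    by (intro Bochner_Integration.integral_cong refl) (auto split: split_indicator)
  finally show ?thesis
    unfolding set_lebesgue_integral_def F_def by simp
qed

lemma ratio_law_eq_mult_conv:
  assumes S: "nonneg_law S"
  shows "ratio_law S = mult_conv S (pow_law (- 1) S)"
proof -
  interpret S: real_distribution S using S by simp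
  have "ratio_law S = mult_conv (distr S borel (\<lambda>x. x)) (distr S borel (\<lambda>x. x powr (- 1)))"
    unfolding ratio_law_def
  proof (rule distr_pair_eq_mult_conv)
    have "AE y in S. x / y = x * y powr (- 1)" for x
      using nonneg_lawD(2)[OF S] by eventually_elim (simp add: powr_minus divide_inverse)
    then show "AE x in S. AE y in S. (case (x, y) of (s, s') \<Rightarrow> s / s') = x * y powr (- 1)" by simp
  qed (auto intro: S.prob_space_axioms)
  then show ?thesis by (simp add: pow_law_def distr_id2)
qed

lemma distr_pair_mult_conv:
  assumes M: "prob_space M" and N: "prob_space N"
    and f: "f \<in> borel_measurable M" and g: "g \<in> borel_measurable N"
  shows "distr (M \<Otimes>\<^sub>M N) borel (\<lambda>(x, y). f x * g y) = mult_conv (distr M borel f) (distr N borel g)"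
proof (rule distr_pair_eq_mult_conv[OF M N f g])
  note [measurable] = f g
  show "(\<lambda>(x, y). f x * g y) \<in> borel_measurable (M \<Otimes>\<^sub>M N)" by measurable
qed simp

text \<open>Everything reduces to \<open>G\<^sub>r = W / Z\<close>, \<open>W\<^bsup>1/b\<^esup> = W / T\<close> and \<open>W\<^bsup>1/a\<^esup> = W / S\<close> in law.\<close>

lemma stable_gamma_factorization:
  assumes S: "positive_stable a S" and T: "positive_stable b T"
    and a: "0 < a" and b: "0 < b" and r: "0 < r" "r < 1"
  defines "W \<equiv> weibull_law 1" and "Z \<equiv> Z_law r"
    and "D \<equiv> mult_conv (pow_law (- 1 / a) T) (pow_law (- 1 / (a * b)) (Z_law r))"
    and "A \<equiv> mult_conv S (pow_law (1 / (a * b)) (gamma_law r))"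
  shows "A = mult_conv S (mult_conv (pow_law (1 / (a * b)) W) (pow_law (- 1 / (a * b)) Z))"
    and "A = mult_conv (pow_law (1 / a) W) (mult_conv S D)"
    and "A = mult_conv W (mult_conv (mult_conv S (pow_law (- 1) S)) D)"
proof -
  have W: "nonneg_law W" unfolding W_def by (rule nonneg_law_weibull_1)
  have Z: "nonneg_law Z" unfolding Z_def using r by simp
  have nS: "nonneg_law S" and nT: "nonneg_law T" using S T by simp_all
  note [simp] = W Z nS nT nonneg_lawD(4)[OF W] nonneg_lawD(4)[OF Z]
    nonneg_lawD(4)[OF nT] nonneg_lawD(4)[OF nS]
  have G: "gamma_law r = mult_conv W (pow_law (- 1) Z)"
    unfolding W_def Z_def by (rule gamma_law_eq_exponential_over_Z[OF r])
  show 1: "A = mult_conv S (mult_conv (pow_law (1 / (a * b)) W) (pow_law (- 1 / (a * b)) Z))"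
    unfolding A_def G by (simp add: pow_law_mult_conv pow_law_pow_law)
  \<comment> \<open>The power is taken in two stages: the inner one of index \<open>b\<close> yields
    \<open>W / T\<close>, the outer one leaves \<open>W powr (1 / a)\<close>, which is converted to
    \<open>W / S\<close> only for the last identity.\<close>
  have "pow_law (1 / (a * b)) W = pow_law (1 / a) (pow_law (1 / b) W)"
    by (simp add: pow_law_pow_law mult.commute)
  also have "pow_law (1 / b) W = mult_conv W (pow_law (- 1) T)"
    unfolding W_def by (rule exponential_over_stable[OF T b])
  finally have WT: "pow_law (1 / (a * b)) W = mult_conv (pow_law (1 / a) W) (pow_law (- 1 / a) T)"
    by (simp add: pow_law_mult_conv pow_law_pow_law)
  show 2: "A = mult_conv (pow_law (1 / a) W) (mult_conv S D)"
    unfolding 1 WT D_def Z_def[symmetric]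
    by (simp add: mult_conv_assoc mult_conv_left_commute[of S])
  have WS: "pow_law (1 / a) W = mult_conv W (pow_law (- 1) S)"
    unfolding W_def by (rule exponential_over_stable[OF S a])
  have D: "nonneg_law D" unfolding D_def using r by simp
  show "A = mult_conv W (mult_conv (mult_conv S (pow_law (- 1) S)) D)"
    unfolding 2 WS using D by (simp add: mult_conv_assoc mult_conv_left_commute[of S])
qed

text \<open>The factor \<open>T\<close> of index \<open>b\<close> comes from the existence result.
  All factors other than \<open>W\<close> are collected in \<open>Q\<close>, and
  \<open>V = 1 / Q\<close> is positive because each of them is.\<close>

lemma stable_gamma_mixed_exponential:
  assumes S: "positive_stable a S" and a: "0 < a" and b: "0 < b" "b \<le> 1" and r: "0 < r" "r < 1"
  shows "mixed_exponential (mult_conv S (pow_law (1 / (a * b)) (gamma_law r)))"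
proof -
  obtain T where T: "positive_stable b T"
    using positive_stable_exists[OF b] by blast
  have nS: "nonneg_law S" and nT: "nonneg_law T" using S T by simp_all
  define Q where "Q = mult_conv (mult_conv S (pow_law (- 1) S))
      (mult_conv (pow_law (- 1 / a) T) (pow_law (- 1 / (a * b)) (Z_law r)))"
  have Q: "nonneg_law Q" unfolding Q_def using nS nT r by simp
  interpret Q: real_distribution Q using Q by simp
  have pos: "AE x in mult_conv M N. 0 < x"
    if "real_distribution M" "real_distribution N" "AE x in M. 0 < x" "AE x in N. 0 < x" for M N
    by (rule AE_mult_conv[OF that]) auto
  have Q_pos: "AE x in Q. 0 < x"
    unfolding Q_def using nS nT r positive_stable_AE_pos[OF S a] positive_stable_AE_pos[OF T b(1)]
    by (intro pos AE_pow_law_pos) auto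
  define V where "V = pow_law (- 1) Q"
  have V: "nonneg_law V" unfolding V_def using Q by simp
  interpret V: real_distribution V using V by simp
  have "distr (weibull_law 1 \<Otimes>\<^sub>M V) borel (\<lambda>(w, v). w / v) =
      mult_conv (distr (weibull_law 1) borel (\<lambda>x. x)) (distr V borel (\<lambda>x. x powr (- 1)))"
  proof (rule distr_pair_eq_mult_conv)
    have "AE v in V. w / v = w * v powr (- 1)" for w
      using nonneg_lawD(2)[OF V] by eventually_elim (simp add: powr_minus divide_inverse)
    then show "AE w in weibull_law 1. AE v in V. (case (w, v) of (w, v) \<Rightarrow> w / v) = w * v powr (- 1)" by simp
  qed (auto intro: W.prob_space_axioms V.prob_space_axioms)
  also have "\<dots> = mult_conv (weibull_law 1) (pow_law (- 1) V)"
    by (simp add: distr_id2 pow_law_def)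
  also have "pow_law (- 1) V = Q"
    unfolding V_def using Q by (simp add: pow_law_pow_law pow_law_1)
  also have "mult_conv (weibull_law 1) Q = mult_conv S (pow_law (1 / (a * b)) (gamma_law r))"
    unfolding Q_def by (rule stable_gamma_factorization(3)[OF S T a b(1) r, symmetric])
  finally have "mult_conv S (pow_law (1 / (a * b)) (gamma_law r)) = distr (weibull_law 1 \<Otimes>\<^sub>M V) borel (\<lambda>(w, v). w / v)" ..
  moreover have "AE v in V. 0 < v"
    unfolding V_def by (rule AE_pow_law_pos[OF _ Q_pos]) (use Q in simp)
  ultimately show ?thesis
    unfolding mixed_exponential_def using V.prob_space_axioms V.events_eq_borel by blast
qed

theorem theorem6:
  fixes M :: "'s measure" and X :: "nat \<Rightarrow> 's \<Rightarrow> real" and N :: "nat \<Rightarrow> 's \<Rightarrow> nat"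
    and S :: "real measure" and \<alpha> \<alpha>' r :: real
  assumes "prob_space M"
    and \<alpha>: "0 < \<alpha>" "\<alpha> < 1"
    and S: "one_sided_stable \<alpha> S"
    and X_rv: "\<And>i. X i \<in> borel_measurable M"
    and X_nonneg: "\<And>i \<omega>. \<omega> \<in> space M \<Longrightarrow> X i \<omega> \<ge> 0"
    and X_ident: "\<And>i. distr M borel (X i) = distr M borel (X 0)"
    and conv: "weak_conv_m
        (\<lambda>n. distr M borel (\<lambda>\<omega>. (\<Sum>i<n. X i \<omega>) / real n powr (1 / \<alpha>))) S"
    and r: "0 < r" and \<alpha>': "\<alpha>' \<noteq> 0"
    and N_law: "\<And>n. n \<ge> 1 \<Longrightarrow> gen_neg_binomial M (N n) r \<alpha>' (1 / real n powr \<alpha>')"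
    and indep: "\<And>n. n \<ge> 1 \<Longrightarrow> prob_space.indep_vars M (\<lambda>_. borel)
        (\<lambda>j \<omega>. case j of None \<Rightarrow> real (N n \<omega>) | Some i \<Rightarrow> X i \<omega>) UNIV"
  shows
    "let A = distr (S \<Otimes>\<^sub>M gamma_law r) borel (\<lambda>(s, g). s * g powr (1 / (\<alpha> * \<alpha>')))
     in
       (\<forall>x\<ge>0. measure A {..<x} =
          1 / Gamma r * (\<integral>z\<in>{0..}. measure S {..< x * z powr (- 1 / (\<alpha> * \<alpha>'))}
                                      * z powr (r - 1) * exp (- z) \<partial>lborel))
     \<and> (\<lambda>n. SUP x\<in>{0::real..}. \<bar>\<P>(\<omega> in M. (\<Sum>i<N n \<omega>. X i \<omega>) < real n powr (1 / \<alpha>) * x)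
                                  - measure A {..<x}\<bar>) \<longlonglongrightarrow> 0
     \<and> (r < 1 \<and> 0 < \<alpha>' \<and> \<alpha>' \<le> 1 \<longrightarrow>
          mixed_exponential A \<and> infinitely_divisible A \<and>
          (\<forall>S' ML. one_sided_stable \<alpha>' S' \<and> mittag_leffler \<alpha> ML \<longrightarrow>
            (let den = (\<lambda>s' z. s' powr (1 / \<alpha>) * z powr (1 / (\<alpha> * \<alpha>')));
                 R = ratio_law S; Z = Z_law r
             in
              A = distr (S \<Otimes>\<^sub>M gen_gamma r \<alpha>' 1) borel (\<lambda>(s, g). s * g powr (1 / \<alpha>))
            \<and> A = distr (weibull_law 1 \<Otimes>\<^sub>M (S \<Otimes>\<^sub>M (S' \<Otimes>\<^sub>M Z))) borel
                   (\<lambda>(w, s, s', z). w powr (1 / \<alpha>) * s / den s' z)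
            \<and> A = distr (weibull_law \<alpha> \<Otimes>\<^sub>M (S \<Otimes>\<^sub>M (S' \<Otimes>\<^sub>M Z))) borel
                   (\<lambda>(w, s, s', z). w * s / den s' z)
            \<and> A = distr (R \<Otimes>\<^sub>M (weibull_law 1 \<Otimes>\<^sub>M (S' \<Otimes>\<^sub>M Z))) borel
                   (\<lambda>(q, w, s', z). q * w / den s' z)
            \<and> A = distr (ML \<Otimes>\<^sub>M (S' \<Otimes>\<^sub>M Z)) borel
                   (\<lambda>(m, s', z). m / den s' z)
            \<and> A = distr (std_normal_law \<Otimes>\<^sub>M (weibull_law 1 \<Otimes>\<^sub>M (R \<Otimes>\<^sub>M (S' \<Otimes>\<^sub>M Z)))) borel
                   (\<lambda>(y, w, q, s', z). \<bar>y\<bar> * sqrt (2 * w) * q / den s' z)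
            \<and> A = distr (laplace_law \<Otimes>\<^sub>M (R \<Otimes>\<^sub>M (S' \<Otimes>\<^sub>M Z))) borel
                   (\<lambda>(l, q, s', z). \<bar>l\<bar> * q / den s' z)
            \<and> A = distr (S \<Otimes>\<^sub>M (weibull_law \<alpha>' \<Otimes>\<^sub>M Z)) borel
                   (\<lambda>(s, w, z). s * (w / z powr (1 / \<alpha>')) powr (1 / \<alpha>))
            \<and> A = distr (S \<Otimes>\<^sub>M (weibull_law (\<alpha> * \<alpha>') \<Otimes>\<^sub>M Z)) borel
                   (\<lambda>(s, w, z). s * w / z powr (1 / (\<alpha> * \<alpha>'))))))"
proof -
  interpret M: prob_space M by fact
  have pS: "positive_stable \<alpha> S"
    using one_sided_stable_imp_positive_stable[OF _ _ S] \<alpha> by simp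
  have nS: "nonneg_law S" using pS by simp
  interpret S: real_distribution S using nS by simp
  interpret G: real_distribution "gamma_law r" using r by simp
  define A where "A = distr (S \<Otimes>\<^sub>M gamma_law r) borel (\<lambda>(s, g). s * g powr (1 / (\<alpha> * \<alpha>')))"
  have A: "A = mult_conv S (pow_law (1 / (\<alpha> * \<alpha>')) (gamma_law r))"
    unfolding A_def
    by (subst distr_pair_mult_conv[of S "gamma_law r" "\<lambda>s. s"])
       (auto simp: distr_id2 pow_law_def S.prob_space_axioms G.prob_space_axioms)
  have c: "1 / (\<alpha> * \<alpha>') \<noteq> 0" using \<alpha> \<alpha>' by simp
  have rA: "real_distribution A" unfolding A using r nS by simp
  have df: "\<forall>x\<ge>0. measure A {..<x} =
          1 / Gamma r * (\<integral>z\<in>{0..}. measure S {..< x * z powr (- 1 / (\<alpha> * \<alpha>'))}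
                                      * z powr (r - 1) * exp (- z) \<partial>lborel)"
    unfolding A using mixed_distribution_function[OF S.real_distribution_axioms r, of "1 / (\<alpha> * \<alpha>')"] by simp
  have lim: "(\<lambda>n. SUP x\<in>{0::real..}. \<bar>\<P>(\<omega> in M. (\<Sum>i<N n \<omega>. X i \<omega>) < real n powr (1 / \<alpha>) * x)
                                  - measure A {..<x}\<bar>) \<longlonglongrightarrow> 0"
  proof -
    define Y where "Y n \<omega> = (\<Sum>i<N (Suc n) \<omega>. X i \<omega>) / real (Suc n) powr (1 / \<alpha>)" for n \<omega>
    note wc = random_sum_weak_conv[OF \<open>prob_space M\<close> \<alpha>(1) pS X_rv X_nonneg X_ident conv r \<alpha>' N_law indep]
    have Y[measurable]: "Y n \<in> borel_measurable M" for n
      using wc(1)[of n] by (simp add: Y_def[abs_def])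
    have "(\<lambda>n. SUP x\<in>{0::real..}. \<bar>measure (distr M borel (Y n)) {..<x} - measure A {..<x}\<bar>) \<longlonglongrightarrow> 0"
    proof (rule weak_conv_uniform)
      show "real_distribution (distr M borel (Y n))" for n
        by (intro real_distributionI M.prob_space_distr) auto
      show "weak_conv_m (\<lambda>n. distr M borel (Y n)) A"
        unfolding A Y_def[abs_def] using wc(2) by simp
      show "measure A {x} = 0" for x
        unfolding A by (rule stable_gamma_no_atoms[OF S.real_distribution_axioms positive_stable_AE_pos[OF pS \<alpha>(1)] r c])
    qed fact
    moreover have "measure (distr M borel (Y n)) {..<x} =
        \<P>(\<omega> in M. (\<Sum>i<N (Suc n) \<omega>. X i \<omega>) < real (Suc n) powr (1 / \<alpha>) * x)" for n x
    proof -
      have "0 < real (Suc n) powr (1 / \<alpha>)" by simp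
      then have "Y n -` {..<x} \<inter> space M = {\<omega> \<in> space M. (\<Sum>i<N (Suc n) \<omega>. X i \<omega>) < real (Suc n) powr (1 / \<alpha>) * x}"
        unfolding Y_def by (auto simp: pos_divide_less_eq mult.commute simp del: of_nat_Suc)
      then show ?thesis by (simp add: measure_distr)
    qed
    \<comment> \<open>Undo the shift: the term at \<open>n = 0\<close> does not affect the
      limit.\<close>
    ultimately show ?thesis
      by (subst filterlim_sequentially_Suc[symmetric]) simp
  qed
  have mixed: "mixed_exponential A" if "r < 1" "0 < \<alpha>'" "\<alpha>' \<le> 1"
    unfolding A by (rule stable_gamma_mixed_exponential[OF pS \<alpha>(1) that(2,3) r that(1)])
  {
    fix S' mlaw
    assume r1: "r < 1" and \<alpha>'01: "0 < \<alpha>'" "\<alpha>' \<le> 1"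
      and S': "one_sided_stable \<alpha>' S'" and ml: "mittag_leffler \<alpha> mlaw"
    have pS': "positive_stable \<alpha>' S'"
      by (rule one_sided_stable_imp_positive_stable[OF \<alpha>'01 S'])
    let ?W = "weibull_law 1" and ?Z = "Z_law r" and ?P = "S' \<Otimes>\<^sub>M Z_law r" and ?R = "ratio_law S"
    let ?c = "1 / (\<alpha> * \<alpha>')" and ?e = "- 1 / (\<alpha> * \<alpha>')" and ?WB = "weibull_law \<alpha>'" and ?WC = "weibull_law (\<alpha> * \<alpha>')"
    \<comment> \<open>The law of the reciprocal of the common denominator.\<close>
    define D where "D = mult_conv (pow_law (- 1 / \<alpha>) S') (pow_law ?e ?Z)"
    note fac = stable_gamma_factorization[OF pS pS' \<alpha>(1) \<alpha>'01(1) r r1, folded D_def A]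
    have nS': "nonneg_law S'" using pS' by simp
    interpret S': real_distribution S' using nS' by simp
    have nZ: "nonneg_law ?Z" using r r1 by simp
    interpret Z: real_distribution ?Z using nZ by simp
    have R: "?R = mult_conv S (pow_law (- 1) S)" by (rule ratio_law_eq_mult_conv[OF nS])
    have nR: "nonneg_law ?R" unfolding R using nS by simp
    interpret R: real_distribution ?R using nR by simp
    interpret L: real_distribution laplace_law by (rule real_distribution_laplace_law)
    interpret N: real_distribution std_normal_law
      unfolding std_normal_law_def by (rule real_dist_normal_dist)
    have mlaw_eq: "mlaw = mult_conv (pow_law (1 / \<alpha>) ?W) S" by (rule mittag_leffler_eq[OF pS \<alpha>(1) ml])
    have nML: "nonneg_law mlaw" unfolding mlaw_eq using nS by simp
    interpret mlaw: real_distribution mlaw using nML by simp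
    have W\<alpha>: "weibull_law b = pow_law (1 / b) ?W" "real_distribution (weibull_law b)" if "0 < b" for b
      using weibull_law_eq_pow_law[OF that] by simp_all
    interpret WA: real_distribution "weibull_law \<alpha>" using \<alpha> by (intro W\<alpha>)
    interpret WB: real_distribution ?WB using \<alpha>'01 by (intro W\<alpha>)
    interpret WC: real_distribution ?WC using \<alpha> \<alpha>'01 by (intro W\<alpha>) simp
    have nWB: "nonneg_law ?WB"
      using W\<alpha>(1)[OF \<alpha>'01(1)] by simp
    have nD: "nonneg_law D" unfolding D_def using nS' nZ by simp
    note [simp] = nonneg_law_weibull_1 nS nS' nZ nR nML nWB nD
    interpret SZ: pair_prob_space S' ?Z ..
    let ?den = "\<lambda>s' z. s' powr (1 / \<alpha>) * z powr ?c"
    let ?inv = "\<lambda>(s', z). s' powr (- 1 / \<alpha>) * z powr ?e"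
    have inv: "u / ?den s' z = u * ?inv (s', z)" for u s' z
      by (simp add: powr_minus divide_inverse)
    have [measurable]: "?inv \<in> borel_measurable ?P" by measurable
    have D: "distr ?P borel ?inv = D"
      unfolding D_def pow_law_def
      by (intro distr_pair_mult_conv) (auto intro: S'.prob_space_axioms Z.prob_space_axioms)
    \<comment> \<open>One numerator over the common denominator; \<open>three\<close> adds a second
      numerator by treating everything else as a single factor.\<close>
    have two: "distr (K \<Otimes>\<^sub>M ?P) borel F = mult_conv (distr K borel f) D"
      if K: "prob_space K" and f: "f \<in> borel_measurable K" and F: "\<And>x s z. F (x, s, z) = f x / ?den s z"
      for K :: "real measure" and f :: "real \<Rightarrow> real" and F
    proof -
      have "F = (\<lambda>(x, y). f x * ?inv y)" by (auto simp: fun_eq_iff F inv)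
      then show ?thesis
        unfolding D[symmetric]
        by (simp only:) (intro distr_pair_mult_conv, auto intro: K f SZ.prob_space_axioms)
    qed
    have three: "distr (H \<Otimes>\<^sub>M (K \<Otimes>\<^sub>M ?P)) borel F =
        mult_conv (distr H borel g) (mult_conv (distr K borel f) D)"
      if H: "prob_space H" and g: "g \<in> borel_measurable H" and K: "prob_space K" and f: "f \<in> borel_measurable K"
        and F: "\<And>w x s z. F (w, x, s, z) = g w * f x / ?den s z"
      for H K :: "real measure" and f g :: "real \<Rightarrow> real" and F
    proof -
      interpret K: prob_space K by fact
      interpret KSZ: pair_prob_space K ?P ..
      note [measurable] = f
      let ?h = "\<lambda>(x, s, z). f x / ?den s z"
      have "F = (\<lambda>(w, y). g w * ?h y)" by (auto simp: fun_eq_iff F)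
      moreover have "distr (K \<Otimes>\<^sub>M ?P) borel ?h = mult_conv (distr K borel f) D"
        by (rule two[OF K f]) simp
      moreover have "distr (H \<Otimes>\<^sub>M (K \<Otimes>\<^sub>M ?P)) borel (\<lambda>(w, y). g w * ?h y) =
          mult_conv (distr H borel g) (distr (K \<Otimes>\<^sub>M ?P) borel ?h)"
        by (intro distr_pair_mult_conv H g KSZ.prob_space_axioms) measurable
      ultimately show ?thesis by (simp only:)
    qed
    have id: "distr K borel (\<lambda>x. x) = K" if "real_distribution K" for K
    proof -
      interpret K: real_distribution K by fact
      show ?thesis by (simp add: distr_id2)
    qed
    have e1: "A = distr (S \<Otimes>\<^sub>M gen_gamma r \<alpha>' 1) borel (\<lambda>(s, g). s * g powr (1 / \<alpha>))" (is "_ = ?d")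
    proof -
      have gg: "gen_gamma r \<alpha>' 1 = pow_law (1 / \<alpha>') (gamma_law r)" by (rule gen_gamma_eq_pow_law[OF r \<alpha>'])
      interpret GG: real_distribution "gen_gamma r \<alpha>' 1" unfolding gg using r by simp
      have "?d =
          mult_conv (distr S borel (\<lambda>x. x)) (pow_law (1 / \<alpha>) (gen_gamma r \<alpha>' 1))"
        unfolding pow_law_def
        by (intro distr_pair_mult_conv) (auto intro: S.prob_space_axioms GG.prob_space_axioms)
      then show ?thesis unfolding A gg by (simp add: id pow_law_pow_law mult.commute)
    qed
    have e2: "A = distr (?W \<Otimes>\<^sub>M (S \<Otimes>\<^sub>M ?P)) borel (\<lambda>(w, s, s', z). w powr (1 / \<alpha>) * s / ?den s' z)" (is "_ = ?d")
    proof -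
      have "?d =
          mult_conv (distr ?W borel (\<lambda>w. w powr (1 / \<alpha>))) (mult_conv (distr S borel (\<lambda>x. x)) D)"
        by (rule three) (auto intro: W.prob_space_axioms S.prob_space_axioms)
      then show ?thesis using fac(2) by (simp only: id[OF S.real_distribution_axioms] pow_law_def)
    qed
    have e3: "A = distr (weibull_law \<alpha> \<Otimes>\<^sub>M (S \<Otimes>\<^sub>M ?P)) borel (\<lambda>(w, s, s', z). w * s / ?den s' z)" (is "_ = ?d")
    proof -
      have "?d =
          mult_conv (distr (weibull_law \<alpha>) borel (\<lambda>x. x)) (mult_conv (distr S borel (\<lambda>x. x)) D)"
        by (rule three) (auto intro: WA.prob_space_axioms S.prob_space_axioms)
      then show ?thesis
        using fac(2) by (simp only: id[OF S.real_distribution_axioms] id[OF W\<alpha>(2)[OF \<alpha>(1)]] W\<alpha>(1)[OF \<alpha>(1), symmetric])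
    qed
    have WRD: "A = mult_conv ?W (mult_conv ?R D)" using fac(3) by (simp add: R)
    have e4: "A = distr (?R \<Otimes>\<^sub>M (?W \<Otimes>\<^sub>M ?P)) borel (\<lambda>(q, w, s', z). q * w / ?den s' z)" (is "_ = ?d")
    proof -
      have "?d =
          mult_conv (distr ?R borel (\<lambda>x. x)) (mult_conv (distr ?W borel (\<lambda>x. x)) D)"
        by (rule three) (auto intro: W.prob_space_axioms R.prob_space_axioms)
      then show ?thesis
        using WRD mult_conv_left_commute[OF W.real_distribution_axioms R.real_distribution_axioms, of D] nD
        by (simp only: id[OF R.real_distribution_axioms] id[OF W.real_distribution_axioms] real_distribution_nonneg)
    qed
    have e5: "A = distr (mlaw \<Otimes>\<^sub>M ?P) borel (\<lambda>(m, s', z). m / ?den s' z)" (is "_ = ?d")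
    proof -
      have "?d =
          mult_conv (distr mlaw borel (\<lambda>x. x)) D"
        by (rule two) (auto intro: mlaw.prob_space_axioms)
      then show ?thesis
        unfolding id[OF mlaw.real_distribution_axioms] using fac(2) by (simp add: mlaw_eq mult_conv_assoc)
    qed
    have e6: "A = distr (std_normal_law \<Otimes>\<^sub>M (?W \<Otimes>\<^sub>M (?R \<Otimes>\<^sub>M ?P))) borel
        (\<lambda>(y, w, q, s', z). \<bar>y\<bar> * sqrt (2 * w) * q / ?den s' z)" (is "_ = ?d")
    proof -
      interpret RSZ: pair_prob_space ?R ?P ..
      interpret WRSZ: pair_prob_space ?W "?R \<Otimes>\<^sub>M ?P" ..
      let ?h = "\<lambda>(w, q, s', z). sqrt (2 * w) * q / ?den s' z"
      let ?V = "distr ?W borel (\<lambda>w. sqrt (2 * w))" and ?N = "distr std_normal_law borel abs"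
      have V: "real_distribution ?V" and N: "real_distribution ?N"
        by (auto intro!: real_distributionI W.prob_space_distr N.prob_space_distr)
      have "?d =
          distr (std_normal_law \<Otimes>\<^sub>M (?W \<Otimes>\<^sub>M (?R \<Otimes>\<^sub>M ?P))) borel
          (\<lambda>(y, v). \<bar>y\<bar> * ?h v)"
        by (intro arg_cong[where f = "distr _ _"]) (auto simp: fun_eq_iff)
      also have "\<dots> = mult_conv ?N (distr (?W \<Otimes>\<^sub>M (?R \<Otimes>\<^sub>M ?P)) borel ?h)"
        by (intro distr_pair_mult_conv N.prob_space_axioms WRSZ.prob_space_axioms) measurable
      also have "distr (?W \<Otimes>\<^sub>M (?R \<Otimes>\<^sub>M ?P)) borel ?h = mult_conv ?V (mult_conv (distr ?R borel (\<lambda>x. x)) D)"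
        by (rule three) (auto intro: W.prob_space_axioms R.prob_space_axioms)
      also have "distr ?R borel (\<lambda>x. x) = ?R" by (rule id[OF R.real_distribution_axioms])
      \<comment> \<open>Regrouping brings \<open>\<bar>X\<bar>\<close> and
        \<open>sqrt (2 * W)\<close> together; their product has the law of \<open>W\<close>.\<close>
      also have "mult_conv ?N (mult_conv ?V (mult_conv ?R D)) = mult_conv (mult_conv ?N ?V) (mult_conv ?R D)"
        using N V by (simp add: mult_conv_assoc)
      also have "\<dots> = A"
        unfolding normal_times_sqrt_exponential WRD ..
      finally show ?thesis ..
    qed
    have e7: "A = distr (laplace_law \<Otimes>\<^sub>M (?R \<Otimes>\<^sub>M ?P)) borel (\<lambda>(l, q, s', z). \<bar>l\<bar> * q / ?den s' z)" (is "_ = ?d")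
    proof -
      have "?d =
          mult_conv (distr laplace_law borel abs) (mult_conv (distr ?R borel (\<lambda>x. x)) D)"
        by (rule three) (auto intro: L.prob_space_axioms R.prob_space_axioms)
      then show ?thesis
        using WRD by (simp only: id[OF R.real_distribution_axioms] distr_abs_laplace_law)
    qed
    interpret WBZ: pair_prob_space ?WB ?Z ..
    interpret WCZ: pair_prob_space ?WC ?Z ..
    have e8: "A = distr (S \<Otimes>\<^sub>M (?WB \<Otimes>\<^sub>M ?Z)) borel
        (\<lambda>(s, w, z). s * (w / z powr (1 / \<alpha>')) powr (1 / \<alpha>))" (is "_ = ?d")
    proof -
      have "?d =
          mult_conv (distr S borel (\<lambda>x. x)) (distr (?WB \<Otimes>\<^sub>M ?Z) borel (\<lambda>(w, z). (w / z powr (1 / \<alpha>')) powr (1 / \<alpha>)))"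
        by (subst distr_pair_mult_conv[symmetric])
           (auto intro: S.prob_space_axioms WBZ.prob_space_axioms simp: case_prod_beta')
      also have "distr (?WB \<Otimes>\<^sub>M ?Z) borel (\<lambda>(w, z). (w / z powr (1 / \<alpha>')) powr (1 / \<alpha>)) =
          mult_conv (pow_law (1 / \<alpha>) ?WB) (pow_law ?e ?Z)"
        unfolding pow_law_def
        by (rule distr_pair_eq_mult_conv)
           (auto simp: powr_divide powr_powr powr_minus_divide mult.commute[of \<alpha>']
             intro: WB.prob_space_axioms Z.prob_space_axioms)
      also have "pow_law (1 / \<alpha>) ?WB = pow_law ?c ?W"
        using W\<alpha>(1)[OF \<alpha>'01(1)] by (simp add: pow_law_pow_law mult.commute)
      finally show ?thesis using fac(1) by (simp add: id)
    qed
    have e9: "A = distr (S \<Otimes>\<^sub>M (?WC \<Otimes>\<^sub>M ?Z)) borel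
        (\<lambda>(s, w, z). s * w / z powr ?c)" (is "_ = ?d")
    proof -
      have "?d =
          distr (S \<Otimes>\<^sub>M (?WC \<Otimes>\<^sub>M ?Z)) borel (\<lambda>(s, v). s * (\<lambda>(w, z). w * z powr ?e) v)"
        by (simp add: case_prod_beta' powr_minus divide_inverse mult.assoc)
      also have "\<dots> = mult_conv (distr S borel (\<lambda>x. x))
          (distr (?WC \<Otimes>\<^sub>M ?Z) borel (\<lambda>(w, z). w * z powr ?e))"
        by (rule distr_pair_mult_conv) (auto intro: S.prob_space_axioms WCZ.prob_space_axioms)
      also have "distr (?WC \<Otimes>\<^sub>M ?Z) borel (\<lambda>(w, z). w * z powr ?e) =
          mult_conv (distr ?WC borel (\<lambda>x. x)) (pow_law ?e ?Z)"
        unfolding pow_law_def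
        by (rule distr_pair_mult_conv) (auto intro: WC.prob_space_axioms Z.prob_space_axioms)
      finally show ?thesis
        using fac(1) W\<alpha>(1)[of "\<alpha> * \<alpha>'"] \<alpha> \<alpha>'01 by (simp add: id WC.real_distribution_axioms)
    qed
    note conjI[OF e1 conjI[OF e2 conjI[OF e3 conjI[OF e4 conjI[OF e5 conjI[OF e6 conjI[OF e7 conjI[OF e8 e9]]]]]]]]
  }
  note reps = this
  show ?thesis
    unfolding Let_def A_def[symmetric]
    using df lim mixed mixed_exponential_infinitely_divisible reps by blast
qed

end
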